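(* Let $E=E(\mathbf{n},\mathbf{c})$ be a uniform Cantor set with associated data $\Lambda$, $\{m_k\}_{k\in\Lambda}$, $\{s_k\}_{k\in\Lambda}$. Let $\mathbb{P}=\{P_k\}_{k=1}^\infty$ be an $\mathbf{n}$-matching sequence of positive probability vectors $P_k=(p_{k,1},\dots,p_{k,n_k})$, and let $\mu_{\mathbb{P}}$ be the measure on $E$ determined by $\mathbb{P}$. Then $\mu_{\mathbb{P}}$ is doubling on $E$ if and only if there is a constant $C>1$ such that $\mathbb{P}$ is $C$-uniform and, for each $k\in\Lambda$, the following conditions hold: (a) for all integers $1\leq t<m_k$, the vector $(P_{k+t},P_{k+t})$ is $C$-uniform and $$C^{-1}\prod_{j=1}^{t}p_{k+j,1}\leq\prod_{j=1}^{t}p_{k+j,n_{k+j}}\leq C\prod_{j=1}^{t}p_{k+j,1};$$ (b) the vector $(P_{k+m_k},P_{k+m_k})$ is $(C,s_k)$-uniform.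
   Context: Uniform Cantor set: let $\mathbf{n}=\{n_k\}_{k\ge1}$ be integers with $n_k\geq 2$ and $\mathbf{c}=\{c_k\}_{k\ge1}$ real numbers in $(0,1)$ with $(n_k-1)c_k<1$ for all $k$. Put $E_0=[0,1]$; $E_k$ is obtained from $E_{k-1}$ by deleting from every component $I$ of $E_{k-1}$ exactly $n_k-1$ open intervals, each of length $c_k|I|$, such that the remaining $n_k$ closed intervals are of equal length. Then $E(\mathbf{n},\mathbf{c})=\bigcap_{k\ge 0}E_k$, with the metric inherited from $\mathbb{R}$. Components of $E_k$ are called components of level $k$, and components of $E_{k-1}\setminus E_k$ gaps of level $k$. The length of a component of level $k$ is $\delta_k=\prod_{i=1}^k\frac{1-(n_i-1)c_i}{n_i}$ (with $\delta_0=1$) and the length of a gap of level $k$ is $\varepsilon_k=c_k\delta_{k-1}$. Words: $W_k=\{i_1\cdots i_k:1\le i_j\le n_j\}$, $W_0=\{\text{empty word}\}$, and $I_{\text{empty}}=[0,1]$. Inductively, for $w\in W_{k-1}$, $I_{w1},\dots,I_{wn_k}$ denote from left to right the $n_k$ components of level $k$ contained in $I_w$. Data: $\Lambda=\{k\ge1:\varepsilon_k<\delta_k\}$. For $k\in\Lambda$, $m_k$ is the unique positive integer with $\delta_{k+m_k}\le\varepsilon_k<\delta_{k+m_k-1}$, and $s_k$ is the unique positive integer with $s_k\delta_{k+m_k}+(s_k-1)\varepsilon_{k+m_k}\le\varepsilon_k<(s_k+1)\delta_{k+m_k}+s_k\varepsilon_{k+m_k}$. Vectors: a vector $P=(p_1,\dots,p_q)$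 is a positive probability vector if all $p_i>0$ and $\sum_i p_i=1$. For $C\ge1$ and an integer $1\le s\le q$, a vector $P=(p_1,\dots,p_q)$ with positive entries is $(C,s)$-uniform if $$C^{-1}\le\frac{p_{i+1}+\cdots+p_{i+l}}{p_{j+1}+\cdots+p_{j+l}}\le C$$ for all integers $i,j,l$ with $s\le l\le q$ and $0\le i\le j\le i+l\le j+l\le q$. It is $C$-uniform if it is $(C,1)$-uniform. A sequence of vectors is $C$-uniform if each of its members is. For $P=(p_1,\dots,p_q)$, $(P,P)=(p_1,\dots,p_q,p_1,\dots,p_q)$ denotes the concatenation. A sequence $\mathbb{P}=\{P_k\}_{k\ge1}$ of positive probability vectors is $\mathbf{n}$-matching if $P_k=(p_{k,1},\dots,p_{k,n_k})$ has $n_k$ entries for each $k$. Then $\mu_{\mathbb{P}}$ is the unique Borel probability measure on $E(\mathbf{n},\mathbf{c})$ with $\mu_{\mathbb{P}}(I_{wi})=p_{k,i}\,\mu_{\mathbb{P}}(I_w)$ for all $k\ge1$, $w\in W_{k-1}$, $1\le i\le n_k$ (where $\mu_{\mathbb{P}}(I)$ means $\mu_{\mathbb{P}}(I\cap E)$). A Borel regular measure $\mu$ on a metric space $X$ is doubling if there is a constant $C\ge1$ with $0<\mu(B(x,2r))\le C\mu(B(x,r))<\infty$ for all $x\in X$ and $r>0$. *)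

theory Defs
  imports "HOL-Probability.Probability"
begin

section \<open>Uniform Cantor sets\<close>

text \<open>The sequences \<open>n\<close>, \<open>c\<close> and \<open>P\<close> are indexed from 1; their values at 0 are irrelevant.\<close>

definition cantor_parameters :: "(nat \<Rightarrow> nat) \<Rightarrow> (nat \<Rightarrow> real) \<Rightarrow> bool" where
  "cantor_parameters n c \<longleftrightarrow>
     (\<forall>k\<ge>1. n k \<ge> 2 \<and> 0 < c k \<and> c k < 1 \<and> (real (n k) - 1) * c k < 1)"

text \<open>The gaps deleted from a compact interval \<open>I\<close>: from left to right, \<open>N - 1\<close> open intervals
  of length \<open>r * |I|\<close>, leaving \<open>N\<close> closed intervals of the common length \<open>l\<close>.\<close>

definition deleted_gaps :: "nat \<Rightarrow> real \<Rightarrow> real set \<Rightarrow> real set set" where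
  "deleted_gaps N r I =
     (let a = Inf I; d = Sup I - Inf I; g = r * d; l = (1 - (real N - 1) * r) / real N * d
      in (\<lambda>i. {a + real i * l + (real i - 1) * g <..< a + real i * (l + g)}) ` {1..<N})"

primrec cantor_level :: "(nat \<Rightarrow> nat) \<Rightarrow> (nat \<Rightarrow> real) \<Rightarrow> nat \<Rightarrow> real set" where
  "cantor_level n c 0 = {0..1}"
| "cantor_level n c (Suc k) =
     cantor_level n c k -
       (\<Union>I\<in>components (cantor_level n c k). \<Union>(deleted_gaps (n (Suc k)) (c (Suc k)) I))"

definition cantor_set :: "(nat \<Rightarrow> nat) \<Rightarrow> (nat \<Rightarrow> real) \<Rightarrow> real set" where
  "cantor_set n c = (\<Inter>k. cantor_level n c k)"

text \<open>\<open>\<delta>\<^sub>k\<close> and, for \<open>k \<ge> 1\<close>, \<open>\<epsilon>\<^sub>k\<close>.\<close>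

definition comp_length :: "(nat \<Rightarrow> nat) \<Rightarrow> (nat \<Rightarrow> real) \<Rightarrow> nat \<Rightarrow> real" where
  "comp_length n c k = (\<Prod>i=1..k. (1 - (real (n i) - 1) * c i) / real (n i))"

definition gap_length :: "(nat \<Rightarrow> nat) \<Rightarrow> (nat \<Rightarrow> real) \<Rightarrow> nat \<Rightarrow> real" where
  "gap_length n c k = c k * comp_length n c (k - 1)"

definition words :: "(nat \<Rightarrow> nat) \<Rightarrow> nat \<Rightarrow> nat list set" where
  "words n k = {w. length w = k \<and> (\<forall>j<k. 1 \<le> w ! j \<and> w ! j \<le> n (Suc j))}"

text \<open>\<open>word_interval n c w\<close> is \<open>I\<^sub>w\<close>. Passing from \<open>I\<^sub>w\<close> to its \<open>i\<close>-th child moves the left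
  endpoint past \<open>i - 1\<close> components and gaps of the next level. That these intervals are the
  components of the levels, in left-to-right order, is proved at the end of this section.\<close>

definition left_endpoint :: "(nat \<Rightarrow> nat) \<Rightarrow> (nat \<Rightarrow> real) \<Rightarrow> nat list \<Rightarrow> real" where
  "left_endpoint n c w =
     (\<Sum>j<length w. (real (w ! j) - 1) * (comp_length n c (Suc j) + gap_length n c (Suc j)))"

definition word_interval :: "(nat \<Rightarrow> nat) \<Rightarrow> (nat \<Rightarrow> real) \<Rightarrow> nat list \<Rightarrow> real set" where
  "word_interval n c w =
     {left_endpoint n c w .. left_endpoint n c w + comp_length n c (length w)}"

lemma comp_length_0 [simp]: "comp_length n c 0 = 1"
  by (simp add: comp_length_def)

lemma comp_length_Suc:
  "comp_length n c (Suc k) =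
     (1 - (real (n (Suc k)) - 1) * c (Suc k)) / real (n (Suc k)) * comp_length n c k"
  by (simp add: comp_length_def)

lemma comp_length_pos:
  assumes "cantor_parameters n c"
  shows "comp_length n c k > 0"
  unfolding comp_length_def
proof (rule prod_pos)
  fix i assume "i \<in> {1..k}"
  then have "n i \<ge> 2" "(real (n i) - 1) * c i < 1"
    using assms by (auto simp: cantor_parameters_def)
  then show "0 < (1 - (real (n i) - 1) * c i) / real (n i)" by auto
qed

lemma gap_length_pos:
  assumes "cantor_parameters n c" "k \<ge> 1"
  shows "gap_length n c k > 0"
  using assms comp_length_pos[OF assms(1)] by (auto simp: gap_length_def cantor_parameters_def)

lemma comp_length_split:
  assumes "cantor_parameters n c"
  shows "comp_length n c k =
    real (n (Suc k)) * comp_length n c (Suc k) + (real (n (Suc k)) - 1) * gap_length n c (Suc k)"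
proof -
  have "n (Suc k) \<ge> 2" using assms by (auto simp: cantor_parameters_def)
  then show ?thesis by (simp add: comp_length_Suc gap_length_def field_simps)
qed

lemma words_0: "words n 0 = {[]}"
  by (auto simp: words_def)

lemma words_Suc: "words n (Suc k) = {w @ [i] |w i. w \<in> words n k \<and> 1 \<le> i \<and> i \<le> n (Suc k)}"
proof (intro set_eqI iffI)
  fix v assume v: "v \<in> words n (Suc k)"
  then have ne: "v \<noteq> []" by (auto simp: words_def)
  have len: "length v = Suc k" using v by (simp add: words_def)
  have "butlast v \<in> words n k" using v by (auto simp: words_def nth_butlast)
  moreover have "last v = v ! k" using ne len by (simp add: last_conv_nth)
  then have "1 \<le> last v \<and> last v \<le> n (Suc k)" using v by (auto simp: words_def)
  moreover have "v = butlast v @ [last v]" using ne by simp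
  ultimately show "v \<in> {w @ [i] |w i. w \<in> words n k \<and> 1 \<le> i \<and> i \<le> n (Suc k)}" by blast
next
  fix v assume "v \<in> {w @ [i] |w i. w \<in> words n k \<and> 1 \<le> i \<and> i \<le> n (Suc k)}"
  then show "v \<in> words n (Suc k)" by (auto simp: words_def nth_append less_Suc_eq)
qed

lemma finite_words: "finite (words n k)"
proof (induction k)
  case (Suc k)
  have "words n (Suc k) = (\<lambda>(w, i). w @ [i]) ` (words n k \<times> {1..n (Suc k)})"
    unfolding words_Suc by auto
  then show ?case using Suc by simp
qed (simp add: words_0)

lemma left_endpoint_snoc:
  "left_endpoint n c (w @ [i]) = left_endpoint n c w +
     (real i - 1) * (comp_length n c (Suc (length w)) + gap_length n c (Suc (length w)))"
proof -
  have "(\<Sum>j<length w. (real ((w @ [i]) ! j) - 1) * (comp_length n c (Suc j) + gap_length n c (Suc j)))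
      = (\<Sum>j<length w. (real (w ! j) - 1) * (comp_length n c (Suc j) + gap_length n c (Suc j)))"
    by (rule sum.cong) (auto simp: nth_append)
  then show ?thesis by (simp add: left_endpoint_def)
qed

lemma interval_minus_gaps:
  fixes a l g :: real and N :: nat
  assumes "l > 0" "g > 0" "N \<ge> 1" and d: "d = real N * l + (real N - 1) * g"
  shows "{a..a + d} - (\<Union>i\<in>{1..<N}. {a + real i * l + (real i - 1) * g <..< a + real i * (l + g)})
    = (\<Union>i\<in>{1..N}. {a + (real i - 1) * (l + g) .. a + (real i - 1) * (l + g) + l})"
    (is "?L = ?R")
proof (intro set_eqI iffI)
  fix x assume x: "x \<in> ?L"
  define m where "m = nat \<lfloor>(x - a) / (l + g)\<rfloor>"
  have lg: "l + g > 0" using assms by simp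
  have "(x - a) / (l + g) \<ge> 0" using x lg by simp
  then have m: "real m \<le> (x - a) / (l + g)" "(x - a) / (l + g) < real m + 1"
    unfolding m_def by linarith+
  have m1: "real m * (l + g) \<le> x - a" "x - a < (real m + 1) * (l + g)"
    using m lg by (simp_all add: pos_le_divide_eq pos_divide_less_eq)
  have "x - a \<le> d" using x by simp
  also have "d < real N * (l + g)" using d assms by (simp add: algebra_simps)
  finally have "real m * (l + g) < real N * (l + g)" using m1 by simp
  then have mN: "m < N" using lg by simp
  have "x \<le> a + real m * (l + g) + l"
  proof (rule ccontr)
    assume gt: "\<not> ?thesis"
    have "Suc m \<noteq> N"
    proof
      assume "Suc m = N"
      then have "d = real m * (l + g) + l" using d by (auto simp: algebra_simps)
      then show False using gt x by simp
    qed
    then have "Suc m \<in> {1..<N}" using mN by simp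
    moreover have "x \<in> {a + real (Suc m) * l + (real (Suc m) - 1) * g <..< a + real (Suc m) * (l + g)}"
      using gt m1 by (simp add: algebra_simps)
    ultimately show False using x by blast
  qed
  then have "x \<in> {a + (real (Suc m) - 1) * (l + g) .. a + (real (Suc m) - 1) * (l + g) + l}"
    using m1 by simp
  moreover have "Suc m \<in> {1..N}" using mN by simp
  ultimately show "x \<in> ?R" by blast
next
  fix x assume "x \<in> ?R"
  then obtain i where i: "1 \<le> i" "i \<le> N" and
    x: "a + (real i - 1) * (l + g) \<le> x" "x \<le> a + (real i - 1) * (l + g) + l" by auto
  have lg: "l + g > 0" using assms by simp
  have "(real i - 1) * (l + g) \<le> (real N - 1) * (l + g)"
    using i lg by (intro mult_right_mono) auto
  then have up: "x \<le> a + d" using x d by (simp add: algebra_simps)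
  have "0 \<le> (real i - 1) * (l + g)" using i lg by simp
  then have lo: "a \<le> x" using x(1) by linarith
  have "x \<notin> {a + real j * l + (real j - 1) * g <..< a + real j * (l + g)}" for j
  proof
    assume j: "x \<in> {a + real j * l + (real j - 1) * g <..< a + real j * (l + g)}"
    show False
    proof (cases "j < i")
      case True
      then have "real j * (l + g) \<le> (real i - 1) * (l + g)"
        using lg by (intro mult_right_mono) auto
      then show False using x j by simp
    next
      case False
      then have "(real i - 1) * (l + g) \<le> (real j - 1) * (l + g)"
        using lg by (intro mult_right_mono) auto
      moreover have "real j * l + (real j - 1) * g = (real j - 1) * (l + g) + l"
        by (simp add: algebra_simps)
      ultimately show False using x j by simp
    qed
  qed
  moreover have "x \<in> {a..a + d}" using lo up by simp
  ultimately show "x \<in> ?L" by blast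
qed

lemma components_disjoint_closed_Union:
  fixes A :: "'a::topological_space set set"
  assumes "finite A" "pairwise disjnt A"
    and A: "\<And>I. I \<in> A \<Longrightarrow> closed I \<and> connected I \<and> I \<noteq> {}"
  shows "components (\<Union>A) = A"
proof -
  have sub: "T \<subseteq> I" if "connected T" "T \<subseteq> \<Union>A" "I \<in> A" "x \<in> I" "x \<in> T" for T I x
  proof -
    have "closed (\<Union>(A - {I}))" using assms(1) A by (intro closed_Union) auto
    moreover have "T \<subseteq> I \<union> \<Union>(A - {I})" using that by auto
    moreover have "I \<inter> \<Union>(A - {I}) = {}"
      using assms(2) \<open>I \<in> A\<close> by (auto simp: pairwise_def disjnt_def)
    ultimately have "I \<inter> T = {} \<or> \<Union>(A - {I}) \<inter> T = {}"
      using connected_closedD[OF that(1), of I "\<Union>(A - {I})"] A that(3) by (metis inf_bot_left)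
    then show ?thesis using that(2,4,5) by blast
  qed
  have cc: "connected_component_set (\<Union>A) x = I" if "I \<in> A" "x \<in> I" for I x
  proof
    show "connected_component_set (\<Union>A) x \<subseteq> I"
    proof (rule sub[OF _ _ that])
      show "x \<in> connected_component_set (\<Union>A) x"
        using that by (simp add: connected_component_refl_eq) blast
    qed (simp_all add: connected_component_subset connected_connected_component)
    show "I \<subseteq> connected_component_set (\<Union>A) x"
      by (rule connected_component_maximal) (use that A in blast)+
  qed
  show ?thesis
  proof
    show "components (\<Union>A) \<subseteq> A" using cc by (auto simp: components_def)
    show "A \<subseteq> components (\<Union>A)"
    proof
      fix I assume I: "I \<in> A"
      then obtain x where "x \<in> I" using A by blast
      then show "I \<in> components (\<Union>A)"
        using I cc[OF I, of x] unfolding components_def by blast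
    qed
  qed
qed

lemma deleted_gaps_word_interval:
  assumes "cantor_parameters n c" "w \<in> words n k"
  shows "deleted_gaps (n (Suc k)) (c (Suc k)) (word_interval n c w) =
    (\<lambda>i. {left_endpoint n c w + real i * comp_length n c (Suc k) + (real i - 1) * gap_length n c (Suc k)
        <..< left_endpoint n c w + real i * (comp_length n c (Suc k) + gap_length n c (Suc k))})
      ` {1..<n (Suc k)}"
proof -
  have len: "length w = k" using assms by (simp add: words_def)
  have g: "c (Suc k) * comp_length n c k = gap_length n c (Suc k)" by (simp add: gap_length_def)
  have l: "(1 - (real (n (Suc k)) - 1) * c (Suc k)) / real (n (Suc k)) * comp_length n c k
      = comp_length n c (Suc k)"
    by (simp add: comp_length_Suc)
  have IS: "Inf (word_interval n c w) = left_endpoint n c w"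
    "Sup (word_interval n c w) - left_endpoint n c w = comp_length n c k"
    using comp_length_pos[OF assms(1), of k] by (simp_all add: word_interval_def len)
  show ?thesis unfolding deleted_gaps_def Let_def IS l g ..
qed

lemma word_interval_minus_gaps:
  assumes "cantor_parameters n c" "w \<in> words n k"
  shows "word_interval n c w - \<Union>(deleted_gaps (n (Suc k)) (c (Suc k)) (word_interval n c w))
    = (\<Union>i\<in>{1..n (Suc k)}. word_interval n c (w @ [i]))"
proof -
  have len: "length w = k" using assms by (simp add: words_def)
  have "n (Suc k) \<ge> 2" using assms(1) by (simp add: cantor_parameters_def)
  then have N: "n (Suc k) \<ge> 1" by simp
  have pos: "comp_length n c (Suc k) > 0" "gap_length n c (Suc k) > 0"
    using assms comp_length_pos gap_length_pos by auto
  show ?thesis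
    unfolding deleted_gaps_word_interval[OF assms]
    using interval_minus_gaps[OF pos N comp_length_split[OF assms(1), of k],
        of "left_endpoint n c w"]
    by (simp add: word_interval_def len left_endpoint_snoc)
qed

lemma word_interval_child_subset:
  assumes "cantor_parameters n c" "w \<in> words n k" "1 \<le> i" "i \<le> n (Suc k)"
  shows "word_interval n c (w @ [i]) \<subseteq> word_interval n c w"
proof -
  have "i \<in> {1..n (Suc k)}" using assms(3,4) by simp
  then have "word_interval n c (w @ [i]) \<subseteq> (\<Union>i\<in>{1..n (Suc k)}. word_interval n c (w @ [i]))"
    by blast
  also have "\<dots> \<subseteq> word_interval n c w"
    unfolding word_interval_minus_gaps[OF assms(1,2), symmetric] by (rule Diff_subset)
  finally show ?thesis .
qed

lemma word_interval_children_ordered: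
  assumes "cantor_parameters n c" "w \<in> words n k" "i < j"
    "x \<in> word_interval n c (w @ [i])" "y \<in> word_interval n c (w @ [j])"
  shows "x < y"
proof -
  have len: "length w = k" using assms by (simp add: words_def)
  let ?l = "comp_length n c (Suc k)" and ?g = "gap_length n c (Suc k)"
  have pos: "?l > 0" "?g > 0" using assms comp_length_pos gap_length_pos by auto
  have "real i * (?l + ?g) \<le> (real j - 1) * (?l + ?g)"
    using assms(3) pos by (intro mult_right_mono) auto
  moreover have "x \<le> left_endpoint n c w + (real i - 1) * (?l + ?g) + ?l"
    "y \<ge> left_endpoint n c w + (real j - 1) * (?l + ?g)"
    using assms(4,5) by (auto simp: word_interval_def len left_endpoint_snoc)
  ultimately show ?thesis using pos by (simp add: algebra_simps)
qed

lemma word_interval_disjoint: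
  assumes "cantor_parameters n c"
  shows "v \<in> words n k \<Longrightarrow> w \<in> words n k \<Longrightarrow> v \<noteq> w \<Longrightarrow>
    word_interval n c v \<inter> word_interval n c w = {}"
proof (induction k arbitrary: v w)
  case (Suc k)
  obtain v' i where v: "v = v' @ [i]" "v' \<in> words n k" "1 \<le> i" "i \<le> n (Suc k)"
    using Suc.prems(1) by (auto simp: words_Suc)
  obtain w' j where w: "w = w' @ [j]" "w' \<in> words n k" "1 \<le> j" "j \<le> n (Suc k)"
    using Suc.prems(2) by (auto simp: words_Suc)
  show ?case
  proof (cases "v' = w'")
    case True
    then have "i < j \<or> j < i" using Suc.prems(3) v w by auto
    then show ?thesis
      using word_interval_children_ordered[OF assms v(2)] True v(1) w(1) by fastforce
  next
    case False
    then show ?thesis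
      using Suc.IH[OF v(2) w(2)] word_interval_child_subset[OF assms v(2-4)]
        word_interval_child_subset[OF assms w(2-4)] v(1) w(1) by blast
  qed
qed (simp add: words_0)

lemma word_interval_nonempty:
  assumes "cantor_parameters n c"
  shows "word_interval n c w \<noteq> {}"
  using comp_length_pos[OF assms, of "length w"] by (simp add: word_interval_def)

lemma inj_on_word_interval:
  assumes "cantor_parameters n c"
  shows "inj_on (word_interval n c) (words n k)"
proof (rule inj_onI, rule ccontr)
  fix v w
  assume "v \<in> words n k" "w \<in> words n k" "word_interval n c v = word_interval n c w" "v \<noteq> w"
  then show False
    using word_interval_disjoint[OF assms, of v k w] word_interval_nonempty[OF assms, of w] by simp
qed

lemma components_Union_word_interval:
  assumes "cantor_parameters n c"
  shows "components (\<Union>(word_interval n c ` words n k)) = word_interval n c ` words n k"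
proof (rule components_disjoint_closed_Union)
  show "pairwise disjnt (word_interval n c ` words n k)"
    unfolding pairwise_def disjnt_def using word_interval_disjoint[OF assms] by blast
qed (use word_interval_nonempty[OF assms] in \<open>auto simp: word_interval_def finite_words\<close>)

lemma UN_diff_UN_disjoint:
  assumes "\<And>w. w \<in> W \<Longrightarrow> G w \<subseteq> I w"
    and "\<And>v w. v \<in> W \<Longrightarrow> w \<in> W \<Longrightarrow> v \<noteq> w \<Longrightarrow> I v \<inter> I w = {}"
  shows "\<Union>(I ` W) - (\<Union>w\<in>W. G w) = (\<Union>w\<in>W. I w - G w)"
proof
  show "(\<Union>w\<in>W. I w - G w) \<subseteq> \<Union>(I ` W) - (\<Union>w\<in>W. G w)"
  proof
    fix x assume "x \<in> (\<Union>w\<in>W. I w - G w)"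
    then obtain w where w: "w \<in> W" "x \<in> I w" "x \<notin> G w" by blast
    have "x \<notin> G v" if "v \<in> W" for v
      using assms(1)[OF that] assms(2)[OF that w(1)] w by (cases "v = w") auto
    then show "x \<in> \<Union>(I ` W) - (\<Union>w\<in>W. G w)" using w by auto
  qed
qed auto

lemma cantor_level_eq:
  assumes "cantor_parameters n c"
  shows "cantor_level n c k = \<Union>(word_interval n c ` words n k)"
proof (induction k)
  case 0
  then show ?case by (simp add: words_0 word_interval_def left_endpoint_def)
next
  case (Suc k)
  let ?G = "\<lambda>w. \<Union>(deleted_gaps (n (Suc k)) (c (Suc k)) (word_interval n c w))"
  have sub: "?G w \<subseteq> word_interval n c w" if "w \<in> words n k" for w
  proof
    fix x assume "x \<in> ?G w"
    then obtain i where i: "1 \<le> i" "i < n (Suc k)"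
      and x: "left_endpoint n c w + real i * comp_length n c (Suc k) + (real i - 1) * gap_length n c (Suc k) < x"
        "x < left_endpoint n c w + real i * (comp_length n c (Suc k) + gap_length n c (Suc k))"
      by (auto simp: deleted_gaps_word_interval[OF assms \<open>w \<in> words n k\<close>])
    let ?l = "comp_length n c (Suc k)" and ?g = "gap_length n c (Suc k)"
    have pos: "?l > 0" "?g > 0" using assms comp_length_pos gap_length_pos by auto
    have "real i * (?l + ?g) \<le> (real (n (Suc k)) - 1) * (?l + ?g)"
      using i pos by (intro mult_right_mono) auto
    then have "x \<le> left_endpoint n c w + comp_length n c k"
      using x pos comp_length_split[OF assms, of k] by (simp add: algebra_simps)
    moreover have "0 \<le> real i * ?l" "0 \<le> (real i - 1) * ?g" using i pos by simp_all
    ultimately show "x \<in> word_interval n c w"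
      using x that by (simp add: word_interval_def words_def)
  qed
  have "cantor_level n c (Suc k) =
      \<Union>(word_interval n c ` words n k) - (\<Union>w\<in>words n k. ?G w)"
    by (simp add: Suc components_Union_word_interval[OF assms])
  also have "\<dots> = (\<Union>w\<in>words n k. word_interval n c w - ?G w)"
    using sub word_interval_disjoint[OF assms] by (rule UN_diff_UN_disjoint)
  also have "\<dots> = (\<Union>w\<in>words n k. \<Union>i\<in>{1..n (Suc k)}. word_interval n c (w @ [i]))"
    using word_interval_minus_gaps[OF assms] by (intro SUP_cong) auto
  also have "\<dots> = \<Union>(word_interval n c ` words n (Suc k))"
  proof -
    have "words n (Suc k) = (\<Union>w\<in>words n k. (\<lambda>i. w @ [i]) ` {1..n (Suc k)})"
      unfolding words_Suc by auto
    then show ?thesis by (simp only: image_UN image_image) blast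
  qed
  finally show ?case .
qed

theorem components_cantor_level:
  assumes "cantor_parameters n c"
  shows "bij_betw (word_interval n c) (words n k) (components (cantor_level n c k))"
  using inj_on_word_interval[OF assms] components_Union_word_interval[OF assms]
  by (simp add: bij_betw_def cantor_level_eq[OF assms])

section \<open>Associated data\<close>

definition Lam :: "(nat \<Rightarrow> nat) \<Rightarrow> (nat \<Rightarrow> real) \<Rightarrow> nat set" where
  "Lam n c = {k. k \<ge> 1 \<and> gap_length n c k < comp_length n c k}"

definition m_data :: "(nat \<Rightarrow> nat) \<Rightarrow> (nat \<Rightarrow> real) \<Rightarrow> nat \<Rightarrow> nat" where
  "m_data n c k = (THE m. m \<ge> 1 \<and> comp_length n c (k + m) \<le> gap_length n c k
      \<and> gap_length n c k < comp_length n c (k + m - 1))"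

definition s_data :: "(nat \<Rightarrow> nat) \<Rightarrow> (nat \<Rightarrow> real) \<Rightarrow> nat \<Rightarrow> nat" where
  "s_data n c k = (let K = k + m_data n c k in
     THE s. s \<ge> 1
      \<and> real s * comp_length n c K + (real s - 1) * gap_length n c K \<le> gap_length n c k
      \<and> gap_length n c k < (real s + 1) * comp_length n c K + real s * gap_length n c K)"

section \<open>Vectors\<close>

text \<open>A vector \<open>(p\<^sub>1, \<dots>, p\<^sub>q)\<close> is a list, so \<open>p\<^sub>i\<close> is \<open>p ! (i - 1)\<close>.\<close>

definition positive_probability_vector :: "real list \<Rightarrow> bool" where
  "positive_probability_vector p \<longleftrightarrow> (\<forall>x\<in>set p. 0 < x) \<and> sum_list p = 1"

text \<open>Meant for \<open>C \<ge> 1\<close> and \<open>1 \<le> s \<le> length p\<close>. The sum \<open>p\<^bsub>i+1\<^esub> + \<dots> + p\<^bsub>i+l\<^esub>\<close> is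
  \<open>\<Sum>t=i..<i+l. p ! t\<close>.\<close>

definition s_uniform :: "real \<Rightarrow> nat \<Rightarrow> real list \<Rightarrow> bool" where
  "s_uniform C s p \<longleftrightarrow> (\<forall>x\<in>set p. 0 < x) \<and>
     (\<forall>i j l. s \<le> l \<and> l \<le> length p \<and> i \<le> j \<and> j \<le> i + l \<and> i + l \<le> j + l \<and> j + l \<le> length p \<longrightarrow>
        1 / C \<le> (\<Sum>t=i..<i+l. p ! t) / (\<Sum>t=j..<j+l. p ! t) \<and>
        (\<Sum>t=i..<i+l. p ! t) / (\<Sum>t=j..<j+l. p ! t) \<le> C)"

abbreviation uniform_vector :: "real \<Rightarrow> real list \<Rightarrow> bool" where
  "uniform_vector C \<equiv> s_uniform C 1"

definition matching :: "(nat \<Rightarrow> nat) \<Rightarrow> (nat \<Rightarrow> real list) \<Rightarrow> bool" where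
  "matching n P \<longleftrightarrow> (\<forall>k\<ge>1. length (P k) = n k)"

section \<open>Measures\<close>

text \<open>\<open>\<mu>\<close> is the Borel probability measure on the Cantor set determined by \<open>P\<close>.\<close>

definition determined_measure ::
  "(nat \<Rightarrow> nat) \<Rightarrow> (nat \<Rightarrow> real) \<Rightarrow> (nat \<Rightarrow> real list) \<Rightarrow> real measure \<Rightarrow> bool" where
  "determined_measure n c P \<mu> \<longleftrightarrow>
     sets \<mu> = sets (restrict_space borel (cantor_set n c)) \<and> prob_space \<mu> \<and>
     (\<forall>k\<ge>1. \<forall>w\<in>words n (k - 1). \<forall>i\<in>{1..n k}.
        measure \<mu> (word_interval n c (w @ [i]) \<inter> cantor_set n c) =
          P k ! (i - 1) * measure \<mu> (word_interval n c w \<inter> cantor_set n c))"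

text \<open>Doubling Borel measures on a subset \<open>X\<close> of a metric space with the inherited metric:
  the ball of \<open>X\<close> is \<open>ball x r \<inter> X\<close>. (A doubling measure is finite on balls, hence locally
  finite, so its extension from the Borel sets to an outer measure is Borel regular.)\<close>

definition doubling_on :: "'a::metric_space set \<Rightarrow> 'a measure \<Rightarrow> bool" where
  "doubling_on X \<mu> \<longleftrightarrow> sets \<mu> = sets (restrict_space borel X) \<and>
     (\<exists>C\<ge>1. \<forall>x\<in>X. \<forall>r>0.
        0 < emeasure \<mu> (ball x (2 * r) \<inter> X) \<and>
        emeasure \<mu> (ball x (2 * r) \<inter> X) \<le> ennreal C * emeasure \<mu> (ball x r \<inter> X) \<and>
        ennreal C * emeasure \<mu> (ball x r \<inter> X) < \<infinity>)"

end

theory Submission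
  imports Defs
begin

text \<open>
  A ball of radius \<open>r\<close> with \<open>\<delta>\<^bsub>k+1\<^esub> < 2r \<le> \<delta>\<^sub>k\<close> sees the Cantor set as a row of components of level \<open>k + 1\<close>:
  up to bounded factors its mass is that of a block of children of one component of level \<open>k\<close>, and
  the ball of twice the radius adds a longer block in the same component and, if a gap of length
  less than \<open>2r\<close> is near, a block of children at the facing end of a neighbouring component.
  Doubling therefore amounts to two kinds of comparison. Blocks of equal length inside one
  component have to be comparable when they overlap or touch, which is the uniformity of the
  vectors. And when two neighbouring components of level \<open>k\<close> are separated by a gap shorter than
  themselves, their masses have to be comparable, and the first \<open>l\<close> entries of \<open>P\<^bsub>k+1\<^esub>\<close> have to have a
  sum comparable to that of the last \<open>l\<close>, provided that the gap is not much longer than a block of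
  \<open>l\<close> children; across a longer gap no ball of that size can see both blocks. This second kind is
  called balance below (\<open>left_bounded_by_right\<close>, for the weights and for the reversed weights).

  The gap between two neighbours of level \<open>k\<close> is a gap of some level \<open>j \<le> k\<close>, and the neighbours are
  reached from two siblings of level \<open>j\<close> by passing \<open>t = k - j\<close> times to the last child on the left
  and to the first child on the right. Hence the ratio of their masses is a ratio of two
  consecutive entries of \<open>P\<^sub>j\<close> times the ratio of the two products in condition (a). That the gap is
  shorter than the neighbours means \<open>j \<in> \<Lambda>\<close> and \<open>t < m\<^sub>j\<close>. If \<open>t + 1 < m\<^sub>j\<close> the gap is even shorter than
  one child, so all \<open>l\<close> are constrained; if \<open>t + 1 = m\<^sub>j\<close> the constrained \<open>l\<close> are exactly those
  with \<open>l \<ge> s\<^sub>j\<close>. For a uniform vector \<open>P\<close>, comparability of the two ends for \<open>l \<ge> s\<close> is the same as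
  \<open>(C, s)\<close>-uniformity of \<open>(P, P)\<close>, up to the constant. So balance is equivalent to (a) and (b)
  (lemmas \<open>edge_condition_if_balanced\<close> and \<open>balanced_if_edge_condition\<close>).

  To deduce balance from doubling (\<open>balanced_if_doubling\<close>) one needs, for each block that is to be
  bounded below, a point of the Cantor set in it whose distance to the rest of the set is
  comparable to the length of the block. Two obstacles arise. A block at the edge of a component
  may have an unrelated neighbour very close; but the vectors depend only on the level, so the
  component can be taken to be the first or the last of its level. And a component may have no
  point near its middle, if it splits into two children that are far apart; then one
  compares the two children next to the gap instead. Conversely (\<open>doubling_if_balanced\<close>), uniformity
  and balance bound the mass of the right half of a ball, and the left half follows by symmetry.

  Everything is stated for the numbering of the components of a level from left to right, in which
  \<open>q\<close> and \<open>q + 1\<close> are neighbours and reflecting the line is the map \<open>q \<mapsto> N - 1 - q\<close>.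
\<close>

section \<open>Vectors whose nearby blocks have comparable sums\<close>

text \<open>This is \<open>(C, s)\<close>-uniformity for a vector given as a function on \<open>{..<N}\<close>, with the two blocks
  in either order, so that an upper bound alone suffices.\<close>

definition block_uniform :: "real \<Rightarrow> nat \<Rightarrow> nat \<Rightarrow> (nat \<Rightarrow> real) \<Rightarrow> bool" where
  "block_uniform C s N f \<longleftrightarrow>
     (\<forall>a b l. s \<le> l \<and> a \<le> b + l \<and> b \<le> a + l \<and> a + l \<le> N \<and> b + l \<le> N \<longrightarrow>
        sum f {a..<a + l} \<le> C * sum f {b..<b + l})"

lemma block_uniformD:
  assumes "block_uniform C s N f" "s \<le> l" "a \<le> b + l" "b \<le> a + l" "a + l \<le> N" "b + l \<le> N"
  shows "sum f {a..<a + l} \<le> C * sum f {b..<b + l}"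
  using assms unfolding block_uniform_def by blast

lemma sum_mono_interval:
  fixes f :: "nat \<Rightarrow> real"
  assumes "\<And>t. t < N \<Longrightarrow> 0 \<le> f t" "b \<le> N" "c \<le> a" "b \<le> d" "d \<le> N"
  shows "sum f {a..<b} \<le> sum f {c..<d}"
  by (rule sum_mono2) (use assms in auto)

lemma block_uniform_mono:
  assumes "block_uniform C s N f" "C \<le> C'" "s \<le> s'" "\<And>t. t < N \<Longrightarrow> 0 \<le> f t"
  shows "block_uniform C' s' N f"
  unfolding block_uniform_def
proof safe
  fix a b l assume *: "s' \<le> l" "a \<le> b + l" "b \<le> a + l" "a + l \<le> N" "b + l \<le> N"
  have "sum f {a..<a + l} \<le> C * sum f {b..<b + l}"
    using block_uniformD[OF assms(1), of l a b] * assms(3) by simp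
  also have "\<dots> \<le> C' * sum f {b..<b + l}"
    by (rule mult_right_mono) (use assms * in \<open>auto intro!: sum_nonneg\<close>)
  finally show "sum f {a..<a + l} \<le> C' * sum f {b..<b + l}" .
qed

text \<open>A block is moved over a distance of \<open>K\<close> block lengths in \<open>K\<close> steps, each of which loses a
  factor \<open>C\<close>.\<close>

lemma block_shift_right:
  assumes "block_uniform C s N f" "C \<ge> 1" "s \<le> l" "\<And>t. t < N \<Longrightarrow> 0 \<le> f t"
    and "a \<le> b" "b \<le> a + K * l" "b + l \<le> N"
  shows "sum f {b..<b + l} \<le> C ^ K * sum f {a..<a + l}"
  using assms(5-7)
proof (induction K arbitrary: b)
  case (Suc K)
  show ?case
  proof (cases "b \<le> a + K * l")
    case True
    have "sum f {b..<b + l} \<le> C ^ K * sum f {a..<a + l}"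
      using Suc True by simp
    also have "\<dots> \<le> C ^ Suc K * sum f {a..<a + l}"
      by (rule mult_right_mono[OF power_increasing])
        (use assms Suc.prems in \<open>auto intro!: sum_nonneg\<close>)
    finally show ?thesis .
  next
    case False
    define b' where "b' = max a (b - l)"
    have b': "a \<le> b'" "b' \<le> a + K * l" "b' + l \<le> N" "b' \<le> b" "b \<le> b' + l"
      using Suc.prems False by (auto simp: b'_def)
    have "sum f {b..<b + l} \<le> C * sum f {b'..<b' + l}"
      by (rule block_uniformD[OF assms(1,3)]) (use b' Suc.prems in auto)
    also have "\<dots> \<le> C * (C ^ K * sum f {a..<a + l})"
      by (rule mult_left_mono[OF Suc.IH]) (use b' assms in auto)
    finally show ?thesis by (simp add: mult.assoc)
  qed
qed auto

lemma block_shift_left: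
  assumes "block_uniform C s N f" "C \<ge> 1" "s \<le> l" "\<And>t. t < N \<Longrightarrow> 0 \<le> f t"
    and "b \<le> a" "a \<le> b + K * l" "a + l \<le> N"
  shows "sum f {b..<b + l} \<le> C ^ K * sum f {a..<a + l}"
  using assms(5-7)
proof (induction K arbitrary: b)
  case (Suc K)
  show ?case
  proof (cases "a \<le> b + K * l")
    case True
    have "sum f {b..<b + l} \<le> C ^ K * sum f {a..<a + l}"
      using Suc True by simp
    also have "\<dots> \<le> C ^ Suc K * sum f {a..<a + l}"
      by (rule mult_right_mono[OF power_increasing])
        (use assms Suc.prems in \<open>auto intro!: sum_nonneg\<close>)
    finally show ?thesis .
  next
    case False
    define b' where "b' = min a (b + l)"
    have b': "b' \<le> a" "a \<le> b' + K * l" "b' + l \<le> N" "b \<le> b'" "b' \<le> b + l"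
      using Suc.prems False by (auto simp: b'_def)
    have "sum f {b..<b + l} \<le> C * sum f {b'..<b' + l}"
      by (rule block_uniformD[OF assms(1,3)]) (use b' Suc.prems in auto)
    also have "\<dots> \<le> C * (C ^ K * sum f {a..<a + l})"
      by (rule mult_left_mono[OF Suc.IH]) (use b' assms in auto)
    finally show ?thesis by (simp add: mult.assoc)
  qed
qed auto

lemma block_cover_right:
  assumes "block_uniform C s N f" "C \<ge> 1" "s \<le> l" "\<And>t. t < N \<Longrightarrow> 0 \<le> f t"
    and "a + l \<le> N" "v \<le> N" "v \<le> a + l + K * l"
  shows "sum f {a..<v} \<le> real (Suc K) * C ^ K * sum f {a..<a + l}"
  using assms(6,7)
proof (induction K arbitrary: v)
  case 0
  then show ?case using sum_mono_interval[of N f v a a "a + l"] assms(4,5) by simp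
next
  case (Suc K)
  let ?B = "sum f {a..<a + l}"
  have B: "0 \<le> ?B" using assms by (auto intro!: sum_nonneg)
  have pw: "C ^ K * ?B \<le> C ^ Suc K * ?B"
    by (rule mult_right_mono[OF power_increasing]) (use assms B in auto)
  show ?case
  proof (cases "v \<le> a + l + K * l")
    case True
    have "sum f {a..<v} \<le> real (Suc K) * (C ^ K * ?B)" using Suc True by (simp add: mult.assoc)
    also have "\<dots> \<le> real (Suc (Suc K)) * (C ^ Suc K * ?B)"
      by (rule mult_mono) (use pw B assms in auto)
    finally show ?thesis by (simp only: mult.assoc)
  next
    case False
    then have v: "v - l \<le> N" "v - l \<le> a + l + K * l" "a \<le> v - l" "v - l \<le> a + Suc K * l" "l \<le> v"
      using Suc.prems by auto
    have "sum f {a..<v} = sum f {a..<v - l} + sum f {v - l..<v}"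
      using v by (simp add: sum.atLeastLessThan_concat)
    also have "sum f {a..<v - l} \<le> real (Suc K) * (C ^ K * ?B)"
      using Suc.IH[OF v(1,2)] by (simp only: mult.assoc)
    also have "\<dots> \<le> real (Suc K) * (C ^ Suc K * ?B)"
      by (rule mult_left_mono[OF pw]) simp
    also have "sum f {v - l..<v} \<le> C ^ Suc K * ?B"
      using block_shift_right[OF assms(1-4) v(3,4)] v Suc.prems by simp
    finally show ?thesis by (simp add: algebra_simps)
  qed
qed

lemma block_cover_left:
  assumes "block_uniform C s N f" "C \<ge> 1" "s \<le> l" "\<And>t. t < N \<Longrightarrow> 0 \<le> f t"
    and "a + l \<le> N" "a \<le> u + K * l"
  shows "sum f {u..<a + l} \<le> real (Suc K) * C ^ K * sum f {a..<a + l}"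
  using assms(6)
proof (induction K arbitrary: u)
  case 0
  then show ?case using sum_mono_interval[of N f "a + l" a u "a + l"] assms(4,5) by simp
next
  case (Suc K)
  let ?B = "sum f {a..<a + l}"
  have B: "0 \<le> ?B" using assms by (auto intro!: sum_nonneg)
  have pw: "C ^ K * ?B \<le> C ^ Suc K * ?B"
    by (rule mult_right_mono[OF power_increasing]) (use assms B in auto)
  show ?case
  proof (cases "a \<le> u + K * l")
    case True
    have "sum f {u..<a + l} \<le> real (Suc K) * (C ^ K * ?B)" using Suc True by (simp add: mult.assoc)
    also have "\<dots> \<le> real (Suc (Suc K)) * (C ^ Suc K * ?B)"
      by (rule mult_mono) (use pw B assms in auto)
    finally show ?thesis by (simp only: mult.assoc)
  next
    case False
    then have u: "a \<le> u + l + K * l" "u \<le> a" "a \<le> u + Suc K * l" "u + l \<le> a + l"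
      using Suc.prems by auto
    have "sum f {u..<a + l} = sum f {u..<u + l} + sum f {u + l..<a + l}"
      using u by (simp add: sum.atLeastLessThan_concat)
    also have "sum f {u + l..<a + l} \<le> real (Suc K) * (C ^ K * ?B)"
      using Suc.IH[OF u(1)] by (simp only: mult.assoc)
    also have "\<dots> \<le> real (Suc K) * (C ^ Suc K * ?B)"
      by (rule mult_left_mono[OF pw]) simp
    also have "sum f {u..<u + l} \<le> C ^ Suc K * ?B"
      using block_shift_left[OF assms(1-4) u(2,3) assms(5)] by simp
    finally show ?thesis by (simp add: algebra_simps)
  qed
qed

text \<open>A window whose ends are within \<open>K\<close> block lengths of the block is covered by the block and
  boundedly many of its translates, each of which is comparable to it.\<close>

lemma block_window:
  assumes "block_uniform C s N f" "C \<ge> 1" "s \<le> l" "\<And>t. t < N \<Longrightarrow> 0 \<le> f t"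
    and "a + l \<le> N" "v \<le> N" "v \<le> a + l + K * l" "a \<le> u + K * l"
  shows "sum f {u..<v} \<le> 2 * real (Suc K) * C ^ K * sum f {a..<a + l}"
proof -
  have "sum f {u..<v} \<le> sum f ({u..<a + l} \<union> {a..<v})"
    by (rule sum_mono2) (use assms(4-6) in auto)
  also have "\<dots> \<le> sum f {u..<a + l} + sum f {a..<v}"
    using sum.union_inter[of "{u..<a + l}" "{a..<v}" f] sum_nonneg[of "{u..<a + l} \<inter> {a..<v}" f] assms(4-6)
    by fastforce
  also have "\<dots> \<le> 2 * real (Suc K) * C ^ K * sum f {a..<a + l}"
    using add_mono[OF block_cover_left[OF assms(1-5,8)] block_cover_right[OF assms(1-7)]]
    by (simp add: algebra_simps)
  finally show ?thesis .
qed

definition ends_comparable :: "real \<Rightarrow> nat \<Rightarrow> nat \<Rightarrow> (nat \<Rightarrow> real) \<Rightarrow> bool" where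
  "ends_comparable C s N f \<longleftrightarrow> (\<forall>l. s \<le> l \<and> l \<le> N \<longrightarrow>
     sum f {0..<l} \<le> C * sum f {N - l..<N} \<and> sum f {N - l..<N} \<le> C * sum f {0..<l})"

text \<open>A block of \<open>(P, P)\<close> splits at the junction into a block at the end of the first copy and a block
  at the beginning of the second. Truncated subtraction makes one of them empty
  if the block does not cross the junction.\<close>

lemma sum_append_self:
  assumes "N = length P" "d + l \<le> 2 * N"
  shows "sum ((!) (P @ P)) {d..<d + l} =
    sum ((!) P) {d..<min N (d + l)} + sum ((!) P) {d - N..<d + l - N}"
proof -
  have split: "{d..<d + l} = {d..<min N (d + l)} \<union> {max d N..<d + l}" by auto
  have "sum ((!) (P @ P)) {d..<d + l} =
      sum ((!) (P @ P)) {d..<min N (d + l)} + sum ((!) (P @ P)) {max d N..<d + l}"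
    unfolding split by (rule sum.union_disjoint) auto
  also have "sum ((!) (P @ P)) {d..<min N (d + l)} = sum ((!) P) {d..<min N (d + l)}"
    by (rule sum.cong) (auto simp: nth_append assms)
  also have "sum ((!) (P @ P)) {max d N..<d + l} = sum ((!) P) {d - N..<d + l - N}"
    by (rule sum.reindex_bij_witness[of _ "\<lambda>t. t + N" "\<lambda>t. t - N"])
      (auto simp: nth_append assms)
  finally show ?thesis .
qed

text \<open>The two ends of \<open>P\<close> are adjacent blocks of \<open>(P, P)\<close>, on either side of the junction.\<close>

lemma ends_comparable_if_block_uniform_append:
  assumes "block_uniform C s (2 * N) ((!) (P @ P))" "N = length P"
  shows "ends_comparable C s N ((!) P)"
  unfolding ends_comparable_def
proof (intro allI impI)
  fix l assume l: "s \<le> l \<and> l \<le> N"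
  have "sum ((!) (P @ P)) {N - l..<N - l + l} = sum ((!) P) {N - l..<N}"
    "sum ((!) (P @ P)) {N..<N + l} = sum ((!) P) {0..<l}"
    using sum_append_self[of N P "N - l" l] sum_append_self[of N P N l] assms(2) l by auto
  then show "sum ((!) P) {0..<l} \<le> C * sum ((!) P) {N - l..<N} \<and>
      sum ((!) P) {N - l..<N} \<le> C * sum ((!) P) {0..<l}"
    using block_uniformD[OF assms(1), of l N "N - l"] block_uniformD[OF assms(1), of l "N - l" N] l
    by auto
qed

text \<open>Two overlapping or touching blocks that do not lie in one and the same copy of \<open>P\<close> are both
  within distance \<open>l\<close> of the junction. Such a block is comparable to the first \<open>min l N\<close> entries of
  \<open>P\<close>: each of its two parts is bounded by an end of \<open>P\<close>, and its longer part, which has at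
  least half the length, bounds an end of \<open>P\<close> by uniformity of \<open>P\<close>.\<close>

lemma block_uniform_append_if_ends_comparable:
  assumes U: "block_uniform C 1 N ((!) P)" and T: "ends_comparable C s N ((!) P)"
    and N: "N = length P" and C: "C \<ge> 1" and s: "1 \<le> s" "s \<le> N" and pos: "\<And>t. t < N \<Longrightarrow> 0 \<le> P ! t"
  shows "block_uniform (4 * C ^ 4) s (2 * N) ((!) (P @ P))"
  unfolding block_uniform_def
proof (intro allI impI, elim conjE)
  fix a b l assume l: "s \<le> l" and ab: "a \<le> b + l" "b \<le> a + l" "a + l \<le> 2 * N" "b + l \<le> 2 * N"
  let ?f = "(!) P"
  let ?T = "\<lambda>d. sum ((!) (P @ P)) {d..<d + l}"
  define r where "r = min l N"
  define F where "F = sum ?f {0..<r}"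
  define G where "G = sum ?f {N - r..<N}"
  have r: "s \<le> r" "r \<le> N" "r \<le> l" "1 \<le> r" "1 \<le> l" using l s by (auto simp: r_def)
  have FG: "F \<le> C * G" "G \<le> C * F" using T r by (auto simp: ends_comparable_def F_def G_def)
  have nn: "0 \<le> sum ?f {u..<v}" if "v \<le> N" for u v using that pos by (auto intro!: sum_nonneg)
  have F0: "0 \<le> F" and G0: "0 \<le> G" unfolding F_def G_def using nn r by auto
  have up: "?T d \<le> 2 * C ^ 2 * F" if d: "N \<le> d + 2 * l" "d \<le> N + l" "d + l \<le> 2 * N" for d
  proof -
    have "sum ?f {d..<min N (d + l)} \<le> C * G"
    proof (cases "l < N \<and> d + l \<le> N")
      case True
      then have "r = l" by (simp add: r_def)
      then show ?thesis
        using block_uniformD[OF U, of l d "N - l"] True d r by (simp add: G_def min_absorb2)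
    next
      case False
      then have "sum ?f {d..<min N (d + l)} \<le> G" unfolding G_def
        by (intro sum_mono_interval[of N]) (use pos in \<open>auto simp: r_def\<close>)
      also have "G \<le> C * G" using mult_right_mono[OF C G0] by simp
      finally show ?thesis .
    qed
    also have "\<dots> \<le> C * (C * F)" using FG C by simp
    finally have 1: "sum ?f {d..<min N (d + l)} \<le> C ^ 2 * F" by (simp add: power2_eq_square)
    have "sum ?f {d - N..<d + l - N} \<le> C * F"
    proof (cases "l < N \<and> N \<le> d")
      case True
      then have "r = l" by (simp add: r_def)
      then show ?thesis
        using block_uniformD[OF U, of l "d - N" 0] True d r by (simp add: F_def)
    next
      case False
      then have "sum ?f {d - N..<d + l - N} \<le> F" unfolding F_def
        by (intro sum_mono_interval[of N]) (use pos d in \<open>auto simp: r_def\<close>)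
      also have "F \<le> C * F" using mult_right_mono[OF C F0] by simp
      finally show ?thesis .
    qed
    also have "C * F \<le> C ^ 2 * F" 
      using mult_right_mono[OF C mult_nonneg_nonneg[of C F]] C F0 by (simp add: power2_eq_square algebra_simps)
    finally show ?thesis using 1 sum_append_self[OF N d(3)] by simp
  qed
  have lo: "F \<le> 2 * C ^ 2 * ?T d" if d: "N \<le> d + 2 * l" "d \<le> N + l" "d + l \<le> 2 * N" for d
  proof -
    define e where "e = min N (d + l) - d"
    have T1: "?T d \<ge> sum ?f {d..<min N (d + l)}" "?T d \<ge> sum ?f {d - N..<d + l - N}"
      using sum_append_self[OF N d(3)] nn[of "min N (d + l)" d] nn[of "d + l - N" "d - N"] d by auto
    then have T0: "0 \<le> ?T d" using nn[of "min N (d + l)" d] by simp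
    have C2: "C \<le> C ^ 2" "1 \<le> C ^ 2" using self_le_power[OF C, of 2] one_le_power[OF C, of 2] by auto
    consider "d + l \<le> N" | "N \<le> d" | "d < N" "N < d + l" "l \<le> 2 * e" | "d < N" "N < d + l" "2 * e < l"
      by linarith
    then have "F \<le> C * (1 + C) * ?T d"
    proof cases
      case 1
      then have "r = l" by (simp add: r_def)
      then have "G \<le> C * sum ?f {d..<d + l}"
        using block_uniformD[OF U, of l "N - l" d] 1 d r by (simp add: G_def)
      also have "\<dots> \<le> C * ?T d" using T1(1) 1 C by (simp add: min_absorb2)
      also have "\<dots> \<le> (1 + C) * ?T d" by (rule mult_right_mono) (use C T0 in auto)
      finally have "C * G \<le> C * ((1 + C) * ?T d)" using C by simp
      then show ?thesis using FG by (simp add: mult.assoc)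
    next
      case 2
      then have "r = l" using d by (simp add: r_def)
      then have "F \<le> C * sum ?f {d - N..<d - N + l}"
        using block_uniformD[OF U, of l 0 "d - N"] 2 d r by (simp add: F_def)
      also have "\<dots> \<le> C * ?T d" using T1(2) 2 C by simp
      also have "\<dots> \<le> C * ((1 + C) * ?T d)" 
        using mult_right_mono[of 1 "1 + C" "?T d"] T0 C by (intro mult_left_mono) auto
      finally show ?thesis by (simp add: mult.assoc)
    next
      case 3
      then have e: "d = N - e" "e \<le> N" "1 \<le> e" "r \<le> 2 * e" "e \<le> l" by (auto simp: e_def r_def)
      have Te: "?T d \<ge> sum ?f {N - e..<N}" using T1(1) 3 e by (simp add: min_def)
      show ?thesis
      proof (cases "r \<le> e")
        case True
        have "G \<le> sum ?f {N - e..<N}" unfolding G_def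
          by (intro sum_mono_interval[of N]) (use pos True in auto)
        also have "\<dots> \<le> (1 + C) * ?T d" using Te mult_right_mono[of 1 "1 + C" "?T d"] T0 C by simp
        finally have "C * G \<le> C * ((1 + C) * ?T d)" using C by simp
        then show ?thesis using FG by (simp add: mult.assoc)
      next
        case False
        have "G \<le> sum ?f ({N - r..<N - r + e} \<union> {N - e..<N})" unfolding G_def
          by (rule sum_mono2) (use pos False r e in auto)
        also have "\<dots> \<le> sum ?f {N - r..<N - r + e} + sum ?f {N - e..<N}"
          using sum.union_inter[of "{N - r..<N - r + e}" "{N - e..<N}" ?f]
            sum_nonneg[of "{N - r..<N - r + e} \<inter> {N - e..<N}" ?f] pos by fastforce
        also have "sum ?f {N - r..<N - r + e} \<le> C * sum ?f {N - e..<N - e + e}"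
          by (rule block_uniformD[OF U]) (use False r e in auto)
        finally have "G \<le> (1 + C) * sum ?f {N - e..<N}" using e by (simp add: algebra_simps)
        also have "\<dots> \<le> (1 + C) * ?T d" using Te C by simp
        finally have "C * G \<le> C * ((1 + C) * ?T d)" using C by simp
        then show ?thesis using FG by (simp add: mult.assoc)
      qed
    next
      case 4
      define e' where "e' = d + l - N"
      have e: "e' \<le> N" "1 \<le> e'" "r \<le> 2 * e'" "d - N = 0" using 4 d by (auto simp: e_def e'_def r_def)
      have Te: "?T d \<ge> sum ?f {0..<e'}" using T1(2) e by (simp add: e'_def)
      have "F \<le> (1 + C) * ?T d"
      proof (cases "r \<le> e'")
        case True
        have "F \<le> sum ?f {0..<e'}" unfolding F_def
          by (intro sum_mono_interval[of N]) (use pos True e in auto)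
        also have "\<dots> \<le> (1 + C) * ?T d" using Te mult_right_mono[of 1 "1 + C" "?T d"] T0 C by simp
        finally show ?thesis .
      next
        case False
        have "F \<le> sum ?f ({0..<e'} \<union> {r - e'..<r - e' + e'})" unfolding F_def
          by (rule sum_mono2) (use pos False r e in auto)
        also have "\<dots> \<le> sum ?f {0..<e'} + sum ?f {r - e'..<r - e' + e'}"
          using sum.union_inter[of "{0..<e'}" "{r - e'..<r - e' + e'}" ?f]
            sum_nonneg[of "{0..<e'} \<inter> {r - e'..<r - e' + e'}" ?f] pos e by fastforce
        also have "sum ?f {r - e'..<r - e' + e'} \<le> C * sum ?f {0..<0 + e'}"
          by (rule block_uniformD[OF U]) (use False r e in auto)
        finally have "F \<le> (1 + C) * sum ?f {0..<e'}" by (simp add: algebra_simps)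
        also have "\<dots> \<le> (1 + C) * ?T d" using Te C by simp
        finally show ?thesis .
      qed
      also have "\<dots> \<le> C * ((1 + C) * ?T d)"
        using mult_right_mono[OF C, of "(1 + C) * ?T d"] T0 C by simp
      finally show ?thesis by (simp add: mult.assoc)
    qed
    also have "\<dots> \<le> 2 * C ^ 2 * ?T d"
      by (rule mult_right_mono) (use C2 T0 in \<open>auto simp: algebra_simps power2_eq_square\<close>)
    finally show ?thesis .
  qed
  have C4: "C \<le> 4 * C ^ 4" using self_le_power[OF C, of 4] C by simp
  have Tnn: "0 \<le> ?T b"
    using sum_append_self[OF N ab(4)] nn[of "min N (b + l)" b] nn[of "b + l - N" "b - N"] ab by simp
  consider "a + l \<le> N" "b + l \<le> N" | "N \<le> a" "N \<le> b"
    | "N \<le> a + 2 * l" "a \<le> N + l" "N \<le> b + 2 * l" "b \<le> N + l" using ab by linarith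
  then show "?T a \<le> 4 * C ^ 4 * ?T b"
  proof cases
    case 1
    have "?T a \<le> C * ?T b"
      using block_uniformD[OF U, of l a b] 1 ab r
        sum_append_self[OF N ab(3)] sum_append_self[OF N ab(4)] by (simp add: min_absorb2)
    also have "\<dots> \<le> 4 * C ^ 4 * ?T b" by (rule mult_right_mono[OF C4 Tnn])
    finally show ?thesis .
  next
    case 2
    have "?T a \<le> C * ?T b"
      using block_uniformD[OF U, of l "a - N" "b - N"] 2 ab r
        sum_append_self[OF N ab(3)] sum_append_self[OF N ab(4)] by simp
    also have "\<dots> \<le> 4 * C ^ 4 * ?T b" by (rule mult_right_mono[OF C4 Tnn])
    finally show ?thesis .
  next
    case 3
    have "?T a \<le> 2 * C ^ 2 * F" by (rule up) (use 3 ab in auto)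
    also have "\<dots> \<le> 2 * C ^ 2 * (2 * C ^ 2 * ?T b)"
      by (rule mult_left_mono[OF lo]) (use 3 ab in auto)
    finally show ?thesis by (simp add: power_add[of C 2 2, simplified] algebra_simps)
  qed
qed

section \<open>Components of a level, numbered from left to right\<close>

text \<open>The component \<open>q\<close> of level \<open>k\<close> has the children \<open>q n + i\<close> with \<open>i < n = n\<^bsub>k+1\<^esub>\<close>, so \<open>q\<close> is written in the mixed
  radix given by \<open>n\<close>; parent and position among the siblings are obtained by \<open>div\<close> and \<open>mod\<close>.\<close>

primrec comp_count :: "(nat \<Rightarrow> nat) \<Rightarrow> nat \<Rightarrow> nat" where
  "comp_count n 0 = 1"
| "comp_count n (Suc k) = comp_count n k * n (Suc k)"

primrec left_end :: "(nat \<Rightarrow> nat) \<Rightarrow> (nat \<Rightarrow> real) \<Rightarrow> nat \<Rightarrow> nat \<Rightarrow> real" where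
  "left_end n c 0 q = 0"
| "left_end n c (Suc k) q = left_end n c k (q div n (Suc k)) +
     real (q mod n (Suc k)) * (comp_length n c (Suc k) + gap_length n c (Suc k))"

primrec mass :: "(nat \<Rightarrow> nat) \<Rightarrow> (nat \<Rightarrow> nat \<Rightarrow> real) \<Rightarrow> nat \<Rightarrow> nat \<Rightarrow> real" where
  "mass n p 0 q = 1"
| "mass n p (Suc k) q = mass n p k (q div n (Suc k)) * p (Suc k) (q mod n (Suc k))"

primrec word_of :: "(nat \<Rightarrow> nat) \<Rightarrow> nat \<Rightarrow> nat \<Rightarrow> nat list" where
  "word_of n 0 q = []"
| "word_of n (Suc k) q = word_of n k (q div n (Suc k)) @ [Suc (q mod n (Suc k))]"

text \<open>For the last component of a level the value has no geometric meaning.\<close>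

definition gap_right :: "(nat \<Rightarrow> nat) \<Rightarrow> (nat \<Rightarrow> real) \<Rightarrow> nat \<Rightarrow> nat \<Rightarrow> real" where
  "gap_right n c k q = left_end n c k (Suc q) - left_end n c k q - comp_length n c k"

lemma length_word_of [simp]: "length (word_of n k q) = k"
  by (induction k arbitrary: q) auto

lemma left_endpoint_word_of: "left_endpoint n c (word_of n k q) = left_end n c k q"
  by (induction k arbitrary: q) (simp_all add: left_endpoint_snoc, simp add: left_endpoint_def)

lemma word_interval_word_of:
  "word_interval n c (word_of n k q) = {left_end n c k q..left_end n c k q + comp_length n c k}"
  by (simp add: word_interval_def left_endpoint_word_of)

lemma child_less_count:
  assumes "q < N" "i < m"
  shows "q * m + i < N * (m::nat)"
proof -
  have "q * m + i < Suc q * m" using assms by simp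
  also have "\<dots> \<le> N * m" using assms by (intro mult_le_mono1) simp
  finally show ?thesis .
qed

text \<open>Reversing the order of all components reverses the order of the parents and the order among
  siblings.\<close>

lemma reflect_index:
  assumes "Q < N" "i < (m::nat)"
  shows "N * m - 1 - (Q * m + i) = (N - 1 - Q) * m + (m - 1 - i)"
proof -
  obtain d where d: "N = Q + 1 + d" using less_imp_Suc_add[OF assms(1)] by auto
  obtain j where j: "m = i + 1 + j" using less_imp_Suc_add[OF assms(2)] by auto
  have "N * m = Q * m + m + d * m" using d by (simp add: algebra_simps)
  then have "N * m - 1 - (Q * m + i) = d * m + j" using j by linarith
  then show ?thesis using d j by simp
qed

locale cantor_geometry =
  fixes n :: "nat \<Rightarrow> nat" and c :: "nat \<Rightarrow> real"
  assumes parameters: "cantor_parameters n c"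
begin

abbreviation N where "N \<equiv> comp_count n"
abbreviation len where "len \<equiv> comp_length n c"
abbreviation eps where "eps \<equiv> gap_length n c"
abbreviation lft where "lft \<equiv> left_end n c"
abbreviation gap where "gap \<equiv> gap_right n c"

lemma two_le_n: "2 \<le> n (Suc k)"
  using parameters by (simp add: cantor_parameters_def)

lemma n_pos: "0 < n (Suc k)"
  using two_le_n[of k] by simp

lemma len_pos: "0 < len k"
  using comp_length_pos[OF parameters] .

lemma eps_pos: "0 < eps (Suc k)"
  using gap_length_pos[OF parameters] by simp

text \<open>A component consists of \<open>n\<close> children each followed by a gap, except that the last gap is
  missing. In this form all positions become multiples of the period
  \<open>\<delta>\<^bsub>k+1\<^esub> + \<epsilon>\<^bsub>k+1\<^esub>\<close>.\<close>

lemma len_split: "len k = real (n (Suc k)) * (len (Suc k) + eps (Suc k)) - eps (Suc k)"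
  using comp_length_split[OF parameters, of k] by (simp add: algebra_simps)

lemma N_pos: "0 < N k"
  by (induction k) (use n_pos in auto)

lemma two_len_Suc_less: "2 * len (Suc k) + eps (Suc k) \<le> len k"
proof -
  have "2 * (len (Suc k) + eps (Suc k)) \<le> real (n (Suc k)) * (len (Suc k) + eps (Suc k))"
    using two_le_n[of k] len_pos[of "Suc k"] eps_pos[of k] by (intro mult_right_mono) auto
  then show ?thesis using len_split[of k] by simp
qed

lemma len_le_half_power: "len (k + j) \<le> len k / 2 ^ j"
proof (induction j)
  case (Suc j)
  have "2 * len (k + Suc j) \<le> len (k + j)"
    using two_len_Suc_less[of "k + j"] eps_pos[of "k + j"] by simp
  then show ?case using Suc by simp
qed simp

lemma len_antimono: "k \<le> j \<Longrightarrow> len j \<le> len k"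
proof (induction rule: dec_induct)
  case (step j)
  then show ?case using two_len_Suc_less[of j] eps_pos[of j] len_pos[of "Suc j"] by linarith
qed simp

lemma ex_len_less:
  assumes "0 < t"
  shows "\<exists>k. len k < t"
proof -
  obtain j where "(1/2) ^ j < t" using real_arch_pow_inv[OF assms, of "1/2"] by auto
  then have "len j < t" using len_le_half_power[of 0 j] by (simp add: power_divide)
  then show ?thesis by blast
qed

lemma ex_len_bracket:
  assumes "0 < t" "t \<le> 1"
  shows "\<exists>k. len (Suc k) < t \<and> t \<le> len k"
proof -
  obtain j where "len j < t" using ex_len_less[OF assms(1)] by blast
  then have "\<exists>k<j. (\<forall>i\<le>k. \<not> \<not> t \<le> len i) \<and> \<not> t \<le> len (Suc k)"
    using ex_least_nat_less[of "\<lambda>k. \<not> t \<le> len k" j] assms by simp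
  then obtain k where "\<forall>i\<le>k. t \<le> len i" "\<not> t \<le> len (Suc k)" by blast
  then show ?thesis by (intro exI[of _ k]) auto
qed

lemma lft_child: "i < n (Suc k) \<Longrightarrow>
    lft (Suc k) (q * n (Suc k) + i) = lft k q + real i * (len (Suc k) + eps (Suc k))"
  by simp

lemma lft_first_child: "lft (Suc k) (q * n (Suc k)) = lft k q"
  using lft_child[of 0 k q] n_pos by simp

lemma right_last_child:
  "lft (Suc k) (q * n (Suc k) + (n (Suc k) - 1)) + len (Suc k) = lft k q + len k"
  using lft_child[of "n (Suc k) - 1" k q] two_le_n[of k] len_split[of k] n_pos[of k]
  by (simp add: algebra_simps of_nat_diff)

lemma gap_sibling: "Suc i < n (Suc k) \<Longrightarrow> gap (Suc k) (q * n (Suc k) + i) = eps (Suc k)"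
  using lft_child[of i k q] lft_child[of "Suc i" k q]
  by (simp add: gap_right_def algebra_simps del: left_end.simps)

text \<open>The right end of the last child is the right end of its parent.\<close>

lemma gap_last_child: "gap (Suc k) (q * n (Suc k) + (n (Suc k) - 1)) = gap k q"
proof -
  have "Suc (q * n (Suc k) + (n (Suc k) - 1)) = Suc q * n (Suc k)" using n_pos[of k] by simp
  then show ?thesis
    using lft_first_child[of k "Suc q"] right_last_child[of k q]
    by (simp add: gap_right_def del: left_end.simps mult_Suc)
qed

lemma child_cases:
  obtains Q i where "i < n (Suc k)" "q = Q * n (Suc k) + i"
proof (rule that)
  show "q mod n (Suc k) < n (Suc k)" using n_pos by simp
  show "q = q div n (Suc k) * n (Suc k) + q mod n (Suc k)" by simp
qed

lemma parent_less: "q < N (Suc k) \<Longrightarrow> q div n (Suc k) < N k"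
  by (simp add: less_mult_imp_div_less)

lemma last_child_parent:
  assumes "Suc (q * n (Suc k) + (n (Suc k) - 1)) < N (Suc k)"
  shows "Suc q < N k"
proof -
  have "Suc (q * n (Suc k) + (n (Suc k) - 1)) = Suc q * n (Suc k)" using n_pos[of k] by simp
  then have "Suc q * n (Suc k) < N k * n (Suc k)" using assms by simp
  then show ?thesis by (simp only: mult_less_cancel2)
qed

lemma gap_pos: "Suc q < N k \<Longrightarrow> 0 < gap k q"
proof (induction k arbitrary: q)
  case (Suc k)
  obtain Q i where i: "i < n (Suc k)" "q = Q * n (Suc k) + i"
    by (rule child_cases)
  show ?case
  proof (cases "Suc i < n (Suc k)")
    case True
    then show ?thesis using gap_sibling[OF True, of Q] eps_pos[of k] by (simp only: i(2))
  next
    case False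
    then have q: "q = Q * n (Suc k) + (n (Suc k) - 1)" using i by simp
    then have "Suc Q < N k" using Suc.prems last_child_parent[of Q k] by (simp only:)
    then have "0 < gap k Q" by (rule Suc.IH)
    then show ?thesis using gap_last_child[of k Q] by (simp only: q)
  qed
qed simp

lemma lft_Suc: "lft k (Suc q) = lft k q + len k + gap k q"
  by (simp add: gap_right_def)

lemma lft_less: "q < q' \<Longrightarrow> q' < N k \<Longrightarrow> lft k q + len k < lft k q'"
proof (induction q')
  case (Suc q')
  then show ?case
    using lft_Suc[of k q'] gap_pos[of q' k] len_pos[of k] by (cases "q = q'") auto
qed simp

lemma lft_mono: "q \<le> q' \<Longrightarrow> q' < N k \<Longrightarrow> lft k q \<le> lft k q'"
  using lft_less[of q q' k] len_pos[of k] by (cases "q = q'") auto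

lemma words_eq_word_of: "words n k = word_of n k ` {..<N k}"
proof (induction k)
  case (Suc k)
  have "words n (Suc k) = {w @ [i] |w i. w \<in> word_of n k ` {..<N k} \<and> 1 \<le> i \<and> i \<le> n (Suc k)}"
    unfolding words_Suc Suc ..
  also have "\<dots> = word_of n (Suc k) ` {..<N (Suc k)}"
  proof (intro set_eqI iffI)
    fix w assume "w \<in> {w @ [i] |w i. w \<in> word_of n k ` {..<N k} \<and> 1 \<le> i \<and> i \<le> n (Suc k)}"
    then obtain q i where q: "w = word_of n k q @ [i]" "q < N k" "1 \<le> i" "i \<le> n (Suc k)" by auto
    obtain i' where "i = Suc i'" using q by (cases i) auto
    then have "w = word_of n (Suc k) (q * n (Suc k) + (i - 1))" using q by simp
    moreover have "q * n (Suc k) + (i - 1) < N (Suc k)"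
      using child_less_count[of q "N k" "i - 1" "n (Suc k)"] q by simp
    ultimately show "w \<in> word_of n (Suc k) ` {..<N (Suc k)}" by blast
  next
    fix w assume "w \<in> word_of n (Suc k) ` {..<N (Suc k)}"
    then obtain q where "w = word_of n (Suc k) q" "q < N (Suc k)" by auto
    then show "w \<in> {w @ [i] |w i. w \<in> word_of n k ` {..<N k} \<and> 1 \<le> i \<and> i \<le> n (Suc k)}"
      using parent_less[of q k] mod_less_divisor[OF n_pos, of q k]
      by (auto simp: Suc_le_eq)
  qed
  finally show ?case .
qed (auto simp: words_0)

lemma cantor_set_iff:
  "x \<in> cantor_set n c \<longleftrightarrow> (\<forall>k. \<exists>q<N k. lft k q \<le> x \<and> x \<le> lft k q + len k)"
  by (simp add: cantor_set_def cantor_level_eq[OF parameters] words_eq_word_of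
      word_interval_word_of image_image Bex_def)

lemma cantor_setE:
  assumes "x \<in> cantor_set n c"
  obtains q where "q < N k" "lft k q \<le> x" "x \<le> lft k q + len k"
  using assms cantor_set_iff by blast

lemma parent_interval:
  "lft k (q div n (Suc k)) \<le> lft (Suc k) q"
  "lft (Suc k) q + len (Suc k) \<le> lft k (q div n (Suc k)) + len k"
proof -
  let ?h = "len (Suc k) + eps (Suc k)"
  have h: "0 < ?h" using len_pos[of "Suc k"] eps_pos[of k] by simp
  show "lft k (q div n (Suc k)) \<le> lft (Suc k) q" using h by simp
  have "real (q mod n (Suc k)) \<le> real (n (Suc k)) - 1"
    using mod_less_divisor[OF n_pos, of q k] by linarith
  then have "real (q mod n (Suc k)) * ?h \<le> (real (n (Suc k)) - 1) * ?h"
    using h by (intro mult_right_mono) auto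
  then show "lft (Suc k) q + len (Suc k) \<le> lft k (q div n (Suc k)) + len k"
    using len_split[of k] by (simp add: algebra_simps)
qed

text \<open>Levels decrease, so membership may be tested on all sufficiently large levels. For the end
  points of a component these are reached by passing to first or last children.\<close>

lemma in_cantor_set_if_eventually:
  assumes "\<And>j. k \<le> j \<Longrightarrow> \<exists>q<N j. lft j q \<le> x \<and> x \<le> lft j q + len j"
  shows "x \<in> cantor_set n c"
proof -
  have "\<exists>q<N j. lft j q \<le> x \<and> x \<le> lft j q + len j" if "j \<le> k" for j
    using that
  proof (induction rule: inc_induct)
    case base
    show ?case by (rule assms) simp
  next
    case (step j)
    then obtain q where q: "q < N (Suc j)" "lft (Suc j) q \<le> x" "x \<le> lft (Suc j) q + len (Suc j)"
      by blast
    show ?case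
      using parent_less[OF q(1)] parent_interval[of j q] q
      by (intro exI[of _ "q div n (Suc j)"]) linarith
  qed
  then have "\<exists>q<N j. lft j q \<le> x \<and> x \<le> lft j q + len j" for j
    using assms[of j] by (cases "j \<le> k") auto
  then show ?thesis unfolding cantor_set_iff by blast
qed

lemma lft_in_cantor_set:
  assumes "q < N k"
  shows "lft k q \<in> cantor_set n c"
proof (rule in_cantor_set_if_eventually)
  fix j assume "k \<le> j"
  then have "\<exists>q'<N j. lft j q' = lft k q"
  proof (induction rule: dec_induct)
    case (step j)
    then obtain q' where "q' < N j" "lft j q' = lft k q" by blast
    then show ?case
      using lft_first_child[of j q'] n_pos[of j] by (intro exI[of _ "q' * n (Suc j)"]) simp
  qed (use assms in auto)
  then show "\<exists>q'<N j. lft j q' \<le> lft k q \<and> lft k q \<le> lft j q' + len j"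
    using len_pos[of j] by force
qed

lemma right_end_in_cantor_set:
  assumes "q < N k"
  shows "lft k q + len k \<in> cantor_set n c"
proof (rule in_cantor_set_if_eventually)
  fix j assume "k \<le> j"
  then have "\<exists>q'<N j. lft j q' + len j = lft k q + len k"
  proof (induction rule: dec_induct)
    case (step j)
    then obtain q' where q': "q' < N j" "lft j q' + len j = lft k q + len k" by blast
    then have "q' * n (Suc j) + (n (Suc j) - 1) < N (Suc j)"
      using child_less_count[of q' "N j" "n (Suc j) - 1" "n (Suc j)"] n_pos[of j] by simp
    then show ?case
      using right_last_child[of j q'] q'(2)
      by (intro exI[of _ "q' * n (Suc j) + (n (Suc j) - 1)"]) (simp del: left_end.simps)
  qed (use assms in auto)
  then show "\<exists>q'<N j. lft j q' \<le> lft k q + len k \<and> lft k q + len k \<le> lft j q' + len j"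
    using len_pos[of j] by force
qed

lemma reflect_child:
  assumes "q < N (Suc k)"
  shows "(N (Suc k) - 1 - q) div n (Suc k) = N k - 1 - q div n (Suc k)"
    "(N (Suc k) - 1 - q) mod n (Suc k) = n (Suc k) - 1 - q mod n (Suc k)"
proof -
  obtain Q i where i: "i < n (Suc k)" "q = Q * n (Suc k) + i"
    by (rule child_cases)
  have Q: "Q < N k" and i': "n (Suc k) - 1 - i < n (Suc k)"
    using parent_less[OF assms] i by auto
  have eq: "N (Suc k) - 1 - q = (N k - 1 - Q) * n (Suc k) + (n (Suc k) - 1 - i)"
    using reflect_index[OF Q i(1)] i(2) by simp
  have "q div n (Suc k) = Q" "q mod n (Suc k) = i" using i by simp_all
  then show "(N (Suc k) - 1 - q) div n (Suc k) = N k - 1 - q div n (Suc k)"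
    "(N (Suc k) - 1 - q) mod n (Suc k) = n (Suc k) - 1 - q mod n (Suc k)"
    unfolding eq using div_mult_self3[of "n (Suc k)" "n (Suc k) - 1 - i" "N k - 1 - Q"] i'
    by (simp_all only: mod_mult_self3 mod_less div_mult_self3 div_less neq0_conv simp_thms)
qed

lemma lft_reflect: "q < N k \<Longrightarrow> lft k (N k - 1 - q) = 1 - len k - lft k q"
proof (induction k arbitrary: q)
  case (Suc k)
  let ?n = "n (Suc k)" and ?Q = "q div n (Suc k)" and ?i = "q mod n (Suc k)"
  have i: "?i < ?n" using n_pos by simp
  have "lft (Suc k) (N (Suc k) - 1 - q) = 1 - len k - lft k ?Q +
      real (?n - 1 - ?i) * (len (Suc k) + eps (Suc k))"
    unfolding left_end.simps(2) reflect_child[OF Suc.prems]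
    using Suc.IH[OF parent_less[OF Suc.prems]] by simp
  also have "real (?n - 1 - ?i) = real ?n - 1 - real ?i" using i by linarith
  finally show ?case using len_split[of k] by (simp add: algebra_simps)
qed simp

lemma gap_reflect:
  assumes "Suc q < N k"
  shows "gap k (N k - 1 - Suc q) = gap k q"
proof -
  have "Suc (N k - 1 - Suc q) = N k - 1 - q" using assms by simp
  then show ?thesis using lft_reflect[of q k] lft_reflect[OF assms] assms
    by (simp add: gap_right_def)
qed

lemma cantor_set_reflect:
  assumes "x \<in> cantor_set n c"
  shows "1 - x \<in> cantor_set n c"
  unfolding cantor_set_iff
proof
  fix k
  obtain q where q: "q < N k" "lft k q \<le> x" "x \<le> lft k q + len k" using cantor_setE[OF assms] .
  then show "\<exists>q<N k. lft k q \<le> 1 - x \<and> 1 - x \<le> lft k q + len k"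
    using lft_reflect[OF q(1)] by (intro exI[of _ "N k - 1 - q"]) auto
qed

lemma mass_reflect:
  "q < N k \<Longrightarrow> mass n (\<lambda>k i. p k (n k - 1 - i)) k (N k - 1 - q) = mass n p k q"
proof (induction k arbitrary: q)
  case (Suc k)
  have "n (Suc k) - 1 - (n (Suc k) - 1 - q mod n (Suc k)) = q mod n (Suc k)"
    using mod_less_divisor[OF n_pos, of q k] by linarith
  then show ?case unfolding mass.simps(2) reflect_child[OF Suc.prems]
    using Suc.IH[OF parent_less[OF Suc.prems]] by simp
qed simp

lemma mass_child: "i < n (Suc k) \<Longrightarrow> mass n p (Suc k) (q * n (Suc k) + i) = mass n p k q * p (Suc k) i"
  by simp

end

section \<open>Masses of components and balance across gaps\<close>

declare left_end.simps [simp del] comp_count.simps(2) [simp del] mass.simps [simp del]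

definition reverse_weights :: "(nat \<Rightarrow> nat) \<Rightarrow> (nat \<Rightarrow> nat \<Rightarrow> real) \<Rightarrow> nat \<Rightarrow> nat \<Rightarrow> real" where
  "reverse_weights n p = (\<lambda>k i. p k (n k - 1 - i))"

text \<open>Across every gap that is shorter than its two neighbours: the left neighbour has at most \<open>C\<close>
  times the mass of the right one, and the last \<open>l\<close> children of a component weigh at most \<open>C\<close> times
  the first \<open>l\<close>. The bound on the gap in the second part says that it is shorter than \<open>l\<close> periods
  and one more child; this is the form in which the upper bound defining \<open>s\<^sub>k\<close> enters.
  The opposite inequalities are the same condition for the reversed weights.\<close>

definition left_bounded_by_right ::
  "real \<Rightarrow> (nat \<Rightarrow> nat) \<Rightarrow> (nat \<Rightarrow> real) \<Rightarrow> (nat \<Rightarrow> nat \<Rightarrow> real) \<Rightarrow> bool" where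
  "left_bounded_by_right C n c p \<longleftrightarrow>
     (\<forall>k q. Suc q < comp_count n k \<and> gap_right n c k q < comp_length n c k \<longrightarrow>
        mass n p k q \<le> C * mass n p k (Suc q) \<and>
        (\<forall>l. 1 \<le> l \<and> l \<le> n (Suc k) \<and>
           gap_right n c k q < real l * (comp_length n c (Suc k) + gap_length n c (Suc k))
             + comp_length n c (Suc k) \<longrightarrow>
           sum (p (Suc k)) {n (Suc k) - l..<n (Suc k)} \<le> C * sum (p (Suc k)) {0..<l}))"

lemma mass_cong:
  assumes "\<And>k i. i < n (Suc k) \<Longrightarrow> p (Suc k) i = p' (Suc k) i" "\<And>k. 0 < n (Suc k)"
  shows "mass n p k q = mass n p' k q"
  by (induction k arbitrary: q) (simp_all add: mass.simps assms)

lemma left_bounded_by_right_cong: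
  assumes "\<And>k i. i < n (Suc k) \<Longrightarrow> p (Suc k) i = p' (Suc k) i" "\<And>k. 0 < n (Suc k)"
  shows "left_bounded_by_right C n c p \<longleftrightarrow> left_bounded_by_right C n c p'"
proof -
  have "sum (p (Suc k)) {n (Suc k) - l..<n (Suc k)} = sum (p' (Suc k)) {n (Suc k) - l..<n (Suc k)}" for k l
    by (rule sum.cong) (use assms in auto)
  moreover have mass: "mass n p = mass n p'" by (intro ext mass_cong assms)
  moreover have "sum (p (Suc k)) {0..<l} = sum (p' (Suc k)) {0..<l}" if "l \<le> n (Suc k)" for k l
    by (rule sum.cong) (use assms that in auto)
  ultimately show ?thesis
    unfolding left_bounded_by_right_def mass
    by (intro iff_allI imp_cong conj_cong refl) auto
qed

lemma sum_reverse:
  fixes f :: "nat \<Rightarrow> real"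
  assumes "b \<le> m"
  shows "(\<Sum>i\<in>{a..<b}. f (m - 1 - i)) = sum f {m - b..<m - a}"
  by (rule sum.reindex_bij_witness[of _ "\<lambda>i. m - 1 - i" "\<lambda>i. m - 1 - i"]) (use assms in auto)

lemma block_uniform_reverse:
  assumes "block_uniform C s m f"
  shows "block_uniform C s m (\<lambda>i. f (m - 1 - i))"
  unfolding block_uniform_def
proof (intro allI impI; elim conjE)
  fix a b l assume *: "s \<le> l" "a \<le> b + l" "b \<le> a + l" "a + l \<le> m" "b + l \<le> m"
  have "m - a = m - (a + l) + l" "m - b = m - (b + l) + l" using * by auto
  then show "(\<Sum>i\<in>{a..<a + l}. f (m - 1 - i)) \<le> C * (\<Sum>i\<in>{b..<b + l}. f (m - 1 - i))"
    using block_uniformD[OF assms, of l "m - (a + l)" "m - (b + l)"] *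
    unfolding sum_reverse[OF *(4)] sum_reverse[OF *(5)] by simp
qed

locale cantor_weights = cantor_geometry +
  fixes p :: "nat \<Rightarrow> nat \<Rightarrow> real"
  assumes p_pos: "i < n (Suc k) \<Longrightarrow> 0 < p (Suc k) i"
    and p_sum: "(\<Sum>i<n (Suc k). p (Suc k) i) = 1"
begin

abbreviation M where "M \<equiv> mass n p"

lemma weights_nonneg: "i < n (Suc k) \<Longrightarrow> 0 \<le> p (Suc k) i"
  using p_pos[of i k] by simp

lemma mass_pos: "0 < M k q"
  by (induction k arbitrary: q) (use p_pos n_pos in \<open>auto simp: mass.simps\<close>)

lemma mass_nonneg: "0 \<le> M k q"
  using mass_pos[of k q] by simp

lemma sum_mass_children:
  assumes "v \<le> n (Suc k)"
  shows "sum (M (Suc k)) {q * n (Suc k) + u..<q * n (Suc k) + v} = M k q * sum (p (Suc k)) {u..<v}"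
proof -
  have "sum (M (Suc k)) {q * n (Suc k) + u..<q * n (Suc k) + v} =
      (\<Sum>i\<in>{u..<v}. M (Suc k) (q * n (Suc k) + i))"
    by (rule sum.reindex_bij_witness[of _ "\<lambda>i. q * n (Suc k) + i" "\<lambda>t. t - q * n (Suc k)"]) auto
  also have "\<dots> = (\<Sum>i\<in>{u..<v}. M k q * p (Suc k) i)"
    by (rule sum.cong) (use assms in \<open>auto simp: mass_child simp del: mass.simps\<close>)
  finally show ?thesis by (simp add: sum_distrib_left)
qed

lemma p_le_one_sum: "sum (p (Suc k)) {0..<n (Suc k)} = 1"
  using p_sum[of k] by (simp add: lessThan_atLeast0)

lemma left_bounded_by_right_reverse_iff:
  "left_bounded_by_right C n c (reverse_weights n p) \<longleftrightarrow>
     (\<forall>k q. Suc q < N k \<and> gap k q < len k \<longrightarrow>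
        M k (Suc q) \<le> C * M k q \<and>
        (\<forall>l. 1 \<le> l \<and> l \<le> n (Suc k) \<and>
           gap k q < real l * (len (Suc k) + eps (Suc k)) + len (Suc k) \<longrightarrow>
           sum (p (Suc k)) {0..<l} \<le> C * sum (p (Suc k)) {n (Suc k) - l..<n (Suc k)}))"
proof -
  let ?p = "reverse_weights n p"
  define r where "r k q = N k - 1 - Suc q" for k q
  have first: "sum (?p (Suc k)) {0..<l} = sum (p (Suc k)) {n (Suc k) - l..<n (Suc k)}"
    and last: "sum (?p (Suc k)) {n (Suc k) - l..<n (Suc k)} = sum (p (Suc k)) {0..<l}"
    if "l \<le> n (Suc k)" for k l
    using that sum_reverse[of l "n (Suc k)" "p (Suc k)" 0]
      sum_reverse[of "n (Suc k)" "n (Suc k)" "p (Suc k)" "n (Suc k) - l"]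
    by (simp_all add: reverse_weights_def)
  have mass: "mass n ?p k (r k q) = M k (Suc q)" "mass n ?p k (Suc (r k q)) = M k q"
    and gap: "gap k (r k q) = gap k q"
    if "Suc q < N k" for k q
  proof -
    show "gap k (r k q) = gap k q" using gap_reflect[OF that] by (simp add: r_def)
    have "Suc (r k q) = N k - 1 - q" using that by (simp add: r_def)
    then show "mass n ?p k (r k q) = M k (Suc q)" "mass n ?p k (Suc (r k q)) = M k q"
      using mass_reflect[of "Suc q" k p] mass_reflect[of q k p] that
      by (simp_all add: reverse_weights_def r_def)
  qed
  have involution: "Suc (r k q) < N k" "r k (r k q) = q"
    if "Suc q < N k" for k q using that by (auto simp: r_def)
  have swap: "(\<forall>q. Suc q < N k \<longrightarrow> Q q) \<longleftrightarrow> (\<forall>q. Suc q < N k \<longrightarrow> Q (r k q))" for k Q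
    using involution by metis
  have "left_bounded_by_right C n c ?p \<longleftrightarrow> (\<forall>k q. Suc q < N k \<longrightarrow> gap k q < len k \<longrightarrow>
      mass n ?p k q \<le> C * mass n ?p k (Suc q) \<and>
        (\<forall>l. 1 \<le> l \<and> l \<le> n (Suc k) \<and>
           gap k q < real l * (len (Suc k) + eps (Suc k)) + len (Suc k) \<longrightarrow>
           sum (?p (Suc k)) {n (Suc k) - l..<n (Suc k)} \<le> C * sum (?p (Suc k)) {0..<l}))"
    unfolding left_bounded_by_right_def by blast
  also have "\<dots> \<longleftrightarrow> (\<forall>k q. Suc q < N k \<longrightarrow> gap k (r k q) < len k \<longrightarrow>
      mass n ?p k (r k q) \<le> C * mass n ?p k (Suc (r k q)) \<and>
        (\<forall>l. 1 \<le> l \<and> l \<le> n (Suc k) \<and>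
           gap k (r k q) < real l * (len (Suc k) + eps (Suc k)) + len (Suc k) \<longrightarrow>
           sum (?p (Suc k)) {n (Suc k) - l..<n (Suc k)} \<le> C * sum (?p (Suc k)) {0..<l}))"
    by (subst swap) (rule refl)
  also have "\<dots> \<longleftrightarrow> (\<forall>k q. Suc q < N k \<and> gap k q < len k \<longrightarrow>
        M k (Suc q) \<le> C * M k q \<and>
        (\<forall>l. 1 \<le> l \<and> l \<le> n (Suc k) \<and>
           gap k q < real l * (len (Suc k) + eps (Suc k)) + len (Suc k) \<longrightarrow>
           sum (p (Suc k)) {0..<l} \<le> C * sum (p (Suc k)) {n (Suc k) - l..<n (Suc k)}))"
    by (simp add: gap mass first last cong: conj_cong imp_cong) blast
  finally show ?thesis .
qed
end

section \<open>Masses of balls\<close>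

text \<open>The measure enters only through the masses \<open>V x r\<close> of balls, and only through the bounds that
  follow from the masses of the components of one level: the components that meet
  the ball bound it from above and the components inside it bound it from below.
  Unlike a measure, this structure is reflected without effort.\<close>

locale cantor_masses = cantor_weights +
  fixes V :: "real \<Rightarrow> real \<Rightarrow> real"
  assumes V_le: "V x r \<le> sum (mass n p k) {q. q < N k \<and> lft k q < x + r \<and> x - r < lft k q + len k}"
    and V_ge: "sum (mass n p k) {q. q < N k \<and> x - r < lft k q \<and> lft k q + len k < x + r} \<le> V x r"
begin

lemma V_nonneg: "0 \<le> V x r"
  by (rule order_trans[OF sum_nonneg V_ge]) (rule mass_nonneg)

lemma V_le_block:
  assumes "a = 0 \<or> lft k (a - 1) + len k \<le> x - r" "N k \<le> b \<or> x + r \<le> lft k b" "a \<le> N k"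
  shows "V x r \<le> sum (M k) {a..<b}"
proof (rule order_trans[OF V_le sum_mono2])
  show "{q. q < N k \<and> lft k q < x + r \<and> x - r < lft k q + len k} \<subseteq> {a..<b}"
  proof safe
    fix q assume q: "q < N k" "lft k q < x + r" "x - r < lft k q + len k"
    have "a \<le> q"
    proof (rule ccontr)
      assume "\<not> a \<le> q"
      then have "lft k q \<le> lft k (a - 1)" "a \<noteq> 0" using assms(3) by (auto intro!: lft_mono)
      then show False using assms(1) q(3) by auto
    qed
    moreover have "q < b"
    proof (rule ccontr)
      assume "\<not> q < b"
      then have "lft k b \<le> lft k q" "b < N k" using q(1) by (auto intro!: lft_mono)
      then show False using assms(2) q(2) by auto
    qed
    ultimately show "q \<in> {a..<b}" by simp
  qed
qed (auto simp: mass_nonneg)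

lemma V_ge_block:
  assumes "b \<le> N k" "x - r < lft k a" "lft k (b - 1) + len k < x + r"
  shows "sum (M k) {a..<b} \<le> V x r"
proof (rule order_trans[OF sum_mono2 V_ge])
  show "{a..<b} \<subseteq> {q. q < N k \<and> x - r < lft k q \<and> lft k q + len k < x + r}"
  proof safe
    fix q assume "q \<in> {a..<b}"
    then have q: "a \<le> q" "q \<le> b - 1" "q < N k" "b - 1 < N k" using assms(1) by auto
    show "q < N k" by fact
    show "x - r < lft k q" "lft k q + len k < x + r"
      using lft_mono[OF q(1,3)] lft_mono[OF q(2,4)] assms by linarith+
  qed
qed (auto simp: mass_nonneg)

text \<open>Every statement proved for ball masses thus has a mirror image, with reversed weights.\<close>

lemma reflected: "cantor_masses n c (\<lambda>k i. p k (n k - 1 - i)) (\<lambda>x. V (1 - x))"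
proof unfold_locales
  fix k i assume "i < n (Suc k)"
  then show "0 < p (Suc k) (n (Suc k) - 1 - i)" using p_pos by simp
next
  fix k
  have "(\<Sum>i<n (Suc k). p (Suc k) (n (Suc k) - 1 - i)) = (\<Sum>i<n (Suc k). p (Suc k) i)"
    by (rule sum.reindex_bij_witness[of _ "\<lambda>i. n (Suc k) - 1 - i" "\<lambda>i. n (Suc k) - 1 - i"]) auto
  then show "(\<Sum>i<n (Suc k). p (Suc k) (n (Suc k) - 1 - i)) = 1" using p_sum by simp
next
  fix x r k
  let ?M' = "mass n (\<lambda>k i. p k (n k - 1 - i)) k"
  have "sum (M k) {q. q < N k \<and> lft k q < 1 - x + r \<and> 1 - x - r < lft k q + len k} =
      sum ?M' {q. q < N k \<and> lft k q < x + r \<and> x - r < lft k q + len k}"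
    by (rule sum.reindex_bij_witness[of _ "\<lambda>q. N k - 1 - q" "\<lambda>q. N k - 1 - q"])
      (auto simp: lft_reflect mass_reflect simp del: diff_diff_left One_nat_def)
  then show "V (1 - x) r \<le> sum ?M' {q. q < N k \<and> lft k q < x + r \<and> x - r < lft k q + len k}"
    using V_le[of "1 - x" r k] by simp
  have "sum (M k) {q. q < N k \<and> 1 - x - r < lft k q \<and> lft k q + len k < 1 - x + r} =
      sum ?M' {q. q < N k \<and> x - r < lft k q \<and> lft k q + len k < x + r}"
    by (rule sum.reindex_bij_witness[of _ "\<lambda>q. N k - 1 - q" "\<lambda>q. N k - 1 - q"])
      (auto simp: lft_reflect mass_reflect simp del: diff_diff_left One_nat_def)
  then show "sum ?M' {q. q < N k \<and> x - r < lft k q \<and> lft k q + len k < x + r} \<le> V (1 - x) r"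
    using V_ge[where x = "1 - x" and r = r and k = k] by simp
qed

end

section \<open>Doubling forces balance\<close>

locale doubling_masses = cantor_masses +
  fixes D :: real
  assumes D_ge_1: "1 \<le> D"
    and doubling: "x \<in> cantor_set n c \<Longrightarrow> 0 < r \<Longrightarrow> V x (2 * r) \<le> D * V x r"
begin

lemma doubling_power: "x \<in> cantor_set n c \<Longrightarrow> 0 < r \<Longrightarrow> V x (2 ^ m * r) \<le> D ^ m * V x r"
proof (induction m)
  case (Suc m)
  have "V x (2 * (2 ^ m * r)) \<le> D * V x (2 ^ m * r)" using Suc.prems by (intro doubling) auto
  also have "\<dots> \<le> D * (D ^ m * V x r)" using Suc D_ge_1 by (intro mult_left_mono) auto
  finally show ?case by (simp add: mult.assoc)
qed simp

text \<open>The way in which doubling is used: if the ball of radius \<open>r\<close> meets only the block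
  \<open>{a..<b}\<close> and the ball of radius \<open>2 ^ m * r\<close> contains the block \<open>{a'..<b'}\<close>, then the masses of these blocks
  compare. The alternatives \<open>a = 0\<close> and \<open>N k \<le> b\<close> are the blocks beyond which there is nothing.\<close>

lemma compare_blocks:
  assumes "x \<in> cantor_set n c" "0 < r"
    and "a = 0 \<or> lft k (a - 1) + len k \<le> x - r" "N k \<le> b \<or> x + r \<le> lft k b" "a \<le> N k"
    and "b' \<le> N k" "x - 2 ^ m * r < lft k a'" "lft k (b' - 1) + len k < x + 2 ^ m * r"
  shows "sum (M k) {a'..<b'} \<le> D ^ m * sum (M k) {a..<b}"
proof -
  have "sum (M k) {a'..<b'} \<le> V x (2 ^ m * r)" by (rule V_ge_block[OF assms(6-8)])
  also have "\<dots> \<le> D ^ m * V x r" by (rule doubling_power[OF assms(1,2)])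
  also have "\<dots> \<le> D ^ m * sum (M k) {a..<b}"
    using D_ge_1 by (intro mult_left_mono V_le_block[OF assms(3-5)]) auto
  finally show ?thesis .
qed

lemma reflected_doubling: "doubling_masses n c (\<lambda>k i. p k (n k - 1 - i)) (\<lambda>x. V (1 - x)) D"
proof -
  interpret R: cantor_masses n c "\<lambda>k i. p k (n k - 1 - i)" "\<lambda>x. V (1 - x)" by (rule reflected)
  show ?thesis by unfold_locales (use D_ge_1 doubling cantor_set_reflect in auto)
qed

text \<open>The second block has to contain a point that is far from the rest of the set. For \<open>l \<ge> 2\<close> this is
  an end point in the middle of the block, and for \<open>l = 1\<close> with long gaps any point of the child.
  If the block reaches an end of the parent, components of other parents could be close; they are
  avoided by choosing the first or the last parent of the level. A block
  that reaches both ends is equal to the first block.\<close>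

lemma sibling_blocks_comparable:
  assumes "1 \<le> l" "2 \<le> l \<or> len (Suc k) \<le> eps (Suc k)"
    and "a \<le> b + l" "b \<le> a + l" "a + l \<le> n (Suc k)" "b + l \<le> n (Suc k)"
  shows "sum (p (Suc k)) {a..<a + l} \<le> D ^ 4 * sum (p (Suc k)) {b..<b + l}"
proof (cases "a = b")
  case True
  have "0 \<le> sum (p (Suc k)) {b..<b + l}"
    using assms by (auto intro!: sum_nonneg less_imp_le[OF p_pos])
  then have "1 * sum (p (Suc k)) {b..<b + l} \<le> D ^ 4 * sum (p (Suc k)) {b..<b + l}"
    using D_ge_1 by (intro mult_right_mono one_le_power) auto
  then show ?thesis using True by simp
next
  case False
  define m where "m = n (Suc k)"
  define h where "h = len (Suc k) + eps (Suc k)"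
  (* Nothing lies to the left of parent 0 and nothing to the right of the last parent. *)
  define q where "q = (if b = 0 then 0 else N k - 1)"
  define u where "u = max 1 (l div 2)"
  define Y where "Y = lft k q"
  (* On its left, x has u children of the block; on its right, the other l - u children,
     which are separated from x by a gap. So x has distance at least u h / 2 from the
     remaining components on both sides; the factor 1 / 2 is needed only for l = 1. *)
  define x where "x = lft (Suc k) (q * m + (b + u - 1)) + len (Suc k)"
  define r where "r = real u * h / 2"
  have pos: "0 < len (Suc k)" "0 < eps (Suc k)" "0 < h"
    using len_pos eps_pos unfolding h_def by (auto intro: add_pos_pos)
  have u: "1 \<le> u" "u \<le> l" "l \<le> 3 * u" "l = 1 \<or> 2 * u \<le> l" using assms(1) by (auto simp: u_def)
  have q: "q < N k" using N_pos by (simp add: q_def)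
  have lft: "lft (Suc k) (q * m + i) = Y + real i * h" if "i < m" for i
    using lft_child[of i k q] that by (simp add: m_def h_def Y_def)
  have less: "q * m + i < N (Suc k)" if "i < m" for i
    using child_less_count[OF q that] by (simp add: m_def comp_count.simps)
  have x: "x = Y + real (b + u - 1) * h + len (Suc k)"
    using lft[of "b + u - 1"] u assms by (simp add: x_def m_def)
  have xE: "x \<in> cantor_set n c" unfolding x_def
    by (rule right_end_in_cantor_set, rule less) (use u assms in \<open>auto simp: m_def\<close>)
  have "sum (M (Suc k)) {q * m + a..<q * m + (a + l)}
      \<le> D ^ 4 * sum (M (Suc k)) {q * m + b..<q * m + (b + l)}"
  proof (rule compare_blocks[OF xE])
    show "0 < r" using pos u by (simp add: r_def)
    show "q * m + b = 0 \<or> lft (Suc k) (q * m + b - 1) + len (Suc k) \<le> x - r"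
    proof (cases "b = 0")
      case False
      then have e: "q * m + b - 1 = q * m + (b - 1)" by simp
      have "real (b - 1) * h + real u * h = real (b + u - 1) * h"
        using False u by (simp add: of_nat_diff flip: distrib_right)
      moreover have "0 \<le> real u * h" using pos by simp
      moreover have "lft (Suc k) (q * m + (b - 1)) = Y + real (b - 1) * h"
        using lft assms by (simp add: m_def)
      ultimately show ?thesis
        unfolding e x r_def by linarith
    qed (simp add: q_def)
    show "N (Suc k) \<le> q * m + (b + l) \<or> x + r \<le> lft (Suc k) (q * m + (b + l))"
    proof (cases "b + l < m")
      case True
      have "real (b + l) * h = real (b + u - 1) * h + real (l - u) * h + h"
        using u by (simp add: of_nat_diff algebra_simps)
      moreover have "real u * h / 2 \<le> real (l - u) * h + eps (Suc k)"
      proof (cases "l = 1")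
        case True
        then have "u = 1" "h \<le> 2 * eps (Suc k)" using u assms(2) by (auto simp: h_def)
        then show ?thesis using pos by (simp add: True)
      next
        case False
        then have "real u * h \<le> real (l - u) * h" using u pos by (intro mult_right_mono) auto
        moreover have "0 \<le> real u * h" using pos by simp
        ultimately show ?thesis using pos by linarith
      qed
      ultimately show ?thesis unfolding x lft[OF True] r_def using pos by (simp add: h_def)
    next
      case False
      then have "b \<noteq> 0" using assms \<open>a \<noteq> b\<close> by (auto simp: m_def)
      then have "q * m + (b + l) = N k * m" using False assms N_pos[of k]
        by (simp add: q_def m_def diff_mult_distrib)
      then show ?thesis by (simp add: m_def comp_count.simps)
    qed
    show "q * m + b \<le> N (Suc k)" using less[of b] assms by (simp add: m_def)
    show "q * m + (a + l) \<le> N (Suc k)" proof -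
      have "q * m + (a + l - 1) < N (Suc k)" using assms(1,5) by (intro less) (simp add: m_def)
      then show ?thesis using assms(1) by linarith
    qed
    have r16: "2 ^ 4 * r = 8 * (real u * h)" by (simp add: r_def)
    have 1: "real (b + u - 1) * h \<le> real a * h + real l * h + real u * h - h"
    proof -
      have "real (b + u - 1) * h \<le> (real a + real l + real u - 1) * h"
        using u assms pos by (intro mult_right_mono) (auto simp: of_nat_diff)
      then show ?thesis by (simp add: algebra_simps)
    qed
    have lu: "real l * h \<le> 3 * (real u * h)" "0 < real u * h" 
      using mult_right_mono[of "real l" "real (3 * u)" h] u pos by auto
    show "x - 2 ^ 4 * r < lft (Suc k) (q * m + a)"
    proof -
      have "lft (Suc k) (q * m + a) = Y + real a * h" using lft assms by (simp add: m_def)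
      then show ?thesis unfolding x r16 using 1 lu pos h_def by linarith
    qed
    have 2: "real (a + l - 1) * h + real u * h \<le> real (b + u - 1) * h + 2 * (real l * h)"
    proof -
      have "(real (a + l - 1) + real u) * h \<le> (real (b + u - 1) + 2 * real l) * h"
        using u assms pos by (intro mult_right_mono) (auto simp: of_nat_diff)
      then show ?thesis by (simp add: algebra_simps)
    qed
    have e: "q * m + (a + l) - 1 = q * m + (a + l - 1)" using assms(1) by simp
    show "lft (Suc k) (q * m + (a + l) - 1) + len (Suc k) < x + 2 ^ 4 * r"
    proof -
      have "lft (Suc k) (q * m + (a + l - 1)) = Y + real (a + l - 1) * h"
        using assms(1,5) by (intro lft) (simp add: m_def)
      then show ?thesis unfolding e x r16 using 2 lu pos by linarith
    qed
  qed
  then have "M k q * sum (p (Suc k)) {a..<a + l} \<le> M k q * (D ^ 4 * sum (p (Suc k)) {b..<b + l})"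
    using assms sum_mass_children[of "a + l" k q a] sum_mass_children[of "b + l" k q b]
    by (simp add: m_def algebra_simps)
  then show ?thesis using mass_pos[of k q] by simp
qed

text \<open>A ball around a point near the middle of the right component gives the claim if there is such
  a point. Otherwise the right component splits into two children \<open>Y\<^sub>1, Y\<^sub>2\<close> with a gap longer than
  each of them, and so does the left one, into \<open>X\<^sub>1, X\<^sub>2\<close>. Then \<open>Y\<^sub>1\<close> is isolated on its right, which bounds \<open>X\<^sub>2\<close> by
  \<open>Y\<^sub>1\<close>; and the two weights of this level are comparable by \<open>sibling_blocks_comparable\<close>,
  as the gap is longer than a child.

  Gaps up to eight times the length of the components are admitted, because
  \<open>edge_children_comparable\<close> has a direct argument for the longer ones only.\<close>

lemma adjacent_comparable:
  assumes "Suc q < N k" "gap k q < 8 * len k"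
  shows "M k q \<le> D ^ 10 * M k (Suc q)"
proof -
  define m where "m = n (Suc k)"
  define d where "d = len (Suc k)"
  define e where "e = eps (Suc k)"
  define g where "g = gap k q"
  define Y where "Y = lft k (Suc q)"
  have pos: "0 < d" "0 < e" "0 < g" "0 < len k"
    using len_pos eps_pos gap_pos[OF assms(1)] by (auto simp: d_def e_def g_def)
  have m: "2 \<le> m" using two_le_n by (simp add: m_def)
  have dk: "len k = real m * (d + e) - e" using len_split[of k] by (simp add: m_def d_def e_def)
  have Y: "Y = lft k q + len k + g" using lft_Suc[of k q] by (simp add: Y_def g_def)
  have g: "g < 8 * len k" using assms by (simp add: g_def)
  have child: "lft (Suc k) (Q * m + i) = lft k Q + real i * (d + e)" if "i < m" for Q i
    using lft_child[of i k Q] that by (simp add: m_def d_def e_def)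
  have less: "Q * m + i < N (Suc k)" if "Q < N k" "i < m" for Q i
    using child_less_count[OF that] by (simp add: m_def comp_count.simps)
  show ?thesis
  proof (cases "3 \<le> m \<or> e \<le> d")
    case True
    (* This point has distance at least m h / 6, where h = d + e, from both ends of the component:
       for m >= 3 because u and m - u - 1 are at least m / 6, and for m = 2 because the last child
       is at least half a period long. *)
    define u where "u = m div 2"
    define x where "x = lft (Suc k) (Suc q * m + u)"
    define r where "r = real m * (d + e) / 6"
    have u: "u < m" "m \<le> 3 * u" "m = 2 \<and> u = 1 \<or> m + 6 * u + 6 \<le> 6 * m" "2 * u \<le> m"
      using m by (auto simp: u_def)
    have x: "x = Y + real u * (d + e)" using child[OF u(1), of "Suc q"] by (simp add: x_def Y_def)
    have xE: "x \<in> cantor_set n c" unfolding x_def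
      by (rule lft_in_cantor_set, rule less) (use u assms in auto)
    have um: "real m * (d + e) \<le> 3 * (real u * (d + e))" "2 * (real u * (d + e)) \<le> real m * (d + e)"
      using mult_right_mono[of "real m" "real (3 * u)" "d + e"]
        mult_right_mono[of "real (2 * u)" "real m" "d + e"] u pos by auto
    have mp: "2 * (d + e) \<le> real m * (d + e)" using m pos by (intro mult_right_mono) auto
    have "sum (M k) {q..<Suc q} \<le> D ^ 6 * sum (M k) {Suc q..<Suc (Suc q)}"
    proof (rule compare_blocks[OF xE])
      show "0 < r" using pos m by (simp add: r_def)
      show "Suc q = 0 \<or> lft k (Suc q - 1) + len k \<le> x - r"
        unfolding x Y r_def using um mp pos by simp
      have "x + r \<le> Y + len k"
        using u(3)
      proof
        assume "m = 2 \<and> u = 1"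
        then show ?thesis using True pos by (simp add: x r_def dk)
      next
        assume "m + 6 * u + 6 \<le> 6 * m"
        then have "real (m + 6 * u + 6) * (d + e) \<le> real (6 * m) * (d + e)"
          using pos by (intro mult_right_mono) auto
        then have "real m * (d + e) + 6 * (real u * (d + e)) + 6 * (d + e) \<le> 6 * (real m * (d + e))"
          by (simp add: distrib_right)
        moreover have "B + A / 6 \<le> A - e" if "A + 6 * B + 6 * (d + e) \<le> 6 * A" for A B
          using that pos by simp
        ultimately show ?thesis unfolding x r_def dk by fastforce
      qed
      then show "N k \<le> Suc (Suc q) \<or> x + r \<le> lft k (Suc (Suc q))"
        using lft_less[of "Suc q" "Suc (Suc q)" k] by (fastforce simp: Y_def)
      show "Suc q \<le> N k" "Suc q \<le> N k" using assms(1) by auto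
      have r64: "2 ^ 6 * r = 32 / 3 * (real m * (d + e))" by (simp add: r_def)
      show "x - 2 ^ 6 * r < lft k q" unfolding r64 x Y using um mp pos g dk by linarith
      show "lft k (Suc q - 1) + len k < x + 2 ^ 6 * r"
        unfolding r64 x Y diff_Suc_1 using um mp pos by linarith
    qed
    then have "M k q \<le> D ^ 6 * M k (Suc q)" by simp
    also have "\<dots> \<le> D ^ 10 * M k (Suc q)"
      using D_ge_1 mass_nonneg by (intro mult_right_mono power_increasing) auto
    finally show ?thesis .
  next
    case False
    then have m2: "m = 2" and de: "d < e" using m by auto
    (* The right end of Y_1: on its left the nearest other component is at distance d + g,
       on its right at distance e. *)
    define x where "x = lft (Suc k) (Suc q * m + 0) + len (Suc k)"
    define r where "r = min (d + g) e"
    have x: "x = Y + d" using child[of 0 "Suc q"] m by (simp add: x_def Y_def d_def)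
    have xE: "x \<in> cantor_set n c" unfolding x_def
      by (rule right_end_in_cantor_set, rule less) (use m assms in auto)
    have prev: "lft (Suc k) (Suc (2 * q)) = lft k q + d + e" "len k = 2 * d + e"
      using child[of 1 q] m2 dk by (auto simp: mult.commute)
    have "sum (M (Suc k)) {2 * q + 1..<2 * q + 2} \<le> D ^ 6 * sum (M (Suc k)) {2 * q + 2..<2 * q + 3}"
    proof (rule compare_blocks[OF xE])
      show "0 < r" using pos by (simp add: r_def)
      have "2 * q + 2 - 1 = Suc (2 * q)" by simp
      then show "2 * q + 2 = 0 \<or> lft (Suc k) (2 * q + 2 - 1) + len (Suc k) \<le> x - r"
        using pos Y prev by (simp add: r_def x d_def[symmetric])
      have "lft (Suc k) (2 * q + 3) = Y + d + e"
        using child[of 1 "Suc q"] m2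
        by (simp add: Y_def mult.commute add.commute numeral_3_eq_3)
      then show "N (Suc k) \<le> 2 * q + 3 \<or> x + r \<le> lft (Suc k) (2 * q + 3)"
        by (simp add: x r_def)
      show "2 * q + 2 \<le> N (Suc k)" "2 * q + 2 \<le> N (Suc k)"
        using less[of "Suc q" 0] assms m2 by (auto simp: mult.commute)
      have "2 * d + g < 2 ^ 6 * r" using pos de g prev by (simp add: r_def min_def)
      then show "x - 2 ^ 6 * r < lft (Suc k) (2 * q + 1)"
        "lft (Suc k) (2 * q + 2 - 1) + len (Suc k) < x + 2 ^ 6 * r"
        using pos prev Y by (auto simp: x d_def[symmetric])
    qed
    then have "M (Suc k) (q * n (Suc k) + 1) \<le> D ^ 6 * M (Suc k) (Suc q * n (Suc k) + 0)"
      using m2 by (simp add: m_def mult.commute numeral_3_eq_3)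
    then have 1: "M k q * p (Suc k) 1 \<le> D ^ 6 * (M k (Suc q) * p (Suc k) 0)"
      using mass_child[of 1 k p q] mass_child[of 0 k p "Suc q"] m2 m_def by simp
    have "sum (p (Suc k)) {0..<0 + 1} \<le> D ^ 4 * sum (p (Suc k)) {1..<1 + 1}"
      using m2 de by (intro sibling_blocks_comparable) (auto simp: m_def d_def e_def)
    then have 2: "p (Suc k) 0 \<le> D ^ 4 * p (Suc k) 1" by simp
    have p1: "0 < p (Suc k) 1" using p_pos m2 by (simp add: m_def)
    have "M k q * p (Suc k) 1 \<le> D ^ 6 * (M k (Suc q) * (D ^ 4 * p (Suc k) 1))"
      using D_ge_1 mass_nonneg by (intro order_trans[OF 1] mult_left_mono 2) auto
    also have "\<dots> = (D ^ 10 * M k (Suc q)) * p (Suc k) 1"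
      using power_add[of D 6 4] by simp
    finally show ?thesis using p1 by simp
  qed
qed

end

context doubling_masses
begin

lemma power_le_three_power: "i \<le> j \<Longrightarrow> D ^ i \<le> 3 * D ^ j"
  using power_increasing[of i j D] one_le_power[OF D_ge_1, of j] D_ge_1 by linarith

lemma next_weight_comparable:
  assumes "Suc i < n (Suc k)" "eps (Suc k) < 8 * len (Suc k)"
  shows "p (Suc k) i \<le> D ^ 10 * p (Suc k) (Suc i)"
proof -
  have "Suc i < N (Suc k)"
    using child_less_count[OF N_pos[of k] assms(1)] by (simp add: comp_count.simps)
  moreover have "gap (Suc k) i = eps (Suc k)" using gap_sibling[OF assms(1), of 0] by simp
  ultimately have "M (Suc k) i \<le> D ^ 10 * M (Suc k) (Suc i)"
    using assms(2) by (intro adjacent_comparable) auto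
  moreover have "M (Suc k) i = M k 0 * p (Suc k) i" "M (Suc k) (Suc i) = M k 0 * p (Suc k) (Suc i)"
    using mass_child[of _ k p 0] assms by auto
  ultimately have "M k 0 * p (Suc k) i \<le> M k 0 * (D ^ 10 * p (Suc k) (Suc i))"
    by (simp add: algebra_simps)
  then show ?thesis using mass_pos[of k 0] by simp
qed

lemma previous_weight_comparable:
  assumes "Suc i < n (Suc k)" "eps (Suc k) < 8 * len (Suc k)"
  shows "p (Suc k) (Suc i) \<le> D ^ 10 * p (Suc k) i"
proof -
  interpret R: doubling_masses n c "\<lambda>k i. p k (n k - 1 - i)" "\<lambda>x. V (1 - x)" D
    by (rule reflected_doubling)
  have "n (Suc k) - 1 - (n (Suc k) - 1 - Suc i) = Suc i"
    "n (Suc k) - 1 - Suc (n (Suc k) - 1 - Suc i) = i"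
    using assms(1) by linarith+
  then show ?thesis
    using R.next_weight_comparable[of "n (Suc k) - 1 - Suc i" k] assms by simp
qed

text \<open>Single weights of children with short gaps are the case not covered by
  \<open>sibling_blocks_comparable\<close>; the children are then adjacent components
  in the sense of \<open>adjacent_comparable\<close>.\<close>

lemma weights_block_uniform: "block_uniform (D ^ 10) 1 (n (Suc k)) (p (Suc k))"
  unfolding block_uniform_def
proof (intro allI impI, elim conjE)
  fix a b l assume l: "1 \<le> l" and ab: "a \<le> b + l" "b \<le> a + l" "a + l \<le> n (Suc k)" "b + l \<le> n (Suc k)"
  have nn: "0 \<le> sum (p (Suc k)) {b..<b + l}"
    using ab weights_nonneg by (auto intro!: sum_nonneg)
  have D: "1 \<le> D ^ 10" "D ^ 4 \<le> D ^ 10" using D_ge_1 by (auto intro!: power_increasing)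
  show "sum (p (Suc k)) {a..<a + l} \<le> D ^ 10 * sum (p (Suc k)) {b..<b + l}"
  proof (cases "2 \<le> l \<or> len (Suc k) \<le> eps (Suc k)")
    case True
    show ?thesis
      using sibling_blocks_comparable[OF l True ab] mult_right_mono[OF D(2) nn] by linarith
  next
    case False
    then have l1: "l = 1" and e: "eps (Suc k) < 8 * len (Suc k)" using l len_pos[of "Suc k"] by auto
    then consider "a = b" | "b = Suc a" | "a = Suc b" using ab by linarith
    then show ?thesis
    proof cases
      case 1
      then show ?thesis using mult_right_mono[OF D(1) nn] by simp
    next
      case 2
      then show ?thesis using next_weight_comparable[of a k] e ab l1 by simp
    next
      case 3
      then show ?thesis using previous_weight_comparable[of b k] e ab l1 by simp
    qed
  qed
qed

text \<open>If the gap is too long for \<open>adjacent_comparable\<close>, then the gaps of the next level are of the same order,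
  so the right child is isolated at the scale of the gap.\<close>

lemma edge_children_comparable:
  assumes "Suc q < N k" "gap k q < 4 * (len (Suc k) + eps (Suc k))"
  shows "M k q * p (Suc k) (n (Suc k) - 1) \<le> D ^ 10 * (M k (Suc q) * p (Suc k) 0)"
proof -
  define a where "a = q * n (Suc k) + (n (Suc k) - 1)"
  have a: "Suc a = Suc q * n (Suc k) + 0" using n_pos[of k] by (simp add: a_def)
  have less: "Suc a < N (Suc k)"
    unfolding a using child_less_count[OF assms(1) n_pos[of k]] by (simp add: comp_count.simps)
  have gap: "gap (Suc k) a = gap k q" using gap_last_child[of k q] by (simp add: a_def)
  have "M (Suc k) a \<le> D ^ 10 * M (Suc k) (Suc a)"
  proof (cases "gap k q < 8 * len (Suc k)")
    case True
    then show ?thesis using less gap by (intro adjacent_comparable) auto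
  next
    case False
    define g where "g = gap k q"
    define r where "r = g / 8"
    define x where "x = lft (Suc k) (Suc a)"
    have g: "8 * len (Suc k) \<le> g" "g < 8 * eps (Suc k)" using False assms(2) by (auto simp: g_def)
    have pos: "0 < len (Suc k)" by (rule len_pos)
    have x: "x = lft (Suc k) a + len (Suc k) + g" using lft_Suc[of "Suc k" a] gap by (simp add: x_def g_def)
    have "sum (M (Suc k)) {a..<Suc a} \<le> D ^ 4 * sum (M (Suc k)) {Suc a..<Suc (Suc a)}"
    proof (rule compare_blocks)
      show "x \<in> cantor_set n c" unfolding x_def by (rule lft_in_cantor_set[OF less])
      show "0 < r" using g pos by (simp add: r_def)
      show "Suc a = 0 \<or> lft (Suc k) (Suc a - 1) + len (Suc k) \<le> x - r"
        using g pos by (simp add: x r_def)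
      have "gap (Suc k) (Suc a) = eps (Suc k)"
        unfolding a by (rule gap_sibling) (use two_le_n[of k] in simp)
      then have "lft (Suc k) (Suc (Suc a)) = x + len (Suc k) + eps (Suc k)"
        using lft_Suc[of "Suc k" "Suc a"] by (simp add: x_def)
      then show "N (Suc k) \<le> Suc (Suc a) \<or> x + r \<le> lft (Suc k) (Suc (Suc a))"
        using g pos by (simp add: r_def)
      show "Suc a \<le> N (Suc k)" "Suc a \<le> N (Suc k)" using less by auto
      show "x - 2 ^ 4 * r < lft (Suc k) a" "lft (Suc k) (Suc a - 1) + len (Suc k) < x + 2 ^ 4 * r"
        using g pos by (auto simp: x r_def)
    qed
    then have "M (Suc k) a \<le> D ^ 4 * M (Suc k) (Suc a)" by simp
    also have "\<dots> \<le> D ^ 10 * M (Suc k) (Suc a)"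
      using D_ge_1 mass_nonneg by (intro mult_right_mono power_increasing) auto
    finally show ?thesis .
  qed
  then show ?thesis
    unfolding a using mass_child[of "n (Suc k) - 1" k p q] mass_child[of 0 k p "Suc q"] n_pos[of k]
    by (simp add: a_def)
qed

text \<open>For \<open>l \<ge> 4\<close> the block on the right has an end point with at least two children on its left, which keeps
  it away from the left component however short the gap is. With fewer children the distance to the left
  might be one child only, much less than the period; but then the blocks are comparable
  to single children by uniformity, and these are compared in \<open>edge_children_comparable\<close>.\<close>

lemma edge_blocks_comparable:
  assumes "Suc q < N k" "1 \<le> l" "l \<le> n (Suc k)"
    and "gap k q < (real l + 1) * (len (Suc k) + eps (Suc k))"
  shows "M k q * sum (p (Suc k)) {n (Suc k) - l..<n (Suc k)}
      \<le> 3 * D ^ 30 * (M k (Suc q) * sum (p (Suc k)) {0..<l})"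
proof -
  define m where "m = n (Suc k)"
  define h where "h = len (Suc k) + eps (Suc k)"
  have pos: "0 < len (Suc k)" "0 < eps (Suc k)" "0 < h"
    using len_pos eps_pos unfolding h_def by (auto intro: add_pos_pos)
  have l: "l \<le> m" using assms by (simp add: m_def)
  let ?F = "sum (p (Suc k)) {0..<l}" and ?G = "sum (p (Suc k)) {m - l..<m}"
  have p0: "p (Suc k) 0 \<le> ?F" 
    using sum_mono2[of "{0..<l}" "{0}" "p (Suc k)"] assms(2,3) weights_nonneg by auto
  show ?thesis
  proof (cases "l \<le> 3")
    case True
    have "?G \<le> real (Suc 2) * (D ^ 10) ^ 2 * sum (p (Suc k)) {m - 1..<m - 1 + 1}"
      using block_cover_left[OF weights_block_uniform[of k], of 1 "m - 1" "m - l" 2]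
        True l assms(2) D_ge_1 weights_nonneg[of _ k] by (simp add: m_def)
    then have G: "?G \<le> 3 * D ^ 20 * p (Suc k) (m - 1)" 
      using power_mult[of D 10 2] by simp
    have "(real l + 1) * h \<le> 4 * h" using True pos by (intro mult_right_mono) auto
    then have g: "gap k q < 4 * h" using assms(4) by (simp add: h_def)
    have "M k q * ?G \<le> M k q * (3 * D ^ 20 * p (Suc k) (m - 1))"
      by (rule mult_left_mono[OF G mass_nonneg])
    also have "\<dots> = 3 * D ^ 20 * (M k q * p (Suc k) (m - 1))" by simp
    also have "\<dots> \<le> 3 * D ^ 20 * (D ^ 10 * (M k (Suc q) * p (Suc k) 0))"
      using edge_children_comparable[OF assms(1)] g D_ge_1
      by (intro mult_left_mono) (auto simp: m_def h_def)
    also have "\<dots> \<le> 3 * D ^ 20 * (D ^ 10 * (M k (Suc q) * ?F))"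
      using D_ge_1 mass_nonneg by (intro mult_left_mono p0) auto
    also have "\<dots> = 3 * D ^ 30 * (M k (Suc q) * ?F)" using power_add[of D 20 10] by simp
    finally show ?thesis by (simp add: m_def)
  next
    case False
    define u where "u = l div 2"
    define g where "g = gap k q"
    define Y where "Y = lft k (Suc q)"
    define x where "x = lft (Suc k) (Suc q * m + (u - 1)) + len (Suc k)"
    define r where "r = real u * h / 2"
    have u: "2 \<le> u" "2 * u \<le> l" "l \<le> 3 * u" "u - 1 < m" using False l by (auto simp: u_def)
    have lft: "lft (Suc k) (Q * m + i) = lft k Q + real i * h" if "i < m" for i Q
      using lft_child[of i k Q] that by (simp add: m_def h_def)
    have less: "Suc q * m + i < N (Suc k)" if "i < m" for i
      using child_less_count[OF assms(1) that] by (simp add: m_def comp_count.simps)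
    have g: "0 < g" "g < real l * h + h"
      using assms(4) gap_pos[OF assms(1)] by (auto simp: g_def h_def distrib_right)
    have Y: "Y = lft k q + len k + g" using lft_Suc[of k q] by (simp add: Y_def g_def)
    have lk: "len k = real m * h - eps (Suc k)" using len_split[of k] by (simp add: m_def h_def)
    have x: "x = Y + real u * h - eps (Suc k)"
      using lft[OF u(4), of "Suc q"] u(1) by (simp add: x_def Y_def h_def of_nat_diff algebra_simps)
    have uh: "2 * h \<le> real u * h" "2 * (real u * h) \<le> real l * h" "real l * h \<le> 3 * (real u * h)"
      using mult_right_mono[of 2 "real u" h] mult_right_mono[of "real (2 * u)" "real l" h]
        mult_right_mono[of "real l" "real (3 * u)" h] u pos by auto
    have eh: "eps (Suc k) < h" using pos by (simp add: h_def)
    have r16: "2 ^ 4 * r = 8 * (real u * h)" by (simp add: r_def)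
    have "sum (M (Suc k)) {q * m + (m - l)..<q * m + m}
        \<le> D ^ 4 * sum (M (Suc k)) {Suc q * m + 0..<Suc q * m + l}"
    proof (rule compare_blocks)
      show "x \<in> cantor_set n c" unfolding x_def by (rule right_end_in_cantor_set[OF less[OF u(4)]])
      show "0 < r" using u pos by (simp add: r_def)
      have "q * m + m - 1 = q * m + (m - 1)" using l False by simp
      then have last: "lft (Suc k) (q * m + m - 1) + len (Suc k) = Y - g"
        using right_last_child[of k q] Y by (simp add: m_def)
      then have last': "lft (Suc k) (Suc q * m + 0 - 1) + len (Suc k) = Y - g"
        by (simp add: add.commute)
      show "Suc q * m + 0 = 0 \<or> lft (Suc k) (Suc q * m + 0 - 1) + len (Suc k) \<le> x - r"
        unfolding last' x r_def using uh g eh by linarith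
      show "N (Suc k) \<le> Suc q * m + l \<or> x + r \<le> lft (Suc k) (Suc q * m + l)"
      proof (cases "Suc q * m + l < N (Suc k)")
        case True
        have "lft (Suc k) (Suc q * m + (l - 1)) = Y + real l * h - h"
          using lft[of "l - 1" "Suc q"] l assms(2) by (simp add: Y_def of_nat_diff algebra_simps)
        moreover have "lft (Suc k) (Suc q * m + (l - 1)) + len (Suc k) < lft (Suc k) (Suc q * m + l)"
          using assms(2) by (intro lft_less True) auto
        ultimately have "Y + real l * h - eps (Suc k) < lft (Suc k) (Suc q * m + l)"
          by (simp add: h_def)
        then show ?thesis unfolding x r_def using uh pos by linarith
      qed simp
      show "Suc q * m + 0 \<le> N (Suc k)" "q * m + m \<le> N (Suc k)"
        using less[of 0] l assms(2) by auto
      have "lft (Suc k) (q * m + (m - l)) = Y - g - len k + real m * h - real l * h"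
        using lft[of "m - l" q] l assms(2) Y by (simp add: of_nat_diff algebra_simps)
      then show "x - 2 ^ 4 * r < lft (Suc k) (q * m + (m - l))"
        unfolding r16 x lk using uh g eh pos by linarith
      show "lft (Suc k) (q * m + m - 1) + len (Suc k) < x + 2 ^ 4 * r"
        unfolding last r16 x using uh g eh pos by linarith
    qed
    then have "M k q * ?G \<le> D ^ 4 * (M k (Suc q) * ?F)"
      using sum_mass_children[of m k q "m - l"] sum_mass_children[of l k "Suc q" 0] l
      by (simp only: m_def)
    also have "\<dots> \<le> 3 * D ^ 30 * (M k (Suc q) * ?F)"
    proof (rule mult_right_mono)
      show "D ^ 4 \<le> 3 * D ^ 30" by (rule power_le_three_power) simp
      show "0 \<le> M k (Suc q) * ?F"
        using l weights_nonneg mass_nonneg by (auto intro!: mult_nonneg_nonneg sum_nonneg simp: m_def)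
    qed
    finally show ?thesis by (simp add: m_def)
  qed
qed

text \<open>\<open>edge_blocks_comparable\<close> compares the ends weighted by the masses of their parents;
  the comparison of these masses in the opposite direction removes the factors.\<close>

lemma left_bounded_by_right_weights: "left_bounded_by_right (3 * D ^ 40) n c p"
  unfolding left_bounded_by_right_def
proof (intro allI impI conjI; elim conjE)
  fix k q assume q: "Suc q < N k" and g: "gap k q < len k"
  have D: "D ^ 10 \<le> 3 * D ^ 40" 
    by (rule power_le_three_power) simp
  show "M k q \<le> 3 * D ^ 40 * M k (Suc q)"
    using adjacent_comparable[OF q] g len_pos[of k] mult_right_mono[OF D mass_nonneg[of k "Suc q"]] by simp
  fix l assume l: "1 \<le> l" "l \<le> n (Suc k)" and
    gl: "gap k q < real l * (len (Suc k) + eps (Suc k)) + len (Suc k)"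
  interpret R: doubling_masses n c "\<lambda>k i. p k (n k - 1 - i)" "\<lambda>x. V (1 - x)" D
    by (rule reflected_doubling)
  have i: "Suc (N k - 1 - Suc q) = N k - 1 - q" using q by simp
  have "R.M k (N k - 1 - Suc q) \<le> D ^ 10 * R.M k (Suc (N k - 1 - Suc q))"
    using q g len_pos[of k] gap_reflect[OF q] by (intro R.adjacent_comparable) auto
  then have bwd: "M k (Suc q) \<le> D ^ 10 * M k q"
    unfolding i using mass_reflect[of q k p] mass_reflect[of "Suc q" k p] q by simp
  let ?F = "sum (p (Suc k)) {0..<l}" and ?G = "sum (p (Suc k)) {n (Suc k) - l..<n (Suc k)}"
  have F: "0 \<le> ?F" using l weights_nonneg by (auto intro!: sum_nonneg)
  have "M k q * ?G \<le> 3 * D ^ 30 * (M k (Suc q) * ?F)"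
    using gl eps_pos[of k] by (intro edge_blocks_comparable q l) (auto simp: algebra_simps)
  also have "\<dots> \<le> 3 * D ^ 30 * (D ^ 10 * M k q * ?F)"
    using D_ge_1 F by (intro mult_left_mono mult_right_mono bwd) auto
  also have "\<dots> = M k q * (3 * D ^ 40 * ?F)" using power_add[of D 30 10] by simp
  finally show "?G \<le> 3 * D ^ 40 * ?F" using mass_pos[of k q] by simp
qed

theorem balanced_if_doubling:
  "block_uniform (3 * D ^ 40) 1 (n (Suc k)) (p (Suc k))"
  "left_bounded_by_right (3 * D ^ 40) n c p"
  "left_bounded_by_right (3 * D ^ 40) n c (reverse_weights n p)"
proof -
  have "D ^ 10 \<le> 3 * D ^ 40" 
    by (rule power_le_three_power) simp
  then show "block_uniform (3 * D ^ 40) 1 (n (Suc k)) (p (Suc k))"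
    using block_uniform_mono[OF weights_block_uniform _ order_refl weights_nonneg] by simp
  show "left_bounded_by_right (3 * D ^ 40) n c p" by (rule left_bounded_by_right_weights)
  show "left_bounded_by_right (3 * D ^ 40) n c (reverse_weights n p)"
    unfolding reverse_weights_def
    by (rule doubling_masses.left_bounded_by_right_weights[OF reflected_doubling])
qed

end

section \<open>Balance forces doubling\<close>

text \<open>Comparability in both directions is needed, because a ball may reach across a gap to the right
  or to the left; assuming both makes the locale invariant under reflection.\<close>

locale balanced_masses = cantor_masses +
  fixes C :: real
  assumes C_ge_1: "1 \<le> C"
    and uniform: "block_uniform C 1 (n (Suc k)) (p (Suc k))"
    and balanced: "left_bounded_by_right C n c p"
    and balanced_reverse: "left_bounded_by_right C n c (reverse_weights n p)"
begin

lemma reflected_balanced: "balanced_masses n c (\<lambda>k i. p k (n k - 1 - i)) (\<lambda>x. V (1 - x)) C"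
proof -
  interpret R: cantor_masses n c "\<lambda>k i. p k (n k - 1 - i)" "\<lambda>x. V (1 - x)" by (rule reflected)
  show ?thesis
  proof unfold_locales
    show "left_bounded_by_right C n c (\<lambda>k i. p k (n k - 1 - i))"
      using balanced_reverse by (simp add: reverse_weights_def)
    have "left_bounded_by_right C n c (reverse_weights n (\<lambda>k i. p k (n k - 1 - i))) \<longleftrightarrow> left_bounded_by_right C n c p"
      by (rule left_bounded_by_right_cong) (use n_pos in \<open>auto simp: reverse_weights_def\<close>)
    then show "left_bounded_by_right C n c (reverse_weights n (\<lambda>k i. p k (n k - 1 - i)))" using balanced by simp
  qed (use C_ge_1 block_uniform_reverse[OF uniform] in auto)
qed

lemma right_neighbour:
  assumes "Suc q < N k" "gap k q < len k"
  shows "M k (Suc q) \<le> C * M k q"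
    and "\<lbrakk>1 \<le> l; l \<le> n (Suc k);
      gap k q < real l * (len (Suc k) + eps (Suc k)) + len (Suc k)\<rbrakk> \<Longrightarrow>
      sum (p (Suc k)) {0..<l} \<le> C * sum (p (Suc k)) {n (Suc k) - l..<n (Suc k)}"
  using balanced_reverse assms unfolding left_bounded_by_right_reverse_iff by blast+

lemma V_ge_children:
  assumes "q < N k" "lft (Suc k) (q * n (Suc k) + i) \<le> x"
    "x \<le> lft (Suc k) (q * n (Suc k) + i) + len (Suc k)"
    and "real (w - 1) * (len (Suc k) + eps (Suc k)) + len (Suc k) < r"
    and "a \<le> i" "i < a + w" "a + w \<le> n (Suc k)"
  shows "M k q * sum (p (Suc k)) {a..<a + w} \<le> V x r"
proof -
  define h where "h = len (Suc k) + eps (Suc k)"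
  have h: "0 < h" using len_pos[of "Suc k"] eps_pos[of k] by (simp add: h_def)
  have lft: "lft (Suc k) (q * n (Suc k) + j) = lft k q + real j * h" if "j < n (Suc k)" for j
    using lft_child[of j k q] that by (simp add: h_def)
  have w: "real (w - 1) * h + len (Suc k) < r" using assms(4) by (simp add: h_def)
  have "sum (M (Suc k)) {q * n (Suc k) + a..<q * n (Suc k) + (a + w)} \<le> V x r"
  proof (rule V_ge_block)
    show "q * n (Suc k) + (a + w) \<le> N (Suc k)"
      using mult_le_mono1[of "Suc q" "N k" "n (Suc k)"] assms(1,7) by (simp add: comp_count.simps)
    have "real i * h \<le> (real a + real (w - 1)) * h"
      using assms(5-7) h by (intro mult_right_mono) auto
    moreover have "lft (Suc k) (q * n (Suc k) + a) = lft k q + real a * h"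
      "lft (Suc k) (q * n (Suc k) + i) = lft k q + real i * h" using assms(5-7) by (auto intro!: lft)
    ultimately show "x - r < lft (Suc k) (q * n (Suc k) + a)"
      using assms(3) w by (simp add: distrib_right)
    have "real (a + w - 1) * h \<le> (real i + real (w - 1)) * h"
      using assms(5-7) h by (intro mult_right_mono) auto
    moreover have "lft (Suc k) (q * n (Suc k) + (a + w - 1)) = lft k q + real (a + w - 1) * h"
      using assms(5-7) by (intro lft) auto
    moreover have "q * n (Suc k) + (a + w) - 1 = q * n (Suc k) + (a + w - 1)" using assms(6) by simp
    ultimately show "lft (Suc k) (q * n (Suc k) + (a + w) - 1) + len (Suc k) < x + r"
      using assms(2) w \<open>lft (Suc k) (q * n (Suc k) + i) = lft k q + real i * h\<close>
      by (simp add: distrib_right)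
  qed
  then show ?thesis using sum_mass_children[of "a + w" k q a] assms(7) by simp
qed

lemma index_unique:
  assumes "q < N k" "q' < N k" "lft k q \<le> x" "x \<le> lft k q + len k" "lft k q' \<le> x" "x \<le> lft k q' + len k"
  shows "q = q'"
  using lft_less[of q q' k] lft_less[of q' q k] assms by (cases q q' rule: linorder_cases) auto

lemma child_containing:
  assumes "x \<in> cantor_set n c" "q < N k" "lft k q \<le> x" "x \<le> lft k q + len k"
  obtains i where "i < n (Suc k)" "lft (Suc k) (q * n (Suc k) + i) \<le> x"
    "x \<le> lft (Suc k) (q * n (Suc k) + i) + len (Suc k)"
proof -
  obtain q' where q': "q' < N (Suc k)" "lft (Suc k) q' \<le> x" "x \<le> lft (Suc k) q' + len (Suc k)"
    using cantor_setE[OF assms(1)] .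
  have "q' div n (Suc k) = q"
    by (rule index_unique[of _ k _ x])
      (use parent_interval[of k q'] parent_less[OF q'(1)] q' assms in auto)
  then have "q' = q * n (Suc k) + q' mod n (Suc k)" by (metis div_mult_mod_eq)
  then show ?thesis using that[of "q' mod n (Suc k)"] q' n_pos[of k] by simp
qed

lemma block_around:
  assumes "i < m" "1 \<le> w" "w \<le> (m::nat)"
  obtains a where "a \<le> i" "i < a + w" "a + w \<le> m"
  by (rule that[of "min i (m - w)"]) (use assms in auto)

text \<open>The ball contains a block of half of the children of the component, so uniformity applied to
  this block gives a definite proportion of its mass.\<close>

lemma half_radius_mass:
  assumes "x \<in> cantor_set n c" "q < N k" "lft k q \<le> x" "x \<le> lft k q + len k" "len k < 2 * r"
  shows "M k q \<le> 6 * C ^ 2 * V x r"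
proof -
  define m where "m = n (Suc k)"
  define w where "w = m div 2"
  have m: "2 \<le> m" using two_le_n by (simp add: m_def)
  then have w: "1 \<le> w" "w \<le> m" "m \<le> 3 * w" "2 * w \<le> m" by (auto simp: w_def)
  obtain i where i: "i < m" "lft (Suc k) (q * m + i) \<le> x" "x \<le> lft (Suc k) (q * m + i) + len (Suc k)"
    using child_containing[OF assms(1-4)] unfolding m_def .
  obtain a where a: "a \<le> i" "i < a + w" "a + w \<le> m" using block_around[OF i(1) w(1,2)] .
  define h where "h = len (Suc k) + eps (Suc k)"
  have h: "0 < h" "0 < eps (Suc k)" using len_pos[of "Suc k"] eps_pos[of k] by (auto simp: h_def)
  have "real (2 * w) * h \<le> real m * h" using w(4) h by (intro mult_right_mono) auto
  then have "real (w - 1) * h + len (Suc k) < r"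
    using w(1) h len_split[of k] assms(5) by (simp add: m_def h_def of_nat_diff algebra_simps)
  then have V: "M k q * sum (p (Suc k)) {a..<a + w} \<le> V x r"
    using assms(2) i a by (intro V_ge_children) (auto simp: h_def m_def)
  have "1 \<le> 2 * real (Suc 2) * C ^ 2 * sum (p (Suc k)) {a..<a + w}"
    unfolding p_le_one_sum[of k, symmetric]
    by (rule block_window[OF uniform[of k] C_ge_1])
      (use w a weights_nonneg in \<open>auto simp: m_def\<close>)
  then have "M k q * 1 \<le> M k q * (6 * C ^ 2 * sum (p (Suc k)) {a..<a + w})"
    by (intro mult_left_mono) (auto simp: mass_nonneg)
  also have "\<dots> = 6 * C ^ 2 * (M k q * sum (p (Suc k)) {a..<a + w})" by simp
  also have "\<dots> \<le> 6 * C ^ 2 * V x r" using C_ge_1 by (intro mult_left_mono V) auto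
  finally show ?thesis by simp
qed

text \<open>Let \<open>h\<close> be the period of level \<open>k + 1\<close>. The mass of the ball of radius \<open>r\<close> is at least a fixed multiple of the mass \<open>S\<close> of a block
  of about \<open>r / h\<close> children around \<open>x\<close>. In the parent of \<open>x\<close> the interval \<open>[x, x + 2r)\<close> meets only children within a bounded
  number of such block lengths, which uniformity compares to \<open>S\<close>. If it reaches the next
  component of level \<open>k\<close>, then \<open>x\<close> is close to the right end of its parent and the gap is less than
  \<open>2r\<close>, so balance bounds the children met there by the last \<open>L\<close> children
  of the parent of \<open>x\<close>, which are again near the block.\<close>

lemma right_half_mass:
  assumes x: "x \<in> cantor_set n c" and r: "len (Suc k) < 2 * r" "2 * r \<le> len k"
  shows "sum (M (Suc k)) {t. t < N (Suc k) \<and> x \<le> lft (Suc k) t + len (Suc k) \<and> lft (Suc k) t < x + 2 * r}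
    \<le> 312 * C ^ 16 * V x r" (is "sum _ ?A \<le> _")
proof -
  define m where "m = n (Suc k)"
  define h where "h = len (Suc k) + eps (Suc k)"
  have pos: "0 < len (Suc k)" "0 < eps (Suc k)" "0 < h"
    using len_pos eps_pos unfolding h_def by (auto intro: add_pos_pos)
  have m: "2 \<le> m" using two_le_n by (simp add: m_def)
  obtain q where q: "q < N k" "lft k q \<le> x" "x \<le> lft k q + len k" using cantor_setE[OF x] .
  obtain i where i: "i < m" "lft (Suc k) (q * m + i) \<le> x" "x \<le> lft (Suc k) (q * m + i) + len (Suc k)"
    using child_containing[OF x q] unfolding m_def .
  have lft: "lft (Suc k) (Q * m + j) = lft k Q + real j * h" if "j < m" for j Q
    using lft_child[of j k Q] that by (simp add: m_def h_def)
  have less: "Q * m + j < N (Suc k)" if "Q < N k" "j < m" for j Q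
    using child_less_count[OF that] by (simp add: m_def comp_count.simps)
  define f where "f = nat \<lfloor>r / h\<rfloor>"
  have "0 < r" using r(1) pos by simp
  then have "real f \<le> r / h" "r / h < real f + 1" using pos unfolding f_def by (simp, linarith)
  then have f: "real f * h \<le> r" "r < (real f + 1) * h" using pos by (auto simp: field_simps)
  (* Children at most f - 2 places away from that of x lie inside the ball, as f h <= r.
     For f <= 2 only the child of x itself is used, of which the ball may contain a part only;
     half_radius_mass covers that case. *)
  define l where "l = max 1 (f - 1)"
  define w where "w = min l m"
  have l: "1 \<le> l" "f + 1 \<le> l + 2" by (auto simp: l_def)
  have w: "1 \<le> w" "w \<le> m" "w = l \<or> w = m" using l m by (auto simp: w_def)
  have "(real f + 1) * h \<le> (real l + 2) * h" using l pos by (intro mult_right_mono) auto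
  then have rl: "r < (real l + 2) * h" using f by simp
  obtain a where a: "a \<le> i" "i < a + w" "a + w \<le> m" using block_around[OF i(1) w(1,2)] .
  define S where "S = M k q * sum (p (Suc k)) {a..<a + w}"
  have S0: "0 \<le> S" unfolding S_def
    using a weights_nonneg by (auto intro!: mult_nonneg_nonneg mass_nonneg sum_nonneg simp: m_def)
  have SV: "S \<le> 6 * C ^ 2 * V x r"
  proof (cases "f \<le> 2")
    case True
    then have "w = 1" using m by (simp add: w_def l_def)
    then have "a = i" using a by simp
    then have "S = M (Suc k) (q * m + i)"
      using \<open>w = 1\<close> mass_child[of i k p q] i(1) by (simp add: S_def m_def)
    then show ?thesis using half_radius_mass[OF x less[OF q(1) i(1)] i(2,3) r(1)] by simp
  next
    case False
    have "real (w - 1) * h \<le> (real f - 2) * h"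
      using False pos by (intro mult_right_mono) (auto simp: w_def l_def of_nat_diff)
    then have "real (w - 1) * h + len (Suc k) < r" 
      using f(1) pos by (simp add: algebra_simps) (simp add: h_def)
    then have "S \<le> V x r" unfolding S_def
      using q(1) i a by (intro V_ge_children) (auto simp: h_def m_def)
    also have "1 * V x r \<le> 6 * C ^ 2 * V x r"
      using one_le_power[OF C_ge_1, of 2] V_nonneg by (intro mult_right_mono) auto
    finally show ?thesis by simp
  qed
  have win: "M k q * sum (p (Suc k)) {u..<v} \<le> 26 * C ^ 12 * S"
    if "v \<le> m" "v \<le> a + w + 12 * w" "a \<le> u + 12 * w" for u v
  proof -
    have "sum (p (Suc k)) {u..<v} \<le> 2 * real (Suc 12) * C ^ 12 * sum (p (Suc k)) {a..<a + w}"
      by (rule block_window[OF uniform[of k] C_ge_1])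
        (use w a weights_nonneg that in \<open>auto simp: m_def\<close>)
    then have "M k q * sum (p (Suc k)) {u..<v} \<le> M k q * (26 * C ^ 12 * sum (p (Suc k)) {a..<a + w})"
      by (intro mult_left_mono mass_nonneg) simp
    then show ?thesis by (simp add: S_def algebra_simps)
  qed
  define v where "v = min m (i + 12 * l)"
  let ?B = "{t \<in> ?A. Suc q * m \<le> t}"
  have sub: "?A \<subseteq> {q * m + i..<q * m + v} \<union> ?B"
  proof
    fix t assume t: "t \<in> ?A"
    show "t \<in> {q * m + i..<q * m + v} \<union> ?B"
    proof (cases "Suc q * m \<le> t")
      case False
      have "q * m + i \<le> t"
      proof (rule ccontr)
        assume "\<not> ?thesis"
        then have "lft (Suc k) t + len (Suc k) < lft (Suc k) (q * m + i)"
          by (intro lft_less less q i) auto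
        then show False using t i by auto
      qed
      then obtain e where e: "t = q * m + e" "i \<le> e" by (metis add_le_cancel_left le_add1 le_iff_add order_trans)
      then have em: "e < m" using False by simp
      have "real e * h < real i * h + len (Suc k) + 2 * r"
        using t i lft[OF em, of q] lft[OF i(1), of q] e by auto
      also have "\<dots> < real i * h + 4 * r" using r by simp
      also have "\<dots> < real i * h + 4 * ((real l + 2) * h)" using rl by simp
      also have "\<dots> \<le> (real i + 12 * real l) * h"
        using l pos mult_right_mono[of "8 + 4 * real l" "12 * real l" h] by (simp add: algebra_simps)
      finally have "real e < real (i + 12 * l)" using pos by simp
      then show ?thesis using e em by (simp add: v_def)
    qed (use t in simp)
  qed
  have "sum (M (Suc k)) {q * m + i..<q * m + v} = M k q * sum (p (Suc k)) {i..<v}"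
    using sum_mass_children[of v k q i] by (simp add: v_def m_def)
  also have "\<dots> \<le> 26 * C ^ 12 * S"
    by (rule win) (use a w l in \<open>auto simp: v_def\<close>)
  finally have near: "sum (M (Suc k)) {q * m + i..<q * m + v} \<le> 26 * C ^ 12 * S" .
  have C12: "26 * C ^ 12 * S \<ge> 0" using C_ge_1 S0 by simp
  have far: "sum (M (Suc k)) ?B \<le> C ^ 2 * (26 * C ^ 12 * S)"
  proof (cases "?B = {}")
    case True
    then show ?thesis using C12 by (simp only: sum.empty) simp
  next
    case False
    then obtain t where t: "t < N (Suc k)" "Suc q * m \<le> t" "lft (Suc k) t < x + 2 * r" by auto
    then have "Suc q * m < N k * m" by (simp add: comp_count.simps m_def)
    then have Sq: "Suc q < N k" by (simp only: mult_less_cancel2)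
    define g where "g = gap k q"
    define Z where "Z = lft k (Suc q)"
    have Z: "Z = lft k q + len k + g" using lft_Suc[of k q] by (simp add: Z_def g_def)
    have Z1: "lft (Suc k) (Suc q * m + j) = Z + real j * h" if "j < m" for j
      using lft[OF that, of "Suc q"] by (simp add: Z_def)
    have "Z \<le> lft (Suc k) t" using lft_mono[OF t(2,1)] Z1[of 0] m by simp
    then have g: "g < 2 * r" "0 < g" using t q(3) gap_pos[OF Sq] by (auto simp: Z g_def)
    then have glen: "g < len k" using r by simp
    have lk: "len k = real m * h - eps (Suc k)" using len_split[of k] by (simp add: m_def h_def)
    (* The right end of child i and the left end of child e of the next component
       are less than 2 r < 2 (l + 2) h apart. *)
    have offset: "m - i + e \<le> 2 * l + 4" if e: "e < m" "lft (Suc k) (Suc q * m + e) < x + 2 * r" for e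
    proof -
      have "Z + real e * h < lft k q + real i * h + len (Suc k) + 2 * r"
        using e i Z1[OF e(1)] lft[OF i(1), of q] by auto
      then have "real m * h + real e * h < real i * h + h + 2 * r"
        using g unfolding Z lk by (simp add: h_def)
      also have "\<dots> < real i * h + h + 2 * ((real l + 2) * h)" using rl by simp
      also have "\<dots> = (real i + 5 + 2 * real l) * h" by (simp add: algebra_simps)
      finally have "(real m + real e) * h < (real i + 5 + 2 * real l) * h" by (simp add: distrib_right)
      then have "real m + real e < real i + 5 + 2 * real l" using pos by simp
      then show ?thesis using i(1) by linarith
    qed
    (* Long enough to contain all children met beyond the gap, to reach back to the child of x,
       and to make balance applicable, since the gap is shorter than the component of m children and than 2 (l + 2) h <= 6 l h. *)
    define L where "L = min m (6 * l)"
    have BL: "?B \<subseteq> {Suc q * m + 0..<Suc q * m + L}"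
    proof
      fix s assume s: "s \<in> ?B"
      have "s < Suc (Suc q) * m"
      proof (rule ccontr)
        assume "\<not> ?thesis"
        then have ge: "Suc (Suc q) * m \<le> s" by simp
        then have "Suc (Suc q) * m < N k * m" using s by (simp add: comp_count.simps m_def)
        then have "Suc (Suc q) < N k" by (simp only: mult_less_cancel2)
        then have "Z + len k < lft k (Suc (Suc q))" unfolding Z_def by (intro lft_less) auto
        also have "\<dots> \<le> lft (Suc k) s"
          using lft_mono[OF ge, of "Suc k"] s lft[of 0 "Suc (Suc q)"] m by simp
        finally show False using s g r q(3) by (simp add: Z)
      qed
      then obtain e where e: "s = Suc q * m + e" "e < m"
        using s by (metis (no_types, lifting) add.commute add_less_cancel_left le_iff_add mem_Collect_eq mult_Suc)
      have "m - i + e \<le> 2 * l + 4" by (rule offset[OF e(2)]) (use s e in simp)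
      then show "s \<in> {Suc q * m + 0..<Suc q * m + L}" using e i(1) l by (simp add: L_def)
    qed
    have "m - i + 0 \<le> 2 * l + 4"
      by (rule offset) (use m Z1[of 0] t \<open>Z \<le> lft (Suc k) t\<close> in auto)
    then have mi: "m \<le> i + 6 * l" using i(1) l by simp
    have gL: "g < real L * h + len (Suc k)"
    proof (cases "m \<le> 6 * l")
      case True
      then show ?thesis using glen lk pos by (simp add: L_def min_def)
    next
      case False
      have "g < 2 * ((real l + 2) * h)" using g rl by simp
      also have "\<dots> \<le> real (6 * l) * h"
        using l pos mult_right_mono[of "4 + 2 * real l" "6 * real l" h] by (simp add: algebra_simps)
      finally show ?thesis using False pos by (simp add: L_def min_def)
    qed
    have L: "1 \<le> L" "L \<le> m" using m l by (auto simp: L_def)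
    have "sum (M (Suc k)) ?B \<le> sum (M (Suc k)) {Suc q * m + 0..<Suc q * m + L}"
      by (rule sum_mono2[OF _ BL]) (auto intro: mass_nonneg)
    also have "\<dots> = M k (Suc q) * sum (p (Suc k)) {0..<L}"
      using sum_mass_children[of L k "Suc q" 0] L by (simp only: m_def)
    also have "\<dots> \<le> (C * M k q) * (C * sum (p (Suc k)) {m - L..<m})"
    proof (rule mult_mono)
      show "M k (Suc q) \<le> C * M k q" using right_neighbour(1)[OF Sq] glen by (simp add: g_def)
      show "sum (p (Suc k)) {0..<L} \<le> C * sum (p (Suc k)) {m - L..<m}"
        using right_neighbour(2)[OF Sq, of L] glen gL L by (simp add: g_def m_def h_def)
      show "0 \<le> C * M k q" using C_ge_1 mass_nonneg by simp
      show "0 \<le> sum (p (Suc k)) {0..<L}" using L weights_nonneg by (auto intro!: sum_nonneg simp: m_def)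
    qed
    also have "\<dots> = C ^ 2 * (M k q * sum (p (Suc k)) {m - L..<m})" by (simp add: power2_eq_square)
    also have "\<dots> \<le> C ^ 2 * (26 * C ^ 12 * S)"
      by (rule mult_left_mono[OF win]) (use a w mi in \<open>auto simp: L_def\<close>)
    finally show ?thesis .
  qed
  have "sum (M (Suc k)) ?A \<le> sum (M (Suc k)) ({q * m + i..<q * m + v} \<union> ?B)"
    by (rule sum_mono2[OF _ sub]) (auto intro: mass_nonneg)
  also have "\<dots> \<le> sum (M (Suc k)) {q * m + i..<q * m + v} + sum (M (Suc k)) ?B"
    using sum.union_inter[of "{q * m + i..<q * m + v}" ?B "M (Suc k)"]
      sum_nonneg[of "{q * m + i..<q * m + v} \<inter> ?B" "M (Suc k)"] mass_nonneg by fastforce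
  also have "\<dots> \<le> 26 * C ^ 12 * S + C ^ 2 * (26 * C ^ 12 * S)" using near far by simp
  also have "\<dots> \<le> C ^ 2 * (26 * C ^ 12 * S) + C ^ 2 * (26 * C ^ 12 * S)"
    using mult_right_mono[OF one_le_power[OF C_ge_1, of 2] C12] by linarith
  also have "\<dots> = 52 * C ^ 14 * S" using power_add[of C 2 12] by (simp add: mult.assoc[symmetric])
  also have "\<dots> \<le> 52 * C ^ 14 * (6 * C ^ 2 * V x r)" using C_ge_1 by (intro mult_left_mono SV) auto
  also have "\<dots> = 312 * C ^ 16 * V x r" using power_add[of C 14 2] by simp
  finally show ?thesis .
qed

lemma left_half_mass:
  assumes x: "x \<in> cantor_set n c" and r: "len (Suc k) < 2 * r" "2 * r \<le> len k"
  shows "sum (M (Suc k)) {t. t < N (Suc k) \<and> lft (Suc k) t \<le> x \<and> x - 2 * r < lft (Suc k) t + len (Suc k)}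
    \<le> 312 * C ^ 16 * V x r"
proof -
  interpret R: balanced_masses n c "\<lambda>k i. p k (n k - 1 - i)" "\<lambda>x. V (1 - x)" C
    by (rule reflected_balanced)
  have "sum (M (Suc k)) {t. t < N (Suc k) \<and> lft (Suc k) t \<le> x \<and> x - 2 * r < lft (Suc k) t + len (Suc k)}
    = sum (R.M (Suc k)) {t. t < N (Suc k) \<and> 1 - x \<le> lft (Suc k) t + len (Suc k) \<and> lft (Suc k) t < 1 - x + 2 * r}"
    by (rule sum.reindex_bij_witness[of _ "\<lambda>q. N (Suc k) - 1 - q" "\<lambda>q. N (Suc k) - 1 - q"])
      (auto simp: lft_reflect mass_reflect simp del: diff_diff_left One_nat_def)
  also have "\<dots> \<le> 312 * C ^ 16 * V (1 - (1 - x)) r"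
    by (rule R.right_half_mass) (use x r cantor_set_reflect in auto)
  finally show ?thesis by simp
qed

text \<open>For \<open>2r > 1\<close> the larger ball is bounded by the total mass, and the smaller one has a definite
  proportion of it.\<close>

theorem doubling_if_balanced:
  assumes x: "x \<in> cantor_set n c" and r: "0 < r"
  shows "V x (2 * r) \<le> 624 * C ^ 16 * V x r"
proof (cases "2 * r \<le> 1")
  case True
  obtain k where k: "len (Suc k) < 2 * r" "2 * r \<le> len k" using ex_len_bracket[of "2 * r"] r True by auto
  let ?L = "{t. t < N (Suc k) \<and> lft (Suc k) t \<le> x \<and> x - 2 * r < lft (Suc k) t + len (Suc k)}"
  let ?R = "{t. t < N (Suc k) \<and> x \<le> lft (Suc k) t + len (Suc k) \<and> lft (Suc k) t < x + 2 * r}"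
  have "V x (2 * r) \<le> sum (M (Suc k))
      {t. t < N (Suc k) \<and> lft (Suc k) t < x + 2 * r \<and> x - 2 * r < lft (Suc k) t + len (Suc k)}"
    by (rule V_le)
  also have "\<dots> \<le> sum (M (Suc k)) (?L \<union> ?R)"
    by (rule sum_mono2) (use len_pos[of "Suc k"] in \<open>auto intro: mass_nonneg\<close>)
  also have "\<dots> \<le> sum (M (Suc k)) ?L + sum (M (Suc k)) ?R"
    using sum.union_inter[of ?L ?R "M (Suc k)"] sum_nonneg[of "?L \<inter> ?R" "M (Suc k)"] mass_nonneg
    by fastforce
  also have "\<dots> \<le> 624 * C ^ 16 * V x r"
    using left_half_mass[OF x k] right_half_mass[OF x k] by simp
  finally show ?thesis .
next
  case False
  obtain q where q: "q < N 0" "lft 0 q \<le> x" "x \<le> lft 0 q + len 0" using cantor_setE[OF x] .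
  have "V x (2 * r) \<le> sum (M 0) {0..<1}" by (rule V_le_block) auto
  also have "\<dots> = M 0 q" by (simp add: mass.simps)
  also have "\<dots> \<le> 6 * C ^ 2 * V x r" by (rule half_radius_mass[OF x q]) (use False in simp)
  also have "\<dots> \<le> 624 * C ^ 16 * V x r"
    using power_increasing[of 2 16 C] C_ge_1 V_nonneg by (intro mult_right_mono mult_mono) auto
  finally show ?thesis .
qed

end

section \<open>Balance in terms of the weight vectors\<close>

lemma s_uniform_iff_block_uniform:
  assumes "\<forall>x\<in>set P. 0 < x" "0 < C" "1 \<le> s"
  shows "s_uniform C s P \<longleftrightarrow> block_uniform C s (length P) ((!) P)"
proof -
  have pos: "0 < sum ((!) P) {a..<a + l}" if "s \<le> l" "a + l \<le> length P" for a l
    using that assms by (intro sum_pos) auto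
  have ratio: "1 / C \<le> x / y \<and> x / y \<le> C \<longleftrightarrow> y \<le> C * x \<and> x \<le> C * y" if "0 < x" "0 < y" for x y
    using that assms(2) by (auto simp: field_simps)
  show ?thesis
  proof
    assume L: "s_uniform C s P"
    show "block_uniform C s (length P) ((!) P)"
      unfolding block_uniform_def
    proof (intro allI impI; elim conjE)
      fix a b l
      assume *: "s \<le> l" "a \<le> b + l" "b \<le> a + l" "a + l \<le> length P" "b + l \<le> length P"
      have both: "sum ((!) P) {v..<v + l} \<le> C * sum ((!) P) {u..<u + l} \<and>
          sum ((!) P) {u..<u + l} \<le> C * sum ((!) P) {v..<v + l}"
        if uv: "u \<le> v" "v \<le> u + l" "v + l \<le> length P" for u v
      proof -
        have "1 / C \<le> sum ((!) P) {u..<u + l} / sum ((!) P) {v..<v + l} \<and>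
            sum ((!) P) {u..<u + l} / sum ((!) P) {v..<v + l} \<le> C"
          using L uv *(1) unfolding s_uniform_def by simp
        moreover have "0 < sum ((!) P) {u..<u + l}" "0 < sum ((!) P) {v..<v + l}"
          using uv *(1) by (auto intro!: pos)
        ultimately show ?thesis using ratio by blast
      qed
      show "sum ((!) P) {a..<a + l} \<le> C * sum ((!) P) {b..<b + l}"
        using both[of a b] both[of b a] * by (cases "a \<le> b") auto
    qed
  next
    assume R: "block_uniform C s (length P) ((!) P)"
    show "s_uniform C s P"
      unfolding s_uniform_def
    proof (intro conjI assms(1) allI impI; elim conjE)
      fix i j l
      assume *: "s \<le> l" "l \<le> length P" "i \<le> j" "j \<le> i + l" "i + l \<le> j + l" "j + l \<le> length P"
      have "sum ((!) P) {j..<j + l} \<le> C * sum ((!) P) {i..<i + l} \<and>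
          sum ((!) P) {i..<i + l} \<le> C * sum ((!) P) {j..<j + l}"
        using * by (auto intro!: block_uniformD[OF R])
      then show "1 / C \<le> sum ((!) P) {i..<i + l} / sum ((!) P) {j..<j + l}"
        "sum ((!) P) {i..<i + l} / sum ((!) P) {j..<j + l} \<le> C"
        using ratio[of "sum ((!) P) {i..<i + l}" "sum ((!) P) {j..<j + l}"] pos[of l i] pos[of l j] *
        by auto
    qed
  qed
qed

lemma cancel_weights:
  fixes x y A B C :: real
  assumes "0 < x" "0 \<le> B" "0 \<le> C" "y \<le> C * x" "x * A \<le> C * (y * B)"
  shows "A \<le> C ^ 2 * B"
proof -
  have "x * A \<le> C * ((C * x) * B)"
    using assms(5) mult_left_mono[OF mult_right_mono[OF assms(4,2)] assms(3)] by (rule order_trans)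
  also have "\<dots> = x * (C ^ 2 * B)" by (simp add: power2_eq_square)
  finally show ?thesis using assms(1) by simp
qed

context cantor_geometry
begin

text \<open>As \<open>\<delta>\<close> decreases to \<open>0\<close>, the number \<open>m\<^sub>k\<close> is the least \<open>i\<close> with \<open>\<delta>\<^bsub>k+i\<^esub> \<le> \<epsilon>\<^sub>k\<close>.\<close>

lemma m_data_spec:
  assumes "k \<in> Lam n c"
  shows "1 \<le> m_data n c k" "len (k + m_data n c k) \<le> eps k" "eps k < len (k + m_data n c k - 1)"
proof -
  have k: "1 \<le> k" "eps k < len k" using assms by (auto simp: Lam_def)
  then have e: "0 < eps k" using eps_pos[of "k - 1"] by simp
  obtain j where j: "len j < eps k" using ex_len_less[OF e] by blast
  then have "len (k + j) \<le> eps k" using len_antimono[of j "k + j"] by simp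
  then have ex: "\<exists>i. len (k + i) \<le> eps k" ..
  define m where "m = (LEAST i. len (k + i) \<le> eps k)"
  have m: "len (k + m) \<le> eps k" unfolding m_def by (rule LeastI_ex[OF ex])
  have m1: "1 \<le> m" using m k by (cases m) auto
  have "\<not> len (k + (m - 1)) \<le> eps k" unfolding m_def
    by (rule not_less_Least) (use m1 in \<open>simp add: m_def\<close>)
  then have m2: "eps k < len (k + m - 1)" using m1 by simp
  have "m_data n c k = m"
    unfolding m_data_def
  proof (rule the_equality)
    fix i assume i: "1 \<le> i \<and> len (k + i) \<le> eps k \<and> eps k < len (k + i - 1)"
    show "i = m"
    proof (rule ccontr)
      assume "i \<noteq> m"
      then consider "i \<le> m - 1" | "m \<le> i - 1" by linarith
      then show False
      proof cases
        case 1
        then have "len (k + m - 1) \<le> len (k + i)" using m1 by (intro len_antimono) auto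
        then show False using i m2 by simp
      next
        case 2
        then have "len (k + i - 1) \<le> len (k + m)" using i by (intro len_antimono) auto
        then show False using i m by simp
      qed
    qed
  qed (use m m1 m2 in auto)
  then show "1 \<le> m_data n c k" "len (k + m_data n c k) \<le> eps k" "eps k < len (k + m_data n c k - 1)"
    using m m1 m2 by auto
qed

text \<open>In terms of the period \<open>h = \<delta>\<^sub>j + \<epsilon>\<^sub>j\<close> of the level \<open>j = k + m\<^sub>k\<close>, the defining inequalities of \<open>s\<^sub>k\<close> say
  that it is the integer part of \<open>(\<epsilon>\<^sub>k + \<epsilon>\<^sub>j) / h\<close>.\<close>

lemma s_data_spec:
  assumes "k \<in> Lam n c" "Suc K = k + m_data n c k"
  shows "1 \<le> s_data n c k" "s_data n c k \<le> n (Suc K)"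
    "real (s_data n c k) * (len (Suc K) + eps (Suc K)) \<le> eps k + eps (Suc K)"
    "eps k < real (s_data n c k) * (len (Suc K) + eps (Suc K)) + len (Suc K)"
proof -
  define h where "h = len (Suc K) + eps (Suc K)"
  have h: "0 < h" "0 < eps (Suc K)" using len_pos[of "Suc K"] eps_pos[of K] by (auto simp: h_def)
  have e: "len (Suc K) \<le> eps k" "eps k < len K"
    using m_data_spec[OF assms(1)] assms(2)[symmetric] by auto
  have form: "real s * len (Suc K) + (real s - 1) * eps (Suc K) = real s * h - eps (Suc K)"
    "(real s + 1) * len (Suc K) + real s * eps (Suc K) = (real s + 1) * h - eps (Suc K)" for s
    by (auto simp: h_def algebra_simps)
  define s where "s = nat \<lfloor>(eps k + eps (Suc K)) / h\<rfloor>"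
  have "1 \<le> (eps k + eps (Suc K)) / h" using e(1) h by (simp add: h_def)
  then have "real s \<le> (eps k + eps (Suc K)) / h" "(eps k + eps (Suc K)) / h < real s + 1" "1 \<le> s"
    unfolding s_def by linarith+
  then have s: "real s * h \<le> eps k + eps (Suc K)" "eps k + eps (Suc K) < (real s + 1) * h" "1 \<le> s"
    using h by (auto simp: pos_le_divide_eq pos_divide_less_eq)
  have "s_data n c k = s"
    unfolding s_data_def Let_def assms(2)[symmetric] form
  proof (rule the_equality)
    fix i assume i: "1 \<le> i \<and> real i * h - eps (Suc K) \<le> eps k \<and> eps k < (real i + 1) * h - eps (Suc K)"
    have "real i * h < (real s + 1) * h" "real s * h < (real i + 1) * h" using i s by linarith+
    then have "real i < real s + 1" "real s < real i + 1" using h by auto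
    then show "i = s" by linarith
  qed (use s in auto)
  moreover have "real s * h < real (n (Suc K)) * h"
    using s(1) e(2) len_split[of K] by (simp add: h_def)
  then have "s \<le> n (Suc K)" using h by simp
  ultimately show "1 \<le> s_data n c k" "s_data n c k \<le> n (Suc K)"
    "real (s_data n c k) * (len (Suc K) + eps (Suc K)) \<le> eps k + eps (Suc K)"
    "eps k < real (s_data n c k) * (len (Suc K) + eps (Suc K)) + len (Suc K)"
    using s by (auto simp: h_def algebra_simps)
qed

end

context cantor_weights
begin

text \<open>The gap between the first two siblings of level \<open>k + 1\<close> persists on all later levels; its
  neighbours there are reached through last children on the left and first children on the right.\<close>

lemma adjacent_pair_below_siblings:
  "\<exists>q. Suc q < N (Suc k + t) \<and> gap (Suc k + t) q = eps (Suc k) \<and>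
     M (Suc k + t) q = M k 0 * p (Suc k) 0 * (\<Prod>j=1..t. p (Suc k + j) (n (Suc k + j) - 1)) \<and>
     M (Suc k + t) (Suc q) = M k 0 * p (Suc k) 1 * (\<Prod>j=1..t. p (Suc k + j) 0)"
proof (induction t)
  case 0
  have "1 < N (Suc k)" using child_less_count[of 0 "N k" 1 "n (Suc k)"] N_pos two_le_n[of k]
    by (simp add: comp_count.simps)
  then show ?case
    using gap_sibling[of 0 k 0] two_le_n[of k] mass_child[of 0 k p 0] mass_child[of 1 k p 0]
    by (intro exI[of _ 0]) auto
next
  case (Suc t)
  then obtain q where q: "Suc q < N (Suc k + t)" "gap (Suc k + t) q = eps (Suc k)"
     "M (Suc k + t) q = M k 0 * p (Suc k) 0 * (\<Prod>j=1..t. p (Suc k + j) (n (Suc k + j) - 1))"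
     "M (Suc k + t) (Suc q) = M k 0 * p (Suc k) 1 * (\<Prod>j=1..t. p (Suc k + j) 0)"
    by blast
  define K where "K = Suc k + t"
  have K: "Suc k + Suc t = Suc K" by (simp add: K_def)
  let ?q = "q * n (Suc K) + (n (Suc K) - 1)"
  have Sq: "Suc ?q = Suc q * n (Suc K) + 0" using n_pos[of K] by simp
  have "Suc ?q < N (Suc K)" unfolding Sq
    using child_less_count[OF q(1) n_pos[of K]] by (simp add: comp_count.simps K_def)
  moreover have "gap (Suc K) ?q = eps (Suc k)" using gap_last_child[of K q] q(2) by (simp add: K_def)
  moreover have "M (Suc K) ?q = M K q * p (Suc K) (n (Suc K) - 1)"
    using mass_child[of "n (Suc K) - 1" K p q] n_pos[of K] by simp
  moreover have "M (Suc K) (Suc ?q) = M K (Suc q) * p (Suc K) 0"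
    unfolding Sq using mass_child[of 0 K p "Suc q"] n_pos[of K] by simp
  ultimately show ?case unfolding K using q(3,4) K_def
    by (intro exI[of _ ?q]) (simp add: mult.assoc)
qed

text \<open>Conversely, going up from two neighbouring components one arrives at siblings: as long as
  they have different parents, the left one is a last child, the right one a first
  child, and the parents are neighbours with the same gap.\<close>

lemma adjacent_pair_from_siblings:
  "Suc q < N K \<Longrightarrow> \<exists>k t Q i. K = Suc k + t \<and> Suc i < n (Suc k) \<and> gap K q = eps (Suc k) \<and>
     M K q = M k Q * p (Suc k) i * (\<Prod>j=1..t. p (Suc k + j) (n (Suc k + j) - 1)) \<and>
     M K (Suc q) = M k Q * p (Suc k) (Suc i) * (\<Prod>j=1..t. p (Suc k + j) 0)"
proof (induction K arbitrary: q)
  case (Suc K)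
  obtain Q i where i: "i < n (Suc K)" "q = Q * n (Suc K) + i" by (rule child_cases)
  show ?case
  proof (cases "Suc i < n (Suc K)")
    case True
    then have "gap (Suc K) q = eps (Suc K)" "M (Suc K) q = M K Q * p (Suc K) i"
      "M (Suc K) (Suc q) = M K Q * p (Suc K) (Suc i)"
      using gap_sibling[OF True, of Q] mass_child[of i K p Q] mass_child[of "Suc i" K p Q] i by auto
    then show ?thesis using True
      by (intro exI[of _ K] exI[of _ 0] exI[of _ Q] exI[of _ i]) simp
  next
    case False
    then have q: "q = Q * n (Suc K) + (n (Suc K) - 1)" using i by simp
    then have Sq: "Suc q = Suc Q * n (Suc K) + 0" using n_pos[of K] by simp
    have "Suc Q < N K" using Suc.prems last_child_parent[of Q K] q by (simp only:)
    from Suc.IH[OF this] obtain k t Q' i' where *: "K = Suc k + t" "Suc i' < n (Suc k)"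
      "gap K Q = eps (Suc k)"
      "M K Q = M k Q' * p (Suc k) i' * (\<Prod>j=1..t. p (Suc k + j) (n (Suc k + j) - 1))"
      "M K (Suc Q) = M k Q' * p (Suc k) (Suc i') * (\<Prod>j=1..t. p (Suc k + j) 0)" by blast
    have "gap (Suc K) q = eps (Suc k)" using gap_last_child[of K Q] * by (simp only: q)
    moreover have "M (Suc K) q = M K Q * p (Suc K) (n (Suc K) - 1)"
      using mass_child[of "n (Suc K) - 1" K p Q] n_pos[of K] by (simp add: q)
    moreover have "M (Suc K) (Suc q) = M K (Suc Q) * p (Suc K) 0"
      unfolding Sq using mass_child[of 0 K p "Suc Q"] n_pos[of K] by simp
    ultimately show ?thesis using *
      by (intro exI[of _ k] exI[of _ "Suc t"] exI[of _ Q'] exI[of _ i']) (simp add: mult.assoc)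
  qed
qed simp

end

definition edge_condition ::
  "(nat \<Rightarrow> nat) \<Rightarrow> (nat \<Rightarrow> real) \<Rightarrow> (nat \<Rightarrow> real list) \<Rightarrow> real \<Rightarrow> bool" where
  "edge_condition n c P C \<longleftrightarrow> (\<forall>k\<ge>1. uniform_vector C (P k)) \<and>
      (\<forall>k\<in>Lam n c.
        (\<forall>t. 1 \<le> t \<and> t < m_data n c k \<longrightarrow>
          uniform_vector C (P (k + t) @ P (k + t)) \<and>
          1 / C * (\<Prod>j=1..t. P (k + j) ! 0) \<le> (\<Prod>j=1..t. P (k + j) ! (n (k + j) - 1)) \<and>
          (\<Prod>j=1..t. P (k + j) ! (n (k + j) - 1)) \<le> C * (\<Prod>j=1..t. P (k + j) ! 0)) \<and>
        s_uniform C (s_data n c k) (P (k + m_data n c k) @ P (k + m_data n c k)))"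

locale cantor_vectors = cantor_geometry +
  fixes P :: "nat \<Rightarrow> real list"
  assumes prob: "\<And>k. k \<ge> 1 \<Longrightarrow> positive_probability_vector (P k)"
    and matching: "matching n P"
begin

lemma length_P: "length (P (Suc k)) = n (Suc k)"
  using matching by (simp add: matching_def)

lemma P_pos: "x \<in> set (P (Suc k)) \<Longrightarrow> 0 < x"
  using prob[of "Suc k"] by (simp add: positive_probability_vector_def)

sublocale cantor_weights n c "\<lambda>k. (!) (P k)"
proof unfold_locales
  fix k i assume "i < n (Suc k)"
  then show "0 < P (Suc k) ! i" using P_pos nth_mem length_P by metis
next
  fix k
  have "(\<Sum>i<n (Suc k). P (Suc k) ! i) = sum_list (P (Suc k))"
    by (simp add: sum_list_sum_nth length_P lessThan_atLeast0)
  then show "(\<Sum>i<n (Suc k). P (Suc k) ! i) = 1"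
    using prob[of "Suc k"] by (simp add: positive_probability_vector_def)
qed

lemma uniform_vector_iff:
  "0 < C \<Longrightarrow> uniform_vector C (P (Suc k)) \<longleftrightarrow> block_uniform C 1 (n (Suc k)) ((!) (P (Suc k)))"
  using s_uniform_iff_block_uniform[of "P (Suc k)" C 1] P_pos by (simp add: length_P)

lemma s_uniform_append_iff:
  "0 < C \<Longrightarrow> 1 \<le> s \<Longrightarrow> s_uniform C s (P (Suc k) @ P (Suc k)) \<longleftrightarrow>
     block_uniform C s (2 * n (Suc k)) ((!) (P (Suc k) @ P (Suc k)))"
  using s_uniform_iff_block_uniform[of "P (Suc k) @ P (Suc k)" C s] P_pos
  by (auto simp: length_P mult_2)

text \<open>Given \<open>k \<in> \<Lambda>\<close>, balance is applied to the neighbours at the gap between the first two siblings of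
  level \<open>k\<close>, on every level \<open>k + t\<close> with \<open>t < m\<^sub>k\<close>. Their masses give the products, and the
  blocks of their children give the concatenated vector of level \<open>k + t + 1\<close>.\<close>

lemma edge_condition_if_balanced:
  assumes C: "1 < C" and U: "\<And>k. block_uniform C 1 (n (Suc k)) ((!) (P (Suc k)))"
    and B: "left_bounded_by_right C n c (\<lambda>k. (!) (P k))"
    and R: "left_bounded_by_right C n c (reverse_weights n (\<lambda>k. (!) (P k)))"
  shows "edge_condition n c P (4 * C ^ 4)"
proof -
  have "C \<le> C ^ 4" "C ^ 2 \<le> C ^ 4" "0 < C ^ 4"
    using self_le_power[of C 4] power_increasing[of 2 4 C] C by auto
  then have C4: "C \<le> 4 * C ^ 4" "C ^ 2 \<le> 4 * C ^ 4" "0 < 4 * C ^ 4" by linarith+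
  have uniform: "uniform_vector (4 * C ^ 4) (P (Suc k))" for k
    unfolding uniform_vector_iff[OF C4(3)]
    by (rule block_uniform_mono[OF U C4(1) order_refl weights_nonneg])
  have append: "s_uniform (4 * C ^ 4) s (P (Suc K) @ P (Suc K))"
    if s: "1 \<le> s" "s \<le> n (Suc K)" and K: "K = Suc k + t" "eps (Suc k) < len K"
      and large: "eps (Suc k) < real s * (len (Suc K) + eps (Suc K)) + len (Suc K)" for s K k t
  proof -
    obtain q where q: "Suc q < N K" "gap K q = eps (Suc k)"
      using adjacent_pair_below_siblings[of k t] K by blast
    have h: "0 < len (Suc K) + eps (Suc K)" using len_pos eps_pos by (intro add_pos_pos)
    have "ends_comparable C s (n (Suc K)) ((!) (P (Suc K)))"
      unfolding ends_comparable_def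
    proof (intro allI impI)
      fix l assume l: "s \<le> l \<and> l \<le> n (Suc K)"
      then have "real s * (len (Suc K) + eps (Suc K)) \<le> real l * (len (Suc K) + eps (Suc K))"
        using h by (intro mult_right_mono) auto
      then have "gap K q < real l * (len (Suc K) + eps (Suc K)) + len (Suc K)" using large q by simp
      moreover have "1 \<le> l" using l s by simp
      ultimately show "sum ((!) (P (Suc K))) {0..<l} \<le> C * sum ((!) (P (Suc K))) {n (Suc K) - l..<n (Suc K)} \<and>
          sum ((!) (P (Suc K))) {n (Suc K) - l..<n (Suc K)} \<le> C * sum ((!) (P (Suc K))) {0..<l}"
        using B[unfolded left_bounded_by_right_def, rule_format, of q K] R[unfolded left_bounded_by_right_reverse_iff, rule_format, of q K]
          q K(2) l by (simp only: simp_thms)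
    qed
    then have "block_uniform (4 * C ^ 4) s (2 * n (Suc K)) ((!) (P (Suc K) @ P (Suc K)))"
      using C s by (intro block_uniform_append_if_ends_comparable[OF U] weights_nonneg)
        (auto simp: length_P)
    then show ?thesis using s_uniform_append_iff[OF C4(3) s(1)] by simp
  qed
  show ?thesis
    unfolding edge_condition_def
  proof (intro conjI allI ballI impI; (elim conjE)?)
    fix k :: nat assume "1 \<le> k"
    then show "uniform_vector (4 * C ^ 4) (P k)" using uniform[of "k - 1"] by simp
  next
    fix k assume kL: "k \<in> Lam n c"
    then obtain k0 where k: "k = Suc k0" by (cases k) (auto simp: Lam_def)
    note m = m_data_spec[OF kL]
    {
      fix t assume t: "1 \<le> t" "t < m_data n c k"
      have below: "eps k < len (k + j)" if "j \<le> t" for j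
      proof -
        have "len (k + m_data n c k - 1) \<le> len (k + j)" by (rule len_antimono) (use t that in simp)
        then show ?thesis using m(3) by simp
      qed
      obtain t' where t': "t = Suc t'" using t by (cases t) auto
      have "s_uniform (4 * C ^ 4) 1 (P (Suc (k + t')) @ P (Suc (k + t')))"
      proof (rule append[of 1 "k + t'" k0 t'])
        show "eps (Suc k0) < len (k + t')" using below[of t'] t' k by simp
        show "eps (Suc k0) < real 1 * (len (Suc (k + t')) + eps (Suc (k + t'))) + len (Suc (k + t'))"
          using below[of t] t' k len_pos[of "Suc (k + t')"] eps_pos[of "k + t'"] by simp
      qed (use k n_pos in \<open>auto simp: Suc_le_eq\<close>)
      then show "uniform_vector (4 * C ^ 4) (P (k + t) @ P (k + t))" using t' by simp
      let ?A = "\<Prod>j=1..t. P (k + j) ! (n (k + j) - 1)" and ?B = "\<Prod>j=1..t. P (k + j) ! 0"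
      obtain q where q: "Suc q < N (k + t)" "gap (k + t) q = eps k"
        "M (k + t) q = M k0 0 * P k ! 0 * ?A" "M (k + t) (Suc q) = M k0 0 * P k ! 1 * ?B"
        using adjacent_pair_below_siblings[of k0 t] unfolding k[symmetric] by blast
      have pos: "0 < P k ! 0" "0 < P k ! 1" using p_pos[of 0 k0] p_pos[of 1 k0] two_le_n[of k0] k by auto
      have "0 < P (k + j) ! 0" "0 < P (k + j) ! (n (k + j) - 1)" for j
        using p_pos[of 0 "k0 + j"] p_pos[of "n (k + j) - 1" "k0 + j"] n_pos[of "k0 + j"] k by auto
      then have AB: "0 \<le> ?A" "0 \<le> ?B" by (auto intro!: prod_nonneg intro: less_imp_le)
      have ratio: "P k ! 0 \<le> C * P k ! 1" "P k ! 1 \<le> C * P k ! 0"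
        using block_uniformD[OF U[of k0], of 1 0 1] block_uniformD[OF U[of k0], of 1 1 0]
          two_le_n[of k0] k by auto
      have "M (k + t) q \<le> C * M (k + t) (Suc q)" "M (k + t) (Suc q) \<le> C * M (k + t) q"
        using B[unfolded left_bounded_by_right_def] R[unfolded left_bounded_by_right_reverse_iff] q(1,2) below[of t] by auto
      then have "M k0 0 * (P k ! 0 * ?A) \<le> M k0 0 * (C * (P k ! 1 * ?B))"
        "M k0 0 * (P k ! 1 * ?B) \<le> M k0 0 * (C * (P k ! 0 * ?A))"
        by (simp_all only: q(3,4) mult_ac)
      then have M: "P k ! 0 * ?A \<le> C * (P k ! 1 * ?B)" "P k ! 1 * ?B \<le> C * (P k ! 0 * ?A)"
        using mass_pos[of k0 0] by simp_all
      have "?A \<le> C ^ 2 * ?B"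
        by (rule cancel_weights[OF pos(1) AB(2) _ ratio(2) M(1)]) (use C in simp)
      then show "?A \<le> 4 * C ^ 4 * ?B" using mult_right_mono[OF C4(2) AB(2)] by simp
      have "?B \<le> C ^ 2 * ?A"
        by (rule cancel_weights[OF pos(2) AB(1) _ ratio(1) M(2)]) (use C in simp)
      then have "?B \<le> 4 * C ^ 4 * ?A" using mult_right_mono[OF C4(2) AB(1)] by simp
      then show "1 / (4 * C ^ 4) * ?B \<le> ?A" using C4(3) by (simp add: pos_divide_le_eq mult.commute)
    }
    define K where "K = k + m_data n c k - 1"
    have K: "Suc K = k + m_data n c k" "K = Suc k0 + (m_data n c k - 1)" "eps k < len K"
      using m k by (auto simp: K_def)
    note s = s_data_spec[OF kL K(1)]
    have "s_uniform (4 * C ^ 4) (s_data n c k) (P (Suc K) @ P (Suc K))"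
      by (rule append[OF s(1,2) K(2)]) (use s K k in auto)
    then show "s_uniform (4 * C ^ 4) (s_data n c k) (P (k + m_data n c k) @ P (k + m_data n c k))"
      using K(1) by simp
  qed
qed

text \<open>If the gap stems from siblings of level \<open>k\<close> and the neighbours are of level \<open>k + t\<close>, then \<open>t < m\<^sub>k\<close> because
  the gap is shorter than the neighbours. Condition (a) for \<open>t\<close> (for \<open>t = 0\<close> both products are empty)
  and uniformity at level \<open>k\<close> give the masses. For the children, condition (a) or (b) is
  used according as \<open>t + 1 < m\<^sub>k\<close> or \<open>t + 1 = m\<^sub>k\<close>; in the latter case the bound on
  the gap implies \<open>s\<^sub>k \<le> l\<close>.\<close>

lemma adjacent_balance_if_edge_condition:
  assumes C: "1 < C" and E: "edge_condition n c P C"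
    and q: "Suc q < N K" "gap K q < len K"
  shows "M K q \<le> C ^ 2 * M K (Suc q)" "M K (Suc q) \<le> C ^ 2 * M K q"
    and "\<lbrakk>1 \<le> l; l \<le> n (Suc K);
      gap K q < real l * (len (Suc K) + eps (Suc K)) + len (Suc K)\<rbrakk> \<Longrightarrow>
      sum ((!) (P (Suc K))) {0..<l} \<le> C * sum ((!) (P (Suc K))) {n (Suc K) - l..<n (Suc K)} \<and>
      sum ((!) (P (Suc K))) {n (Suc K) - l..<n (Suc K)} \<le> C * sum ((!) (P (Suc K))) {0..<l}"
proof -
  obtain k0 t Q i where *: "K = Suc k0 + t" "Suc i < n (Suc k0)" "gap K q = eps (Suc k0)"
     "M K q = M k0 Q * P (Suc k0) ! i * (\<Prod>j=1..t. P (Suc k0 + j) ! (n (Suc k0 + j) - 1))"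
     "M K (Suc q) = M k0 Q * P (Suc k0) ! Suc i * (\<Prod>j=1..t. P (Suc k0 + j) ! 0)"
    using adjacent_pair_from_siblings[OF q(1)] by blast
  define k where "k = Suc k0"
  have K: "K = k + t" using * by (simp add: k_def)
  have kL: "k \<in> Lam n c" using q(2) * len_antimono[of k K] by (simp add: Lam_def k_def)
  note m = m_data_spec[OF kL]
  have tm: "t < m_data n c k"
  proof (rule ccontr)
    assume "\<not> ?thesis"
    then have "len K \<le> len (k + m_data n c k)" unfolding K by (intro len_antimono) auto
    then show False using m(2) q(2) * by (simp add: k_def)
  qed
  let ?A = "\<Prod>j=1..t. P (k + j) ! (n (k + j) - 1)" and ?B = "\<Prod>j=1..t. P (k + j) ! 0"
  have "0 < P (k + j) ! 0" "0 < P (k + j) ! (n (k + j) - 1)" for j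
    using p_pos[of 0 "k0 + j"] p_pos[of "n (k + j) - 1" "k0 + j"] n_pos[of "k0 + j"] k_def by auto
  then have AB0: "0 \<le> ?A" "0 \<le> ?B" by (auto intro!: prod_nonneg intro: less_imp_le)
  have AB: "?A \<le> C * ?B" "?B \<le> C * ?A"
  proof -
    have "1 / C * ?B \<le> ?A \<and> ?A \<le> C * ?B"
    proof (cases "t = 0")
      case False
      then show ?thesis using E kL tm unfolding edge_condition_def by simp
    qed (use C in auto)
    then show "?A \<le> C * ?B" "?B \<le> C * ?A" using C by (auto simp: pos_divide_le_eq mult.commute)
  qed
  have U: "block_uniform C 1 (n k) ((!) (P k))"
    using E uniform_vector_iff[of C k0] C by (simp add: edge_condition_def k_def)
  have ratio: "P k ! i \<le> C * P k ! Suc i" "P k ! Suc i \<le> C * P k ! i"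
    using block_uniformD[OF U, of 1 i "Suc i"] block_uniformD[OF U, of 1 "Suc i" i] *(2) k_def by auto
  have pos: "0 < P k ! i" "0 < P k ! Suc i" using p_pos[of _ k0] *(2) k_def by auto
  have "P k ! i * ?A \<le> (C * P k ! Suc i) * (C * ?B)"
    using C pos AB0 by (intro mult_mono ratio AB) auto
  then have "M k0 Q * (P k ! i * ?A) \<le> M k0 Q * ((C * P k ! Suc i) * (C * ?B))"
    by (intro mult_left_mono mass_nonneg)
  then show "M K q \<le> C ^ 2 * M K (Suc q)"
    unfolding *(4,5) k_def by (simp add: power2_eq_square mult_ac)
  have "P k ! Suc i * ?B \<le> (C * P k ! i) * (C * ?A)"
    using C pos AB0 by (intro mult_mono ratio AB) auto
  then have "M k0 Q * (P k ! Suc i * ?B) \<le> M k0 Q * ((C * P k ! i) * (C * ?A))"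
    by (intro mult_left_mono mass_nonneg)
  then show "M K (Suc q) \<le> C ^ 2 * M K q"
    unfolding *(4,5) k_def by (simp add: power2_eq_square mult_ac)
  assume l: "1 \<le> l" "l \<le> n (Suc K)" "gap K q < real l * (len (Suc K) + eps (Suc K)) + len (Suc K)"
  have "\<exists>s. 1 \<le> s \<and> s \<le> l \<and> s_uniform C s (P (Suc K) @ P (Suc K))"
  proof (cases "Suc t < m_data n c k")
    case True
    then have "uniform_vector C (P (k + Suc t) @ P (k + Suc t))"
      using E[unfolded edge_condition_def, THEN conjunct2, rule_format, OF kL, THEN conjunct1, rule_format, of "Suc t"]
      by simp
    then show ?thesis using l K by (intro exI[of _ 1]) simp
  next
    case False
    then have mt: "m_data n c k = Suc t" "Suc K = k + m_data n c k" using tm K by auto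
    note s = s_data_spec[OF kL mt(2)]
    let ?h = "len (Suc K) + eps (Suc K)"
    have "real (s_data n c k) * ?h < real l * ?h + ?h"
      using s(3) l(3) * by (simp add: k_def)
    then have "real (s_data n c k) * ?h < (real l + 1) * ?h" by (simp add: distrib_right)
    moreover have "0 < ?h" using len_pos eps_pos by (intro add_pos_pos)
    ultimately have "real (s_data n c k) < real l + 1" by simp
    then have "s_data n c k \<le> l" by simp
    moreover have "s_uniform C (s_data n c k) (P (Suc K) @ P (Suc K))"
      using E kL mt(2) unfolding edge_condition_def by simp
    ultimately show ?thesis using s(1) by blast
  qed
  then obtain s where s: "1 \<le> s" "s \<le> l" "s_uniform C s (P (Suc K) @ P (Suc K))" by blast
  then have "ends_comparable C s (n (Suc K)) ((!) (P (Suc K)))"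
    using s_uniform_append_iff[of C s K] C
    by (intro ends_comparable_if_block_uniform_append) (auto simp: length_P)
  then show "sum ((!) (P (Suc K))) {0..<l} \<le> C * sum ((!) (P (Suc K))) {n (Suc K) - l..<n (Suc K)} \<and>
      sum ((!) (P (Suc K))) {n (Suc K) - l..<n (Suc K)} \<le> C * sum ((!) (P (Suc K))) {0..<l}"
    using s l unfolding ends_comparable_def by blast
qed

lemma balanced_if_edge_condition:
  assumes C: "1 < C" and E: "edge_condition n c P C"
  shows "block_uniform (C ^ 2) 1 (n (Suc k)) ((!) (P (Suc k)))"
    "left_bounded_by_right (C ^ 2) n c (\<lambda>k. (!) (P k))"
    "left_bounded_by_right (C ^ 2) n c (reverse_weights n (\<lambda>k. (!) (P k)))"
proof -
  have C2: "C \<le> C ^ 2" using self_le_power[of C 2] C by simp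
  have "block_uniform C 1 (n (Suc k)) ((!) (P (Suc k)))"
    using E uniform_vector_iff[of C k] C by (simp add: edge_condition_def)
  then show "block_uniform (C ^ 2) 1 (n (Suc k)) ((!) (P (Suc k)))"
    by (rule block_uniform_mono[OF _ C2 order_refl weights_nonneg])
  have up: "x \<le> C ^ 2 * sum ((!) (P (Suc k))) {a..<b}"
    if "x \<le> C * sum ((!) (P (Suc k))) {a..<b}" "b \<le> n (Suc k)" for x a b k
  proof -
    have "0 \<le> sum ((!) (P (Suc k))) {a..<b}" using that weights_nonneg by (auto intro!: sum_nonneg)
    then show ?thesis using that mult_right_mono[OF C2] by fastforce
  qed
  note adj = adjacent_balance_if_edge_condition[OF C E]
  show "left_bounded_by_right (C ^ 2) n c (\<lambda>k. (!) (P k))"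
    unfolding left_bounded_by_right_def
  proof (intro allI impI conjI; elim conjE)
    fix k q assume q: "Suc q < N k" "gap k q < len k"
    show "M k q \<le> C ^ 2 * M k (Suc q)" by (rule adj(1)[OF q])
    fix l assume l: "1 \<le> l" "l \<le> n (Suc k)"
      "gap k q < real l * (len (Suc k) + eps (Suc k)) + len (Suc k)"
    show "sum ((!) (P (Suc k))) {n (Suc k) - l..<n (Suc k)} \<le> C ^ 2 * sum ((!) (P (Suc k))) {0..<l}"
      by (rule up) (use adj(3)[OF q l] l in auto)
  qed
  show "left_bounded_by_right (C ^ 2) n c (reverse_weights n (\<lambda>k. (!) (P k)))"
    unfolding left_bounded_by_right_reverse_iff
  proof (intro allI impI conjI; elim conjE)
    fix k q assume q: "Suc q < N k" "gap k q < len k"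
    show "M k (Suc q) \<le> C ^ 2 * M k q" by (rule adj(2)[OF q])
    fix l assume l: "1 \<le> l" "l \<le> n (Suc k)"
      "gap k q < real l * (len (Suc k) + eps (Suc k)) + len (Suc k)"
    show "sum ((!) (P (Suc k))) {0..<l} \<le> C ^ 2 * sum ((!) (P (Suc k))) {n (Suc k) - l..<n (Suc k)}"
      by (rule up) (use adj(3)[OF q l] l in auto)
  qed
qed

end

section \<open>The determined measure\<close>

locale cantor_measure = cantor_vectors +
  fixes \<mu> :: "real measure"
  assumes determined: "determined_measure n c P \<mu>"
begin

abbreviation E where "E \<equiv> cantor_set n c"

sublocale prob_space \<mu>
  using determined by (simp add: determined_measure_def)

lemma sets_\<mu>: "sets \<mu> = sets (restrict_space borel E)"
  using determined by (simp add: determined_measure_def)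

lemma space_\<mu>: "space \<mu> = E"
  using sets_eq_imp_space_eq[OF sets_\<mu>] by (simp add: space_restrict_space)

lemma borel_Int_in_sets: "A \<in> sets borel \<Longrightarrow> A \<inter> E \<in> sets \<mu>"
  unfolding sets_\<mu> sets_restrict_space by blast

abbreviation comp where "comp k q \<equiv> {lft k q..lft k q + len k} \<inter> E"

lemma comp_in_sets: "comp k q \<in> sets \<mu>"
  by (rule borel_Int_in_sets) simp

lemma measure_comp: "q < N k \<Longrightarrow> measure \<mu> (comp k q) = M k q"
proof (induction k arbitrary: q)
  case 0
  have "E \<subseteq> {0..1}" using cantor_set_iff by (auto simp: left_end.simps dest!: spec[of _ 0])
  then have "comp 0 q = space \<mu>" unfolding space_\<mu> by (auto simp: left_end.simps)
  then show ?case using prob_space by (simp add: mass.simps)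
next
  case (Suc k)
  let ?Q = "q div n (Suc k)" and ?i = "q mod n (Suc k)"
  have Q: "?Q < N k" by (rule parent_less[OF Suc.prems])
  have "word_of n k ?Q \<in> words n (Suc k - 1)" using Q by (simp add: words_eq_word_of)
  moreover have "Suc ?i \<in> {1..n (Suc k)}" using n_pos[of k] by (simp add: Suc_le_eq)
  moreover have "\<And>w i. w \<in> words n (Suc k - 1) \<Longrightarrow> i \<in> {1..n (Suc k)} \<Longrightarrow>
      measure \<mu> (word_interval n c (w @ [i]) \<inter> E) =
      P (Suc k) ! (i - 1) * measure \<mu> (word_interval n c w \<inter> E)"
    using determined by (simp add: determined_measure_def)
  ultimately have "measure \<mu> (word_interval n c (word_of n k ?Q @ [Suc ?i]) \<inter> E) =
      P (Suc k) ! (Suc ?i - 1) * measure \<mu> (word_interval n c (word_of n k ?Q) \<inter> E)" by blast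
  then show ?case
    using Suc.IH[OF Q] word_interval_word_of[of n c "Suc k" q] word_interval_word_of[of n c k ?Q]
    by (simp add: mass.simps)
qed

lemma ball_in_sets: "ball x r \<inter> E \<in> sets \<mu>"
  by (rule borel_Int_in_sets) simp

sublocale cantor_masses n c "\<lambda>k. (!) (P k)" "\<lambda>x r. measure \<mu> (ball x r \<inter> E)"
proof unfold_locales
  fix x r k
  let ?Q = "{q. q < N k \<and> lft k q < x + r \<and> x - r < lft k q + len k}"
  have "ball x r \<inter> E \<subseteq> (\<Union>q\<in>?Q. comp k q)"
  proof
    fix y assume y: "y \<in> ball x r \<inter> E"
    then obtain q where q: "q < N k" "lft k q \<le> y" "y \<le> lft k q + len k"
      using cantor_setE by blast
    moreover have "y < x + r" "x - r < y" using y by (auto simp: dist_real_def)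
    ultimately have "q \<in> ?Q" by auto
    then show "y \<in> (\<Union>q\<in>?Q. comp k q)" using q y by auto
  qed
  then have "measure \<mu> (ball x r \<inter> E) \<le> measure \<mu> (\<Union>q\<in>?Q. comp k q)"
    by (rule finite_measure_mono) (intro sets.finite_UN comp_in_sets, simp)
  also have "\<dots> \<le> (\<Sum>q\<in>?Q. measure \<mu> (comp k q))"
    using comp_in_sets by (intro finite_measure_subadditive_finite) auto
  also have "\<dots> = sum (M k) ?Q" by (rule sum.cong) (auto simp: measure_comp)
  finally show "measure \<mu> (ball x r \<inter> E) \<le> sum (M k) ?Q" .
  let ?R = "{q. q < N k \<and> x - r < lft k q \<and> lft k q + len k < x + r}"
  have "sum (M k) ?R = (\<Sum>q\<in>?R. measure \<mu> (comp k q))"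
    by (rule sum.cong) (auto simp: measure_comp)
  also have "\<dots> = measure \<mu> (\<Union>q\<in>?R. comp k q)"
  proof (rule finite_measure_finite_Union[symmetric])
    show "disjoint_family_on (comp k) ?R"
      unfolding disjoint_family_on_def
    proof (intro ballI impI)
      fix q q' assume "q \<in> ?R" "q' \<in> ?R" "q \<noteq> q'"
      then show "comp k q \<inter> comp k q' = {}"
        using lft_less[of q q' k] lft_less[of q' q k] by (cases "q < q'") auto
    qed
  qed (use comp_in_sets in auto)
  also have "\<dots> \<le> measure \<mu> (ball x r \<inter> E)"
    using ball_in_sets by (intro finite_measure_mono) (auto simp: dist_real_def)
  finally show "sum (M k) ?R \<le> measure \<mu> (ball x r \<inter> E)" .
qed

lemma measure_ball_pos:
  assumes "x \<in> E" "0 < r"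
  shows "0 < measure \<mu> (ball x r \<inter> E)"
proof -
  obtain k where k: "len k < r" using ex_len_less[OF assms(2)] by blast
  obtain q where q: "q < N k" "lft k q \<le> x" "x \<le> lft k q + len k" using cantor_setE[OF assms(1)] .
  have "sum (M k) {q..<Suc q} \<le> measure \<mu> (ball x r \<inter> E)"
    by (rule V_ge_block) (use q k in auto)
  then show ?thesis using mass_pos[of k q] by simp
qed

text \<open>All masses of balls are positive and finite, so only the inequality between them remains.\<close>

lemma doubling_on_iff:
  "doubling_on E \<mu> \<longleftrightarrow> (\<exists>D\<ge>1. \<forall>x\<in>E. \<forall>r>0.
     measure \<mu> (ball x (2 * r) \<inter> E) \<le> D * measure \<mu> (ball x r \<inter> E))"
proof -
  have "0 < emeasure \<mu> (ball x (2 * r) \<inter> E) \<and>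
      emeasure \<mu> (ball x (2 * r) \<inter> E) \<le> ennreal D * emeasure \<mu> (ball x r \<inter> E) \<and>
      ennreal D * emeasure \<mu> (ball x r \<inter> E) < \<infinity> \<longleftrightarrow>
      measure \<mu> (ball x (2 * r) \<inter> E) \<le> D * measure \<mu> (ball x r \<inter> E)"
    if "1 \<le> D" "x \<in> E" "0 < r" for D x r
    using measure_ball_pos[of x "2 * r"] that
    by (simp add: emeasure_eq_measure ennreal_less_iff ennreal_mult[symmetric] ennreal_le_iff
        ennreal_mult_less_top)
  then show ?thesis unfolding doubling_on_def using sets_\<mu> by (simp cong: conj_cong)
qed

lemma doubling_on_iff_edge_condition: "doubling_on E \<mu> \<longleftrightarrow> (\<exists>C>1. edge_condition n c P C)"
proof
  assume "doubling_on E \<mu>"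
  then obtain D where D: "1 \<le> D" "\<And>x r. x \<in> E \<Longrightarrow> 0 < r \<Longrightarrow>
      measure \<mu> (ball x (2 * r) \<inter> E) \<le> D * measure \<mu> (ball x r \<inter> E)"
    unfolding doubling_on_iff by blast
  interpret doubling_masses n c "\<lambda>k. (!) (P k)" "\<lambda>x r. measure \<mu> (ball x r \<inter> E)" D
    by unfold_locales (use D in auto)
  have C: "1 < 3 * D ^ 40" using one_le_power[OF D(1), of 40] by linarith
  have "edge_condition n c P (4 * (3 * D ^ 40) ^ 4)"
    by (rule edge_condition_if_balanced[OF C balanced_if_doubling])
  moreover have "1 < 4 * (3 * D ^ 40) ^ 4" using one_le_power[of "3 * D ^ 40" 4] C by linarith
  ultimately show "\<exists>C>1. edge_condition n c P C" by blast
next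
  assume "\<exists>C>1. edge_condition n c P C"
  then obtain C where C: "1 < C" "edge_condition n c P C" by blast
  have C2: "1 \<le> C ^ 2" using C(1) by simp
  interpret balanced_masses n c "\<lambda>k. (!) (P k)" "\<lambda>x r. measure \<mu> (ball x r \<inter> E)" "C ^ 2"
    by unfold_locales (rule C2 balanced_if_edge_condition[OF C])+
  have "1 \<le> 624 * (C ^ 2) ^ 16" using one_le_power[OF C2, of 16] by linarith
  then show "doubling_on E \<mu>" unfolding doubling_on_iff using doubling_if_balanced by blast
qed

end

theorem theorem1:
  fixes n :: "nat \<Rightarrow> nat" and c :: "nat \<Rightarrow> real" and P :: "nat \<Rightarrow> real list"
    and \<mu> :: "real measure"
  assumes "cantor_parameters n c"
    and "\<And>k. k \<ge> 1 \<Longrightarrow> positive_probability_vector (P k)"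
    and "matching n P"
    and "determined_measure n c P \<mu>"
  shows "doubling_on (cantor_set n c) \<mu> \<longleftrightarrow>
    (\<exists>C>1. (\<forall>k\<ge>1. uniform_vector C (P k)) \<and>
      (\<forall>k\<in>Lam n c.
        (\<forall>t. 1 \<le> t \<and> t < m_data n c k \<longrightarrow>
          uniform_vector C (P (k + t) @ P (k + t)) \<and>
          1 / C * (\<Prod>j=1..t. P (k + j) ! 0) \<le> (\<Prod>j=1..t. P (k + j) ! (n (k + j) - 1)) \<and>
          (\<Prod>j=1..t. P (k + j) ! (n (k + j) - 1)) \<le> C * (\<Prod>j=1..t. P (k + j) ! 0)) \<and>
        s_uniform C (s_data n c k) (P (k + m_data n c k) @ P (k + m_data n c k))))"
proof -
  interpret cantor_measure n c P \<mu> by unfold_locales (use assms in auto)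
  show ?thesis
    using doubling_on_iff_edge_condition unfolding edge_condition_def .
qed

end
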